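(* (Schläfli differential formula on simplices based on edge lengths.) Let $k\ge2$, let $G$ be a $k$-simplex in $\mathbb{S}^d$ or $\mathbb{H}^d$, of constant curvature $\kappa$, with vertices $B_1,\dots,B_{k+1}$, and let $F_{ij}$ be the $(k-2)$-face $G\setminus\{B_i,B_j\}$. Then, regarding $V_k(G)$ as a function of the edge lengths of $G$, $$2\cdot k!\,\|G\|\,dV_k(G)=\sum_{i<j}\|F_{ij}\|\,g_{F_{ij}}(B_i,B_j)\,d\,\overrightarrow{B_iB_j}^2,$$ where $g_{F_{ij}}(B_i,B_j)$ is given explicitly by $$\kappa\,\|F_{ij}\|\,g_{F_{ij}}(B_i,B_j)=k\,(k-2)!\sum_{p<q}R^{pq}_{ij}(G)\,\|F_{pq}\|\,V_{k-2}(F_{pq}).$$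
   Context: Spaces: $\mathbb{S}^d\subset\mathbb{R}^{d+1}$ is the unit sphere ($\kappa=1$); $\mathbb{H}^d=\{x\in\mathbb{R}^{d,1}: x\cdot x=-1,\ x_0>0\}$ ($\kappa=-1$), with $x\cdot y=-x_0y_0+x_1y_1+\cdots+x_dy_d$ on $\mathbb{R}^{d,1}$. Points are vectors of the ambient space, $\overrightarrow{PQ}=Q-P$, and $\overrightarrow{PQ}^2=\overrightarrow{PQ}\cdot\overrightarrow{PQ}$ in the ambient bilinear form. Simplices are non-degenerate. $V_r$ is $r$-dimensional volume ($V_0$ of a point is $1$). For a simplex $F$ with vertices $C_1,\dots,C_m$, $\|F\|:=|\det(C_p\cdot C_q)_{1\le p,q\le m}|^{1/2}$. Definition of $g_F$: let $F$ be an $r$-simplex and $P,Q$ points such that the join $\hat F$ of $F$ with the segment $PQ$ is a non-degenerate $(r+2)$-simplex; let $\theta_F$ be the dihedral angle of $\hat F$ at $F$. Let $\theta_F$ vary while all edge lengths of $\hat F$ except that of $PQ$ are fixed. Then $g_F(P,Q):=(r+2)!\,dV_{r+2}(\hat F)/d\theta_F$. Coefficients: for a simplex $H$ whose vertices are some of the $B_s$ and a vertex $B_i$ of $H$, project $B_i$ orthogonally onto the linear span of the other vertices of $H$ and write the projection as $\sum_{s\ne i}\beta_sB_s$ (over the other vertices of $H$); set $R^i_j(H):=-\beta_j$ for $j\ne i$ and $R^i_i(H):=1$. Let $E_j$ be the $(k-1)$-face $G\setminus\{B_j\}$, and for $i\neq j$ set $R^i_j(E_j):=0$. For $p\ne q$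 and $s\ne t$, $$R^{pq}_{st}(G):=R^p_s(G)R^q_t(E_p)+R^q_s(G)R^p_t(E_q).$$ *)

theory Defs
  imports "HOL-Analysis.Analysis"
begin

text \<open>
  Both geometries live in the ambient space \<open>real \<times> 'a\<close> with \<open>DIM('a) = d\<close>; the first component
  is the coordinate \<open>x\<^sub>0\<close>.  For \<open>\<kappa> = 1\<close> the form below is the Euclidean inner product of
  \<open>\<real>\<^bsup>d+1\<^esup>\<close>, for \<open>\<kappa> = -1\<close> it is the Lorentzian form of \<open>\<real>\<^bsup>d,1\<^esup>\<close>.
\<close>

definition bform :: "real \<Rightarrow> real \<times> 'a::euclidean_space \<Rightarrow> real \<times> 'a \<Rightarrow> real" where
  "bform \<kappa> x y = \<kappa> * fst x * fst y + snd x \<bullet> snd y"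

definition model_space :: "real \<Rightarrow> (real \<times> 'a::euclidean_space) set" where
  "model_space \<kappa> = {x. bform \<kappa> x x = \<kappa> \<and> (\<kappa> = -1 \<longrightarrow> fst x > 0)}"

definition sqdist :: "real \<Rightarrow> real \<times> 'a::euclidean_space \<Rightarrow> real \<times> 'a \<Rightarrow> real" where
  "sqdist \<kappa> P Q = bform \<kappa> (Q - P) (Q - P)"

definition geodist :: "real \<Rightarrow> real \<times> 'a::euclidean_space \<Rightarrow> real \<times> 'a \<Rightarrow> real" where
  "geodist \<kappa> P Q = (if \<kappa> = 1 then arccos (bform \<kappa> P Q) else arcosh (- bform \<kappa> P Q))"

text \<open>
  A simplex is given by a family \<open>B\<close> of points and the finite set \<open>I\<close> of indices of its
  vertices; its faces are given by the subsets of \<open>I\<close>, and its dimension is \<open>card I - 1\<close>.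
\<close>

definition nondeg_simplex ::
    "real \<Rightarrow> 'v::{finite,linorder} set \<Rightarrow> ('v \<Rightarrow> real \<times> 'a::euclidean_space) \<Rightarrow> bool" where
  "nondeg_simplex \<kappa> I B \<longleftrightarrow> B ` I \<subseteq> model_space \<kappa> \<and> inj_on B I \<and> independent (B ` I)"

text \<open>
  The determinant of the matrix \<open>(A p q)\<close> with rows and columns restricted to \<open>I\<close>: that submatrix
  is completed by an identity block on the complement of \<open>I\<close>, which does not change the determinant.
\<close>

definition subdet :: "'v::finite set \<Rightarrow> ('v \<Rightarrow> 'v \<Rightarrow> real) \<Rightarrow> real" where
  "subdet I A =
     det (\<chi> p q. if p \<in> I \<and> q \<in> I then A p q else if p = q then 1 else 0)"

definition gram_norm :: "real \<Rightarrow> 'v::finite set \<Rightarrow> ('v \<Rightarrow> real \<times> 'a::euclidean_space) \<Rightarrow> real" where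
  "gram_norm \<kappa> I B = sqrt \<bar>subdet I (\<lambda>p q. bform \<kappa> (B p) (B q))\<bar>"

text \<open>
  Volume: the Riemannian volume \<open>\<integral> sqrt (det (\<partial>\<^sub>p \<phi> \<cdot> \<partial>\<^sub>q \<phi>))\<close> of a parametrised piece \<open>\<phi>\<close>, for the
  metric induced by the ambient form.  A simplex is parametrised by radially projecting the affine
  simplex with the same vertices to the model space; the parameters are the barycentric coordinates
  other than that of the vertex \<open>Min I\<close>.  For a single vertex the parameter space is one point of
  mass 1, so the volume is 1.
\<close>

definition param_volume ::
    "real \<Rightarrow> 'v::finite set \<Rightarrow> ('v \<Rightarrow> real) set \<Rightarrow> (('v \<Rightarrow> real) \<Rightarrow> real \<times> 'a::euclidean_space) \<Rightarrow> real"
  where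
  "param_volume \<kappa> J D \<phi> =
     (let D\<phi> = (\<lambda>p t. vector_derivative (\<lambda>s. \<phi> (t(p := s))) (at (t p)))
      in LINT t : D | (\<Pi>\<^sub>M j\<in>J. lborel). sqrt (subdet J (\<lambda>p q. bform \<kappa> (D\<phi> p t) (D\<phi> q t))))"

definition radial_proj :: "real \<Rightarrow> real \<times> 'a::euclidean_space \<Rightarrow> real \<times> 'a" where
  "radial_proj \<kappa> x = (1 / sqrt \<bar>bform \<kappa> x x\<bar>) *\<^sub>R x"

definition simplex_volume ::
    "real \<Rightarrow> 'v::{finite,linorder} set \<Rightarrow> ('v \<Rightarrow> real \<times> 'a::euclidean_space) \<Rightarrow> real" where
  "simplex_volume \<kappa> I B =
     (let m = Min I; J = I - {m}
      in param_volume \<kappa> J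
           {t \<in> J \<rightarrow>\<^sub>E UNIV. (\<forall>j\<in>J. 0 \<le> t j) \<and> (\<Sum>j\<in>J. t j) \<le> 1}
           (\<lambda>t. radial_proj \<kappa> ((1 - (\<Sum>j\<in>J. t j)) *\<^sub>R B m + (\<Sum>j\<in>J. t j *\<^sub>R B j))))"

definition orth_proj ::
    "real \<Rightarrow> (real \<times> 'a::euclidean_space) set \<Rightarrow> real \<times> 'a \<Rightarrow> real \<times> 'a" where
  "orth_proj \<kappa> S x = (THE y. y \<in> span S \<and> (\<forall>s \<in> span S. bform \<kappa> (x - y) s = 0))"

text \<open>
  The dihedral angle of the simplex at its codimension-2 face \<open>I - {p, q}\<close>: the angle between the
  two facets \<open>I - {q}\<close> and \<open>I - {p}\<close>, measured in the plane normal to that face.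
\<close>

definition dihedral_angle ::
    "real \<Rightarrow> 'v set \<Rightarrow> ('v \<Rightarrow> real \<times> 'a::euclidean_space) \<Rightarrow> 'v \<Rightarrow> 'v \<Rightarrow> real" where
  "dihedral_angle \<kappa> I B p q =
     (let F = B ` (I - {p, q});
          u = B p - orth_proj \<kappa> F (B p);
          v = B q - orth_proj \<kappa> F (B q)
      in arccos (bform \<kappa> u v / (sqrt (bform \<kappa> u u) * sqrt (bform \<kappa> v v))))"

text \<open>
  \<open>volume_of_angle \<kappa> I B p q \<theta>\<close> is the volume of the simplices that have the same edge lengths as
  \<open>B\<close>, except possibly for the edge \<open>p q\<close>, and dihedral angle \<open>\<theta>\<close> at the face \<open>I - {p, q}\<close>.
  With \<open>F = I - {p, q}\<close> and \<open>P = B p\<close>, \<open>Q = B q\<close>, the value \<open>g_face \<kappa> I B p q\<close> is \<open>g\<^sub>F(P, Q)\<close>;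
  the factorial is that of the dimension of the join of \<open>F\<close> with \<open>P Q\<close>.
\<close>

definition volume_of_angle ::
    "real \<Rightarrow> 'v::{finite,linorder} set \<Rightarrow> ('v \<Rightarrow> real \<times> 'a::euclidean_space) \<Rightarrow>
       'v \<Rightarrow> 'v \<Rightarrow> real \<Rightarrow> real" where
  "volume_of_angle \<kappa> I B p q \<theta> =
     (THE V. \<exists>B' :: 'v \<Rightarrow> real \<times> 'a. nondeg_simplex \<kappa> I B'
        \<and> (\<forall>a\<in>I. \<forall>b\<in>I. a \<noteq> b \<and> {a, b} \<noteq> {p, q} \<longrightarrow>
              geodist \<kappa> (B' a) (B' b) = geodist \<kappa> (B a) (B b))
        \<and> dihedral_angle \<kappa> I B' p q = \<theta>
        \<and> V = simplex_volume \<kappa> I B')"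

definition g_face ::
    "real \<Rightarrow> 'v::{finite,linorder} set \<Rightarrow> ('v \<Rightarrow> real \<times> 'a::euclidean_space) \<Rightarrow>
       'v \<Rightarrow> 'v \<Rightarrow> real" where
  "g_face \<kappa> I B p q =
     fact (card I - 1) * deriv (volume_of_angle \<kappa> I B p q) (dihedral_angle \<kappa> I B p q)"

text \<open>
  \<open>Rcoef \<kappa> B H i j\<close> is \<open>R\<^sup>i\<^sub>j(H)\<close>; the value 0 for \<open>j \<notin> H\<close> covers the convention
  \<open>R\<^sup>i\<^sub>j(E\<^sub>j) = 0\<close>.
\<close>

definition Rcoef ::
    "real \<Rightarrow> ('v \<Rightarrow> real \<times> 'a::euclidean_space) \<Rightarrow> 'v set \<Rightarrow> 'v \<Rightarrow> 'v \<Rightarrow> real" where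
  "Rcoef \<kappa> B H i j =
     (if j = i then 1
      else if j \<in> H
      then - representation (B ` (H - {i})) (orth_proj \<kappa> (B ` (H - {i})) (B i)) (B j)
      else 0)"

definition Rcoef2 ::
    "real \<Rightarrow> ('v \<Rightarrow> real \<times> 'a::euclidean_space) \<Rightarrow> 'v set \<Rightarrow> 'v \<Rightarrow> 'v \<Rightarrow> 'v \<Rightarrow> 'v \<Rightarrow> real" where
  "Rcoef2 \<kappa> B H p q s t =
     Rcoef \<kappa> B H p s * Rcoef \<kappa> B (H - {p}) q t + Rcoef \<kappa> B H q s * Rcoef \<kappa> B (H - {q}) p t"

text \<open>
  Quantities of a simplex with vertex index type \<open>'v\<close> as functions of its edge lengths: only the
  entries \<open>L $ i $ j\<close> with \<open>i < j\<close> are used, one for each edge, so that the edge lengths are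
  independent coordinates.
\<close>

definition edge_lengths ::
    "real \<Rightarrow> ('v::{finite,linorder} \<Rightarrow> real \<times> 'a::euclidean_space) \<Rightarrow> ((real, 'v) vec, 'v) vec" where
  "edge_lengths \<kappa> B = (\<chi> i j. geodist \<kappa> (B i) (B j))"

definition as_function_of_lengths ::
    "real \<Rightarrow> (('v::{finite,linorder} \<Rightarrow> real \<times> 'a::euclidean_space) \<Rightarrow> real) \<Rightarrow>
       ((real, 'v) vec, 'v) vec \<Rightarrow> real" where
  "as_function_of_lengths \<kappa> \<Phi> L =
     (THE y. \<exists>B. nondeg_simplex \<kappa> UNIV B
        \<and> (\<forall>i j. i < j \<longrightarrow> edge_lengths \<kappa> B $ i $ j = L $ i $ j)
        \<and> y = \<Phi> B)"

end

(* With A the Gram matrix of the vertices, M = \<kappa> A and Q(t) = \<Sum> M i j t i t j, polar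
   coordinates along the cone over the simplex show that V_k is a constant times
   sqrt |det A| * \<integral> exp (- Q) over the nonnegative orthant; the integrand decays in both geometries
   because Q is coercive on the orthant.  Differentiating in A i j produces second moments of exp (- Q),
   and two integrations by parts (with M^-1 = \<kappa> N, N = A^-1) move them to the boundary faces of
   codimension 2, the terms of codimension 0 cancelling against the derivative of the determinant.
   Cramer's rule turns the resulting products of entries of N into the coefficients R, since
   R^i_j = N i j / N i i.  Finally A i j is a constant plus a multiple of the cosine of the dihedral
   angle opposite to it, so dV/d\<theta> and dV/dA i j differ by the factor - ||G|| / ||F_ij||. *)
theory Submission
  imports Defs "HOL-Probability.Distributions" "HOL-Real_Asymp.Real_Asymp"
begin

section \<open>The ambient form and Gram determinants\<close>

text \<open>Passing to the cone replaces a moving simplex by a fixed domain, the orthant: only the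
  integrand depends on the Gram matrix, and boundary terms are orthants of faces. The resulting
  function of matrices is differentiable near the Gram matrix of any simplex. The obstacle is
  geometric. Volume as a function of lengths, or of one angle, is a definite description over
  simplices that exist, so all data near the given ones must first be realised by a simplex in the
  same ambient space. Uniqueness is cheaper: lengths determine the Gram matrix, and that determines
  the volume. The constants: the integrals of r^k and r^(k-2) against exp (- r^2) over the half-line
  have quotient (k - 1)/2, which takes k - 1 out of k! and leaves k (k - 2)!; the squared chord is 2
  \<kappa> - 2 A i j, whose factor -2 meets the negative factor that belongs to the angle. Signs of
  determinants do no harm, since a Gram determinant and that of a nonempty facet differ by a
  positive factor.\<close>

lemma bform_commute: "bform \<kappa> x y = bform \<kappa> y x"
  by (simp add: bform_def inner_commute mult_ac)

lemma bform_add_left: "bform \<kappa> (x + y) z = bform \<kappa> x z + bform \<kappa> y z"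
  and bform_add_right: "bform \<kappa> z (x + y) = bform \<kappa> z x + bform \<kappa> z y"
  and bform_diff_left: "bform \<kappa> (x - y) z = bform \<kappa> x z - bform \<kappa> y z"
  and bform_diff_right: "bform \<kappa> z (x - y) = bform \<kappa> z x - bform \<kappa> z y"
  and bform_scaleR_left: "bform \<kappa> (a *\<^sub>R x) z = a * bform \<kappa> x z"
  and bform_scaleR_right: "bform \<kappa> z (a *\<^sub>R x) = a * bform \<kappa> z x"
  and bform_zero_left [simp]: "bform \<kappa> 0 z = 0"
  and bform_zero_right [simp]: "bform \<kappa> z 0 = 0"
  by (simp_all add: bform_def algebra_simps)

lemma bform_sum_left: "bform \<kappa> (sum f S) z = (\<Sum>i\<in>S. bform \<kappa> (f i) z)"
  by (induction S rule: infinite_finite_induct) (simp_all add: bform_add_left)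

lemma bform_sum_right: "bform \<kappa> z (sum f S) = (\<Sum>i\<in>S. bform \<kappa> z (f i))"
  by (induction S rule: infinite_finite_induct) (simp_all add: bform_add_right)

lemmas bform_simps = bform_add_left bform_add_right bform_diff_left bform_diff_right
  bform_scaleR_left bform_scaleR_right bform_sum_left bform_sum_right

lemma bform_one: "bform 1 x y = x \<bullet> y"
  by (simp add: bform_def inner_prod_def)

text \<open>For \<kappa> = -1 the hypothesis says that \<open>x\<close> is timelike, and
  Cauchy-Schwarz for the spatial parts then excludes a nonzero \<open>y\<close> with nonpositive
  square. Positivity of altitudes, of tangent vectors and of normals to faces comes from here in
  both geometries at once.\<close>

lemma bform_orthogonal_pos:
  assumes \<kappa>: "\<kappa> = 1 \<or> \<kappa> = -1" and x: "\<kappa> * bform \<kappa> x x > 0"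
    and xy: "bform \<kappa> x y = 0" and y: "y \<noteq> 0"
  shows "bform \<kappa> y y > 0"
proof (cases "\<kappa> = 1")
  case True
  then show ?thesis using y by (simp add: bform_one)
next
  case False
  with \<kappa> have k: "\<kappa> = -1" by simp
  have x0: "snd x \<bullet> snd x < fst x ^ 2" using x by (simp add: k bform_def power2_eq_square)
  have e: "fst x * fst y = snd x \<bullet> snd y" using xy by (simp add: k bform_def)
  have cs: "(snd x \<bullet> snd y)\<^sup>2 \<le> (snd x \<bullet> snd x) * (snd y \<bullet> snd y)" by (rule Cauchy_Schwarz_ineq)
  show ?thesis
  proof (rule ccontr)
    assume "\<not> ?thesis"
    then have yy: "snd y \<bullet> snd y \<le> fst y ^ 2" by (simp add: k bform_def power2_eq_square)
    have "fst x ^ 2 * fst y ^ 2 \<le> (snd x \<bullet> snd x) * (snd y \<bullet> snd y)"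
      using cs by (simp add: e[symmetric] power_mult_distrib)
    also have "\<dots> \<le> (snd x \<bullet> snd x) * fst y ^ 2" by (rule mult_left_mono[OF yy]) simp
    finally have "(fst x ^ 2 - snd x \<bullet> snd x) * fst y ^ 2 \<le> 0" by (simp add: algebra_simps)
    then have "fst y = 0" using x0 by (simp add: mult_le_0_iff)
    moreover have "snd y \<bullet> snd y = 0" using yy inner_ge_zero[of "snd y"] \<open>fst y = 0\<close> by simp
    then have "snd y = 0" by simp
    ultimately show False using y by (simp add: prod_eq_iff)
  qed
qed

section \<open>Determinants of submatrices completed by an identity block\<close>

definition complete_mat :: "'v::finite set \<Rightarrow> ('v \<Rightarrow> 'v \<Rightarrow> real) \<Rightarrow> real^'v^'v" where
  "complete_mat I A = (\<chi> p q. if p \<in> I \<and> q \<in> I then A p q else if p = q then 1 else 0)"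

lemma subdet_det: "subdet I A = det (complete_mat I A)"
  by (simp add: subdet_def complete_mat_def)

lemma subdet_cong: "(\<And>p q. p \<in> I \<Longrightarrow> q \<in> I \<Longrightarrow> A p q = B p q) \<Longrightarrow> subdet I A = subdet I B"
  unfolding subdet_def by (rule arg_cong[of _ _ det]) (simp add: vec_eq_iff)

lemma complete_mat_mult:
  "complete_mat I X ** complete_mat I Y = complete_mat I (\<lambda>p q. \<Sum>k\<in>I. X p k * Y k q)"
proof -
  have "(\<Sum>k\<in>UNIV. (if p \<in> I \<and> k \<in> I then X p k else if p = k then 1 else 0) *
      (if k \<in> I \<and> q \<in> I then Y k q else if k = q then 1 else 0)) =
      (if p \<in> I \<and> q \<in> I then \<Sum>k\<in>I. X p k * Y k q else if p = q then 1 else 0)" for p q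
  proof (cases "p \<in> I")
    case True
    have "(\<Sum>k\<in>UNIV. (if p \<in> I \<and> k \<in> I then X p k else if p = k then 1 else 0) *
      (if k \<in> I \<and> q \<in> I then Y k q else if k = q then 1 else 0)) =
      (\<Sum>k\<in>I. X p k * (if k \<in> I \<and> q \<in> I then Y k q else if k = q then 1 else 0))"
      using True by (intro sum.mono_neutral_cong_right) auto
    also have "\<dots> = (if p \<in> I \<and> q \<in> I then \<Sum>k\<in>I. X p k * Y k q else if p = q then 1 else 0)"
      using True by (auto intro!: sum.neutral)
    finally show ?thesis .
  next
    case False
    then show ?thesis by (auto simp: if_distrib[of "\<lambda>x. x * _"] cong: if_cong)
  qed
  then show ?thesis by (simp add: complete_mat_def matrix_matrix_mult_def vec_eq_iff)
qed

lemma subdet_mult: "subdet I (\<lambda>p q. \<Sum>k\<in>I. X p k * Y k q) = subdet I X * subdet I Y"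
  unfolding subdet_det by (simp add: complete_mat_mult[symmetric] det_mul)

lemma subdet_transpose: "subdet I (\<lambda>p q. X q p) = subdet I X"
proof -
  have "complete_mat I (\<lambda>p q. X q p) = transpose (complete_mat I X)"
    by (auto simp: complete_mat_def transpose_def vec_eq_iff)
  then show ?thesis by (simp add: subdet_det det_transpose)
qed

lemma subdet_empty [simp]: "subdet {} A = 1"
proof -
  have "complete_mat {} A = mat 1" by (simp add: complete_mat_def mat_def vec_eq_iff)
  then show ?thesis by (simp add: subdet_det det_I)
qed

text \<open>Apart from its diagonal entry, row \<open>m\<close> is a combination of the remaining
  unit rows, which contributes nothing to the determinant. Such matrices are the shears that carry
  one Gram family to another.\<close>

lemma subdet_elementary_row:
  fixes m :: "'v::finite"
  assumes "m \<in> I"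
  shows "subdet I (\<lambda>p q. if p = m then r q else if p = q then 1 else 0) = (r m :: real)"
proof -
  define x where "x = (\<Sum>q\<in>I - {m}. r q *s (axis q 1 :: real^'v))"
  have row: "row j (mat 1 :: real^'v^'v) = axis j 1" for j
    by (auto simp: row_def mat_def axis_def vec_eq_iff)
  have "x \<in> vec.span {row j (mat 1 :: real^'v^'v) |j. j \<noteq> m}"
    unfolding x_def by (intro vec.span_sum vec.span_scale vec.span_base) (auto simp: row)
  from det_row_span[OF this]
  have d: "det (\<chi> k. if k = m then axis m 1 + x else (axis k 1 :: real^'v)) = 1"
    unfolding row by (simp add: det_I)
  have s: "x $ q = (if q \<in> I - {m} then r q else 0)" for q
  proof -
    have "x $ q = (\<Sum>i\<in>I - {m}. if q = i then r i else 0)"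
      by (simp add: x_def axis_def if_distrib[of "\<lambda>x. _ * x"] cong: if_cong)
    then show ?thesis by simp
  qed
  have "subdet I (\<lambda>p q. if p = m then r q else if p = q then 1 else 0) =
     det (complete_mat I (\<lambda>p q. if p = m then r q else if p = q then 1 else 0))"
    by (rule subdet_det)
  also have "complete_mat I (\<lambda>p q. if p = m then r q else if p = q then 1 else 0) =
     (\<chi> k. if k = m then r m *s axis m 1 + x else axis k 1)"
    using assms by (auto simp: complete_mat_def vec_eq_iff s axis_def)
  also have "det \<dots> = det (\<chi> k. if k = m then r m *s axis m 1 else (axis k 1 :: real^'v)) +
                       det (\<chi> k. if k = m then x else (axis k 1 :: real^'v))"
    by (rule det_row_add)
  also have "det (\<chi> k. if k = m then r m *s axis m 1 else (axis k 1 :: real^'v)) =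
      r m * det (\<chi> k. if k = m then axis m 1 else (axis k 1 :: real^'v))"
    by (rule det_row_mul)
  also have "(\<chi> k. if k = m then axis m 1 else (axis k 1 :: real^'v)) = mat 1"
    by (auto simp: vec_eq_iff mat_def axis_def)
  \<comment> \<open>Obtained as a difference: adding \<open>x\<close> to the unit row
    \<open>m\<close> does not change the value 1.\<close>
  also have "det (\<chi> k. if k = m then x else (axis k 1 :: real^'v)) = 0"
  proof -
    have "det (\<chi> k. if k = m then axis m 1 + x else (axis k 1 :: real^'v)) =
      det (\<chi> k. if k = m then axis m 1 else (axis k 1 :: real^'v)) +
      det (\<chi> k. if k = m then x else (axis k 1 :: real^'v))" by (rule det_row_add)
    moreover have "(\<chi> k. if k = m then axis m 1 else (axis k 1 :: real^'v)) = mat 1"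
      by (auto simp: vec_eq_iff mat_def axis_def)
    ultimately show ?thesis using d by (simp add: det_I)
  qed
  finally show ?thesis by (simp add: det_I)
qed

lemma subdet_elementary_col:
  assumes "m \<in> I"
  shows "subdet I (\<lambda>p q. if q = m then r p else if p = q then 1 else 0) = (r m :: real)"
proof -
  have "subdet I (\<lambda>p q. if q = m then r p else if p = q then 1 else 0) =
     subdet I (\<lambda>p q. if p = m then r q else if p = q then 1 else 0)"
    by (subst subdet_transpose[symmetric]) (rule subdet_cong, auto)
  then show ?thesis using subdet_elementary_row[OF assms] by simp
qed

text \<open>Pulling \<open>A m m\<close> out of row \<open>m\<close> leaves a unit row there, which
  is exactly the identity completion belonging to \<open>I - {m}\<close>.\<close>

lemma subdet_remove:
  assumes "m \<in> I" and "\<And>q. q \<in> I - {m} \<Longrightarrow> A m q = 0" and "\<And>q. q \<in> I - {m} \<Longrightarrow> A q m = 0"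
  shows "subdet I A = A m m * subdet (I - {m}) A"
proof -
  let ?C = "complete_mat (I - {m}) A"
  have "complete_mat I A = (\<chi> k. if k = m then A m m *s row m ?C else row k ?C)"
    using assms by (auto simp: complete_mat_def row_def vec_eq_iff)
  then have "subdet I A = A m m * det (\<chi> k. if k = m then row m ?C else row k ?C)"
    by (simp add: subdet_det det_row_mul)
  also have "(\<chi> k. if k = m then row m ?C else row k ?C) = ?C"
    by (simp add: vec_eq_iff row_def)
  finally show ?thesis by (simp add: subdet_det)
qed

lemma complete_mat_vec:
  "(complete_mat I A *v x) $ p = (if p \<in> I then \<Sum>q\<in>I. A p q * x $ q else x $ p)"
proof (cases "p \<in> I")
  case True
  have "(\<Sum>q\<in>UNIV. (if p \<in> I \<and> q \<in> I then A p q else if p = q then 1 else 0) * x $ q) =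
      (\<Sum>q\<in>I. A p q * x $ q)"
    using True by (intro sum.mono_neutral_cong_right) auto
  then show ?thesis using True by (simp add: matrix_vector_mult_def complete_mat_def)
next
  case False
  then show ?thesis
    by (simp add: matrix_vector_mult_def complete_mat_def if_distrib[of "\<lambda>x. x * _"] cong: if_cong)
qed

lemma subdet_nonzero:
  assumes "\<And>c. (\<And>p. p \<in> I \<Longrightarrow> (\<Sum>q\<in>I. A p q * c q) = 0) \<Longrightarrow> (\<forall>p\<in>I. c p = 0)"
  shows "subdet I A \<noteq> 0"
proof -
  have "\<exists>B. B ** complete_mat I A = mat 1"
    unfolding matrix_left_invertible_ker
  proof (intro allI impI)
    fix x assume x: "complete_mat I A *v x = 0"
    then have "(complete_mat I A *v x) $ p = 0" for p by simp
    then have e: "(if p \<in> I then \<Sum>q\<in>I. A p q * x $ q else x $ p) = 0" for p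
      unfolding complete_mat_vec .
    have "\<forall>p\<in>I. x $ p = 0" using assms[of "\<lambda>p. x $ p"] e by presburger
    with e show "x = 0" by (metis vec_eq_iff zero_index)
  qed
  then show ?thesis by (metis subdet_det invertible_det_nz invertible_left_inverse)
qed

lemma subdet_inverse:
  assumes "subdet I A \<noteq> 0"
  obtains N where "\<And>i j. i \<in> I \<Longrightarrow> j \<in> I \<Longrightarrow> (\<Sum>l\<in>I. N i l * A l j) = (if i = j then 1 else 0 :: real)"
proof -
  obtain B where B: "B ** complete_mat I A = mat 1"
    using assms by (metis subdet_det invertible_det_nz invertible_left_inverse)
  show ?thesis
  proof (rule that[of "\<lambda>i l. B $ i $ l"])
    fix i j assume ij: "i \<in> I" "j \<in> I"
    have "(\<Sum>l\<in>I. B $ i $ l * A l j) = (\<Sum>l\<in>UNIV. B $ i $ l * (if l \<in> I \<and> j \<in> I then A l j else if l = j then 1 else 0))"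
      using ij by (intro sum.mono_neutral_cong_left) auto
    also have "\<dots> = (B ** complete_mat I A) $ i $ j"
      by (simp add: matrix_matrix_mult_def complete_mat_def)
    finally show "(\<Sum>l\<in>I. B $ i $ l * A l j) = (if i = j then 1 else 0)"
      by (simp add: B mat_def)
  qed
qed

lemma subdet_kernel_trivial:
  assumes "subdet I A \<noteq> 0" and c: "\<And>p. p \<in> I \<Longrightarrow> (\<Sum>q\<in>I. A p q * c q) = 0" and i: "i \<in> I"
  shows "c i = (0 :: real)"
proof -
  obtain N where N: "\<And>i j. i \<in> I \<Longrightarrow> j \<in> I \<Longrightarrow> (\<Sum>l\<in>I. N i l * A l j) = (if i = j then 1 else 0 :: real)"
    using subdet_inverse[OF assms(1)] by blast
  have "c i = (\<Sum>j\<in>I. (if i = j then 1 else 0) * c j)" 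
    using i by (simp add: if_distrib[of "\<lambda>x. x * _"] cong: if_cong)
  also have "\<dots> = (\<Sum>j\<in>I. (\<Sum>l\<in>I. N i l * A l j) * c j)" using N i by simp
  also have "\<dots> = (\<Sum>l\<in>I. N i l * (\<Sum>j\<in>I. A l j * c j))"
    by (simp add: sum_distrib_left sum_distrib_right mult_ac) (rule sum.swap)
  also have "\<dots> = 0" using c by simp
  finally show ?thesis .
qed

text \<open>The matrix is joined to the identity by a path of positive definite matrices.\<close>
lemma subdet_pos:
  assumes pos: "\<And>c. \<exists>p\<in>I. c p \<noteq> 0 \<Longrightarrow> (\<Sum>p\<in>I. \<Sum>q\<in>I. c p * A p q * c q) > (0 :: real)"
  shows "subdet I A > 0"
proof (rule ccontr)
  assume not_pos: "\<not> ?thesis"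
  define P where "P s p q = (1 - s) * (if p = q then 1 else 0) + s * A p q" for s :: real and p q :: 'a
  have P0: "subdet I (P 0) = 1"
  proof -
    have "complete_mat I (P 0) = mat 1" by (simp add: complete_mat_def P_def mat_def vec_eq_iff)
    then show ?thesis by (simp add: subdet_det det_I)
  qed
  have P1: "subdet I (P 1) \<le> 0"
    using not_pos by (simp add: P_def[abs_def])
  have nz: "subdet I (P s) \<noteq> 0" if s: "0 \<le> s" "s \<le> 1" for s
  proof (rule subdet_nonzero, rule ccontr)
    fix c assume c: "\<And>p. p \<in> I \<Longrightarrow> (\<Sum>q\<in>I. P s p q * c q) = 0" and n: "\<not> (\<forall>p\<in>I. c p = 0)"
    have "0 = (\<Sum>p\<in>I. c p * (\<Sum>q\<in>I. P s p q * c q))" using c by simp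
    also have "\<dots> = (\<Sum>p\<in>I. (1 - s) * (c p)\<^sup>2 + s * (\<Sum>q\<in>I. c p * A p q * c q))"
    proof (rule sum.cong[OF refl])
      fix p assume p: "p \<in> I"
      have "(\<Sum>q\<in>I. P s p q * c q) = (\<Sum>q\<in>I. (if p = q then (1 - s) * c q else 0) + s * (A p q * c q))"
        by (rule sum.cong) (auto simp: P_def algebra_simps)
      also have "\<dots> = (1 - s) * c p + s * (\<Sum>q\<in>I. A p q * c q)"
        using p by (simp add: sum.distrib sum_distrib_left)
      finally have "c p * (\<Sum>q\<in>I. P s p q * c q) = c p * ((1 - s) * c p + s * (\<Sum>q\<in>I. A p q * c q))"
        by simp
      also have "\<dots> = (1 - s) * (c p)\<^sup>2 + s * (c p * (\<Sum>q\<in>I. A p q * c q))"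
        by (simp add: algebra_simps power2_eq_square)
      also have "c p * (\<Sum>q\<in>I. A p q * c q) = (\<Sum>q\<in>I. c p * A p q * c q)"
        by (simp add: sum_distrib_left mult.assoc)
      finally show "c p * (\<Sum>q\<in>I. P s p q * c q) = (1 - s) * (c p)\<^sup>2 + s * (\<Sum>q\<in>I. c p * A p q * c q)" .
    qed
    also have "\<dots> = (1 - s) * (\<Sum>p\<in>I. (c p)\<^sup>2) + s * (\<Sum>p\<in>I. \<Sum>q\<in>I. c p * A p q * c q)"
      by (simp add: sum.distrib sum_distrib_left)
    also have "\<dots> > 0"
    proof -
      have a: "(\<Sum>p\<in>I. \<Sum>q\<in>I. c p * A p q * c q) > 0" using pos n by blast
      obtain p where p: "p \<in> I" "c p \<noteq> 0" using n by blast
      have b: "(\<Sum>p\<in>I. (c p)\<^sup>2) > 0" using p by (intro sum_pos2[of I p]) auto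
      show ?thesis
      proof (cases "s = 0")
        case False
        then have "s * (\<Sum>p\<in>I. \<Sum>q\<in>I. c p * A p q * c q) > 0" using a s by simp
        then show ?thesis using b s by (simp add: add_nonneg_pos)
      qed (use b in simp)
    qed
    finally show False by simp
  qed
  have "continuous_on {0..1} (\<lambda>s. subdet I (P s))"
    unfolding subdet_def det_def P_def
    apply simp
    apply (intro continuous_intros)
    subgoal for p i by (cases "i \<in> I \<and> p i \<in> I") (auto simp del: mult_eq_0_iff intro!: continuous_intros)
    done
  then obtain s where "0 \<le> s" "s \<le> 1" "subdet I (P s) = 0"
    using IVT2'[of "\<lambda>s. subdet I (P s)" 1 0 0] P0 P1 by auto
  then show False using nz by blast
qed

text \<open>The new Gram matrix is the product of \<open>T\<close>, the old Gram matrix and the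
  transpose of \<open>T\<close>, so its determinant changes by a square and can never change
  sign.\<close>

lemma subdet_gram_change:
  assumes "\<And>p. p \<in> I \<Longrightarrow> C p = (\<Sum>k\<in>I. T p k *\<^sub>R B k)"
  shows "subdet I (\<lambda>p q. bform \<kappa> (C p) (C q)) = (subdet I T)\<^sup>2 * subdet I (\<lambda>p q. bform \<kappa> (B p) (B q))"
proof -
  have "subdet I (\<lambda>p q. bform \<kappa> (C p) (C q)) =
     subdet I (\<lambda>p q. \<Sum>k\<in>I. T p k * (\<Sum>l\<in>I. bform \<kappa> (B k) (B l) * T q l))"
  proof (rule subdet_cong)
    fix p q assume "p \<in> I" "q \<in> I"
    then have "bform \<kappa> (C p) (C q) = (\<Sum>k\<in>I. T p k * bform \<kappa> (B k) (\<Sum>l\<in>I. T q l *\<^sub>R B l))"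
      by (simp only: assms bform_sum_left bform_scaleR_left)
    also have "\<dots> = (\<Sum>k\<in>I. T p k * (\<Sum>l\<in>I. bform \<kappa> (B k) (B l) * T q l))"
      by (simp add: bform_sum_right bform_scaleR_right mult.commute)
    finally show "bform \<kappa> (C p) (C q) = \<dots>" .
  qed
  also have "\<dots> = subdet I T * (subdet I (\<lambda>p q. bform \<kappa> (B p) (B q)) * subdet I (\<lambda>k q. T q k))"
    using subdet_mult[of I T "\<lambda>k q. \<Sum>l\<in>I. bform \<kappa> (B k) (B l) * T q l"]
      subdet_mult[of I "\<lambda>k l. bform \<kappa> (B k) (B l)" "\<lambda>l q. T q l"] by simp
  finally show ?thesis by (simp add: subdet_transpose[of I T] power2_eq_square)
qed

text \<open>One of two shears of determinant 1. Together with the one that adds multiples of a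
  single vector to all others, it moves from vertices to edge vectors, radial vectors and altitudes
  without changing the Gram determinant.\<close>

lemma subdet_gram_add_to_one:
  assumes m: "m \<in> I" and C: "C m = B m + (\<Sum>s\<in>I - {m}. c s *\<^sub>R B s)" "\<And>p. p \<in> I - {m} \<Longrightarrow> C p = B p"
  shows "subdet I (\<lambda>p q. bform \<kappa> (C p) (C q)) = subdet I (\<lambda>p q. bform \<kappa> (B p) (B q))"
proof -
  let ?T = "\<lambda>p q. if p = m then (if q = m then 1 else c q) else if p = q then 1 else 0"
  have "C p = (\<Sum>k\<in>I. ?T p k *\<^sub>R B k)" if p: "p \<in> I" for p
  proof (cases "p = m")
    case True
    then show ?thesis using m C(1) by (simp add: sum.remove[OF finite m])
  next
    case False
    then show ?thesis using p C(2) by (simp add: if_distrib[of "\<lambda>x. x *\<^sub>R _"] cong: if_cong)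
  qed
  from subdet_gram_change[of I C ?T B \<kappa>, OF this] show ?thesis 
    using subdet_elementary_row[OF m, of "\<lambda>q. if q = m then 1 else c q"] by simp
qed

lemma subdet_gram_add_from_one:
  assumes m: "m \<in> I" and C: "C m = B m" "\<And>p. p \<in> I - {m} \<Longrightarrow> C p = B p + c p *\<^sub>R B m"
  shows "subdet I (\<lambda>p q. bform \<kappa> (C p) (C q)) = subdet I (\<lambda>p q. bform \<kappa> (B p) (B q))"
proof -
  let ?T = "\<lambda>p q. if q = m then (if p = m then 1 else c p) else if p = q then 1 else 0"
  have "C p = (\<Sum>k\<in>I. ?T p k *\<^sub>R B k)" if p: "p \<in> I" for p
  proof (cases "p = m")
    case True
    moreover have "(\<Sum>k\<in>I - {m}. ?T m k *\<^sub>R B k) = 0"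
      by (rule sum.neutral) auto
    ultimately show ?thesis using m C(1) by (simp add: sum.remove[OF finite m])
  next
    case False
    moreover have "(\<Sum>k\<in>I - {m}. ?T p k *\<^sub>R B k) = (\<Sum>k\<in>I - {m}. if p = k then B k else 0)"
      by (rule sum.cong) auto
    ultimately show ?thesis using p m C(2) by (simp add: sum.remove[OF finite m])
  qed
  from subdet_gram_change[of I C ?T B \<kappa>, OF this] show ?thesis 
    using subdet_elementary_col[OF m, of "\<lambda>q. if q = m then 1 else c q"] by simp
qed

text \<open>Base times squared height: replacing the vertex \<open>m\<close> by its altitude vector
  \<open>u\<close> is a shear of determinant 1, and the Gram matrix of the new family is block
  diagonal.\<close>

lemma subdet_gram_height:
  assumes m: "m \<in> I" and u: "u = B m + (\<Sum>s\<in>I - {m}. c s *\<^sub>R B s)"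
    and orth: "\<And>s. s \<in> I - {m} \<Longrightarrow> bform \<kappa> u (B s) = 0"
  shows "subdet I (\<lambda>p q. bform \<kappa> (B p) (B q)) =
    bform \<kappa> u u * subdet (I - {m}) (\<lambda>p q. bform \<kappa> (B p) (B q))"
proof -
  have "subdet I (\<lambda>p q. bform \<kappa> (B p) (B q)) =
      subdet I (\<lambda>p q. bform \<kappa> ((B(m := u)) p) ((B(m := u)) q))"
    by (rule subdet_gram_add_to_one[symmetric, OF m]) (auto simp: u)
  also have "\<dots> = bform \<kappa> u u * subdet (I - {m}) (\<lambda>p q. bform \<kappa> ((B(m := u)) p) ((B(m := u)) q))"
    using orth by (subst subdet_remove[OF m]) (auto simp: bform_commute[of \<kappa> "B _" u])
  also have "subdet (I - {m}) (\<lambda>p q. bform \<kappa> ((B(m := u)) p) ((B(m := u)) q)) =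
     subdet (I - {m}) (\<lambda>p q. bform \<kappa> (B p) (B q))"
    by (rule subdet_cong) auto
  finally show ?thesis .
qed

section \<open>Gaussian integrals over an orthant\<close>

text \<open>The product on the right is the growth gauge for all later estimates: it dominates every
  coordinate and, being a product over coordinates, keeps dominating functions integrable factor by
  factor.\<close>

lemma sum_le_prod_one_plus:
  fixes t :: "'i \<Rightarrow> real"
  assumes "finite I" "\<And>i. i \<in> I \<Longrightarrow> 0 \<le> t i"
  shows "1 + (\<Sum>i\<in>I. t i) \<le> (\<Prod>i\<in>I. 1 + t i)"
  using assms
proof (induction I rule: finite_induct)
  case (insert i I)
  have "0 \<le> t i" "0 \<le> (\<Sum>i\<in>I. t i)" using insert.prems by (auto intro: sum_nonneg)
  then have "1 + (\<Sum>i\<in>insert i I. t i) \<le> (1 + t i) * (1 + (\<Sum>i\<in>I. t i))"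
    using insert.hyps by (simp add: algebra_simps)
  also have "\<dots> \<le> (1 + t i) * (\<Prod>i\<in>I. 1 + t i)"
    using insert \<open>0 \<le> t i\<close> by (intro mult_left_mono) auto
  finally show ?case using insert.hyps by simp
qed simp

text \<open>Restricting the measure, instead of inserting an indicator, makes the product measure
  live on the orthant: nonnegativity is membership in the space, and Fubini yields half-line
  integrals directly.\<close>

definition half_line :: "real measure" where
  "half_line = restrict_space lborel {0..}"

lemma space_half_line [simp]: "space half_line = {0..}"
  by (simp add: half_line_def space_restrict_space)

lemma measurable_half_line: "f \<in> borel_measurable borel \<Longrightarrow> f \<in> borel_measurable half_line"
  unfolding half_line_def by (rule measurable_restrict_space1) simp

lemma sigma_finite_half_line: "sigma_finite_measure half_line"
  unfolding half_line_def by (rule sigma_finite_measure_restrict_space) (auto intro: sigma_finite_lborel)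

interpretation half_line: sigma_finite_measure half_line
  by (rule sigma_finite_half_line)

interpretation orthant: product_sigma_finite "\<lambda>_. half_line"
  by (simp add: product_sigma_finite_def sigma_finite_half_line)

abbreviation orthant :: "'v set \<Rightarrow> ('v \<Rightarrow> real) measure" where
  "orthant I \<equiv> (\<Pi>\<^sub>M i\<in>I. half_line)"

lemma space_orthant: "space (orthant I) = I \<rightarrow>\<^sub>E {0..}"
  by (simp add: space_PiM)

lemma orthant_nonneg: "t \<in> space (orthant I) \<Longrightarrow> i \<in> I \<Longrightarrow> 0 \<le> t i"
  by (auto simp: space_orthant)

lemma measurable_orthant_coordinate:
  assumes "i \<in> I"
  shows "(\<lambda>t. t i) \<in> borel_measurable (orthant I)"
  using measurable_comp[OF measurable_component_singleton[OF assms, of "\<lambda>_. half_line"]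
      measurable_half_line[of "\<lambda>x. x"]] by (simp add: comp_def)

text \<open>Even after multiplication by \<open>exp y\<close> the left side tends to 0, so the
  quotient is eventually below 1 and, by continuity, bounded on the compact rest.\<close>

lemma poly_gauss_bound:
  assumes "0 < c"
  obtains K where "0 < K" "\<And>y::real. 0 \<le> y \<Longrightarrow> (1 + y) ^ 4 * exp (- (c * y\<^sup>2)) \<le> K * exp (- y)"
proof -
  let ?g = "\<lambda>y::real. (1 + y) ^ 4 * exp (- (c * y\<^sup>2) + y)"
  have "(?g \<longlongrightarrow> 0) at_top" using assms by real_asymp
  then have "eventually (\<lambda>y. ?g y < 1) at_top" by (rule order_tendstoD) simp
  then obtain y0 where y0: "\<And>y. y \<ge> y0 \<Longrightarrow> ?g y < 1" by (auto simp: eventually_at_top_linorder)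
  have "compact (?g ` {0..y0})" by (intro compact_continuous_image continuous_intros) auto
  then have "bounded (?g ` {0..y0})" by (rule compact_imp_bounded)
  then obtain b where b': "\<forall>x\<in>?g ` {0..y0}. norm x \<le> b" unfolding bounded_iff by blast
  have b: "\<bar>?g y\<bar> \<le> b" if "0 \<le> y" "y \<le> y0" for y
    using bspec[OF b', of "?g y"] that by simp
  show ?thesis
  proof (rule that[of "max 1 b"])
    fix y :: real assume "0 \<le> y"
    then have "?g y \<le> max 1 b" using y0[of y] b[of y] by (cases "y \<le> y0") auto
    then have "?g y * exp (- y) \<le> max 1 b * exp (- y)" by (rule mult_right_mono) simp
    also have "?g y * exp (- y) = (1 + y) ^ 4 * exp (- (c * y\<^sup>2))"
      by (simp only: mult.assoc exp_add[symmetric]) simp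
    finally show "(1 + y) ^ 4 * exp (- (c * y\<^sup>2)) \<le> max 1 b * exp (- y)" .
  qed simp
qed

text \<open>The share of one coordinate in the dominating function. The exponent 4 is dictated by
  differentiation under the integral, whose second-order remainder squares a quadratic form and so
  grows like the fourth power of the gauge.\<close>

definition weight :: "real \<Rightarrow> real \<Rightarrow> real" where
  "weight c y = (1 + y) ^ 4 * exp (- (c * y\<^sup>2))"

lemma weight_nonneg: "0 \<le> y \<Longrightarrow> 0 \<le> weight c y"
  by (simp add: weight_def)

lemma integrable_weight:
  assumes "0 < c"
  shows "integrable half_line (weight c)"
proof -
  obtain K where K: "0 < K" "\<And>y::real. 0 \<le> y \<Longrightarrow> (1 + y) ^ 4 * exp (- (c * y\<^sup>2)) \<le> K * exp (- y)"
    using poly_gauss_bound[OF assms] by blast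
  have "integrable half_line (\<lambda>y. exp (- y))"
  proof (rule integrableI_nonneg)
    have "(\<integral>\<^sup>+ y. ennreal (exp (- y)) \<partial>half_line) = (\<integral>\<^sup>+ y. ennreal (exp (- y)) * indicator {0..} y \<partial>lborel)"
      unfolding half_line_def by (rule nn_integral_restrict_space) simp
    also have "\<dots> < \<infinity>" using nn_intergal_power_times_exp_Ici[of 0] by simp
    finally show "(\<integral>\<^sup>+ y. ennreal (exp (- y)) \<partial>half_line) < \<infinity>" .
  next
    show "(\<lambda>y. exp (- y)) \<in> borel_measurable half_line" by (rule measurable_half_line) measurable
  qed simp
  then have "integrable half_line (\<lambda>y. K * exp (- y))" by simp
  then show ?thesis
  proof (rule Bochner_Integration.integrable_bound)
    show "weight c \<in> borel_measurable half_line"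
      unfolding weight_def[abs_def] by (rule measurable_half_line) measurable
    show "AE x in half_line. norm (weight c x) \<le> norm (K * exp (- x))"
    proof (rule AE_I2)
      fix x assume "x \<in> space half_line"
      then have "0 \<le> x" by simp
      then show "norm (weight c x) \<le> norm (K * exp (- x))"
        using K(2)[of x] K(1) weight_nonneg[of x c] by (simp only: weight_def real_norm_def abs_of_nonneg) simp
    qed
  qed
qed

lemma weight_tendsto_0: "0 < c \<Longrightarrow> (weight c \<longlongrightarrow> 0) at_top"
  unfolding weight_def[abs_def] by real_asymp

lemma integrable_orthant_weight:
  "finite I \<Longrightarrow> 0 < c \<Longrightarrow> integrable (orthant I) (\<lambda>t. \<Prod>i\<in>I. weight c (t i))"
  by (intro orthant.product_integrable_prod integrable_weight)

section \<open>Quadratic forms coercive on the orthant and their Gaussian moments\<close>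

definition quad_form :: "('v \<Rightarrow> 'v \<Rightarrow> real) \<Rightarrow> 'v set \<Rightarrow> ('v \<Rightarrow> real) \<Rightarrow> real" where
  "quad_form M I t = (\<Sum>i\<in>I. \<Sum>j\<in>I. M i j * t i * t j)"

text \<open>Coercivity is only required on the nonnegative orthant: in the hyperbolic case the form is
  indefinite.\<close>
definition coercive_on :: "real \<Rightarrow> 'v set \<Rightarrow> ('v \<Rightarrow> 'v \<Rightarrow> real) \<Rightarrow> bool" where
  "coercive_on c I M \<longleftrightarrow> (\<forall>t. (\<forall>i\<in>I. 0 \<le> t i) \<longrightarrow> c * (\<Sum>i\<in>I. (t i)\<^sup>2) \<le> quad_form M I t)"

lemma coercive_onD:
  "coercive_on c I M \<Longrightarrow> (\<And>i. i \<in> I \<Longrightarrow> 0 \<le> t i) \<Longrightarrow> c * (\<Sum>i\<in>I. (t i)\<^sup>2) \<le> quad_form M I t"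
  by (simp add: coercive_on_def)

lemma quad_form_cong: "(\<And>i. i \<in> I \<Longrightarrow> s i = t i) \<Longrightarrow> quad_form M I s = quad_form M I t"
  by (simp add: quad_form_def)

lemma quad_form_measurable: "quad_form M I \<in> borel_measurable (orthant I)"
  unfolding quad_form_def[abs_def]
  by (intro borel_measurable_sum borel_measurable_times borel_measurable_const measurable_orthant_coordinate)

lemma exp_quad_form_measurable: "(\<lambda>t. exp (- quad_form M I t)) \<in> borel_measurable (orthant I)"
  using measurable_compose[OF quad_form_measurable, of "\<lambda>x. exp (- x)" borel M I] by simp

text \<open>Coercivity replaces the quadratic form by a sum of squares, after which everything
  splits over the coordinates. Powers below 4 are raised to 4, since the gauge is at least
  1.\<close>

lemma exp_quad_form_le_weight:
  assumes "finite I" "coercive_on c I M" "t \<in> space (orthant I)" "a \<le> 4"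
  shows "(\<Prod>i\<in>I. 1 + t i) ^ a * exp (- quad_form M I t) \<le> (\<Prod>i\<in>I. weight c (t i))"
proof -
  have t: "\<And>i. i \<in> I \<Longrightarrow> 0 \<le> t i" by (rule orthant_nonneg[OF assms(3)])
  have p: "1 \<le> (\<Prod>i\<in>I. 1 + t i)" using t by (intro prod_ge_1) auto
  have "(\<Prod>i\<in>I. 1 + t i) ^ a * exp (- quad_form M I t) \<le>
      (\<Prod>i\<in>I. 1 + t i) ^ 4 * exp (- (c * (\<Sum>i\<in>I. (t i)\<^sup>2)))"
    using coercive_onD[OF assms(2), of t] t p assms(4)
    by (intro mult_mono power_increasing) auto
  also have "\<dots> = (\<Prod>i\<in>I. weight c (t i))"
    using assms(1) exp_sum[OF assms(1), of "\<lambda>i. - (c * (t i)\<^sup>2)"]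
    by (simp add: weight_def prod.distrib prod_power_distrib sum_distrib_left sum_negf)
  finally show ?thesis .
qed

definition gauss :: "('v \<Rightarrow> 'v \<Rightarrow> real) \<Rightarrow> 'v set \<Rightarrow> (('v \<Rightarrow> real) \<Rightarrow> real) \<Rightarrow> real" where
  "gauss M I f = (LINT t|orthant I. f t * exp (- quad_form M I t))"

lemma integrable_gauss:
  assumes "finite I" "0 < c" "coercive_on c I M" "f \<in> borel_measurable (orthant I)"
    and f: "\<And>t. t \<in> space (orthant I) \<Longrightarrow> \<bar>f t\<bar> \<le> K * (\<Prod>i\<in>I. 1 + t i) ^ a" and "a \<le> 4"
  shows "integrable (orthant I) (\<lambda>t. f t * exp (- quad_form M I t))"
proof -
  have "integrable (orthant I) (\<lambda>t. \<bar>K\<bar> * (\<Prod>i\<in>I. weight c (t i)))"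
    using integrable_orthant_weight[OF assms(1,2)] by simp
  then show ?thesis
  proof (rule Bochner_Integration.integrable_bound)
    show "(\<lambda>t. f t * exp (- quad_form M I t)) \<in> borel_measurable (orthant I)"
      by (intro borel_measurable_times assms(4) exp_quad_form_measurable)
    show "AE t in orthant I. norm (f t * exp (- quad_form M I t)) \<le> norm (\<bar>K\<bar> * (\<Prod>i\<in>I. weight c (t i)))"
    proof (rule AE_I2)
      fix t assume t: "t \<in> space (orthant I)"
      have p: "0 \<le> (\<Prod>i\<in>I. 1 + t i)" "0 \<le> (\<Prod>i\<in>I. weight c (t i))"
        using orthant_nonneg[OF t] by (auto intro!: prod_nonneg weight_nonneg)
      have "\<bar>f t\<bar> * exp (- quad_form M I t) \<le> (\<bar>K\<bar> * (\<Prod>i\<in>I. 1 + t i) ^ a) * exp (- quad_form M I t)"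
      proof (rule mult_right_mono)
        have "\<bar>f t\<bar> \<le> K * (\<Prod>i\<in>I. 1 + t i) ^ a" by (rule f[OF t])
        also have "\<dots> \<le> \<bar>K\<bar> * (\<Prod>i\<in>I. 1 + t i) ^ a" using p by (intro mult_right_mono) auto
        finally show "\<bar>f t\<bar> \<le> \<bar>K\<bar> * (\<Prod>i\<in>I. 1 + t i) ^ a" .
      qed simp
      also have "\<dots> \<le> \<bar>K\<bar> * (\<Prod>i\<in>I. weight c (t i))"
        using exp_quad_form_le_weight[OF assms(1,3) t \<open>a \<le> 4\<close>] by (simp add: mult.assoc mult_left_mono)
      finally show "norm (f t * exp (- quad_form M I t)) \<le> norm (\<bar>K\<bar> * (\<Prod>i\<in>I. weight c (t i)))"
        using p by (simp add: abs_mult)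
    qed
  qed
qed

lemma affine_bound:
  fixes t :: "'i \<Rightarrow> real"
  assumes "finite I" "\<And>i. i \<in> I \<Longrightarrow> 0 \<le> t i"
  shows "\<bar>a + (\<Sum>j\<in>I. b j * t j)\<bar> \<le> (\<bar>a\<bar> + (\<Sum>j\<in>I. \<bar>b j\<bar>)) * (\<Prod>i\<in>I. 1 + t i)"
proof -
  let ?P = "\<Prod>i\<in>I. 1 + t i"
  have P: "1 + (\<Sum>i\<in>I. t i) \<le> ?P" by (rule sum_le_prod_one_plus[OF assms])
  have nn: "0 \<le> (\<Sum>i\<in>I. t i)" using assms by (auto intro: sum_nonneg)
  have tP: "t j \<le> ?P" if "j \<in> I" for j
  proof -
    have "t j \<le> (\<Sum>i\<in>I. t i)" using assms that by (intro member_le_sum) auto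
    then show ?thesis using P by simp
  qed
  have "\<bar>a + (\<Sum>j\<in>I. b j * t j)\<bar> \<le> \<bar>a\<bar> + (\<Sum>j\<in>I. \<bar>b j * t j\<bar>)"
    by (intro order_trans[OF abs_triangle_ineq] add_left_mono sum_abs)
  also have "\<dots> \<le> \<bar>a\<bar> * ?P + (\<Sum>j\<in>I. \<bar>b j\<bar> * ?P)"
  proof (intro add_mono sum_mono)
    show "\<bar>a\<bar> \<le> \<bar>a\<bar> * ?P" using P nn mult_left_mono[of 1 ?P "\<bar>a\<bar>"] by simp
    show "\<bar>b j * t j\<bar> \<le> \<bar>b j\<bar> * ?P" if "j \<in> I" for j
      using tP[OF that] assms(2)[OF that] by (simp add: abs_mult mult_left_mono)
  qed
  finally show ?thesis by (simp add: distrib_right sum_distrib_right)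
qed

section \<open>Integration by parts along one coordinate\<close>

lemma half_line_FTC:
  assumes int: "integrable half_line g"
    and G: "\<And>y. 0 \<le> y \<Longrightarrow> (G has_real_derivative g y) (at y)"
    and cont: "\<And>y. isCont g y" and lim: "(G \<longlongrightarrow> 0) at_top"
  shows "(LINT y|half_line. g y) = - G 0"
proof -
  let ?h = "\<lambda>y. indicator {0..} y *\<^sub>R g y"
  have h: "integrable lborel ?h" 
    using int unfolding half_line_def by (subst (asm) integrable_restrict_space) auto
  have "((\<lambda>b. \<integral>y. indicator {..b} y *\<^sub>R ?h y \<partial>lborel) \<longlongrightarrow> (\<integral>y. ?h y \<partial>lborel)) at_top"
    by (rule tendsto_integral_at_top[OF _ h]) simp
  moreover have "eventually (\<lambda>b. (\<integral>y. indicator {..b} y *\<^sub>R ?h y \<partial>lborel) = G b - G 0) at_top"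
    using eventually_ge_at_top[of 0]
  proof eventually_elim
    case (elim b)
    have "(\<integral>y. indicator {..b} y *\<^sub>R ?h y \<partial>lborel) = (\<integral>y. g y * indicator {0..b} y \<partial>lborel)"
      by (rule Bochner_Integration.integral_cong) (auto simp: indicator_def)
    also have "\<dots> = G b - G 0"
      using elim G cont by (intro integral_FTC_Icc_real) auto
    finally show ?case .
  qed
  ultimately have "((\<lambda>b. G b - G 0) \<longlongrightarrow> (\<integral>y. ?h y \<partial>lborel)) at_top"
    by (rule Lim_transform_eventually)
  moreover have "((\<lambda>b. G b - G 0) \<longlongrightarrow> 0 - G 0) at_top" by (intro tendsto_intros lim)
  ultimately have "(\<integral>y. ?h y \<partial>lborel) = - G 0"
    using tendsto_unique[OF trivial_limit_at_top_linorder, of "\<lambda>b. G b - G 0" "\<integral>y. ?h y \<partial>lborel" "0 - G 0"]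
    by simp
  then show ?thesis unfolding half_line_def by (subst integral_restrict_space) auto
qed

text \<open>Makes the dependence on one variable explicit. Symmetry doubles the cross term, so the
  derivative in \<open>y\<close> is twice row \<open>p\<close> of \<open>M\<close> applied to the
  point.\<close>

lemma quad_form_upd:
  assumes "finite I" "p \<in> I" and sym: "\<And>i j. i \<in> I \<Longrightarrow> j \<in> I \<Longrightarrow> M i j = M j i"
  shows "quad_form M I (t(p := y)) =
    quad_form M (I - {p}) t + 2 * y * (\<Sum>l\<in>I - {p}. M p l * t l) + M p p * y\<^sup>2"
proof -
  define s where "s = t(p := y)"
  have s_p [simp]: "s p = y" and s_other: "\<And>j. j \<in> I - {p} \<Longrightarrow> s j = t j" by (auto simp: s_def)
  have c: "(\<Sum>j\<in>I - {p}. a j * s j) = (\<Sum>j\<in>I - {p}. a j * t j)" for a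
    by (rule sum.cong) (auto simp: s_other)
  have inner: "(\<Sum>j\<in>I. M i j * s i * s j) = M i p * s i * y + (\<Sum>j\<in>I - {p}. M i j * s i * t j)" for i
    using sum.remove[OF assms(1,2), of "\<lambda>j. M i j * s i * s j"]
    by (simp add: c)
  have "quad_form M I s = (M p p * y * y + (\<Sum>j\<in>I - {p}. M p j * y * t j)) +
    (\<Sum>i\<in>I - {p}. M i p * t i * y + (\<Sum>j\<in>I - {p}. M i j * t i * t j))"
    unfolding quad_form_def inner using sum.remove[OF assms(1,2), of "\<lambda>i. M i p * s i * y + (\<Sum>j\<in>I - {p}. M i j * s i * t j)"]
    by (simp add: s_other)
  also have "(\<Sum>i\<in>I - {p}. M i p * t i * y + (\<Sum>j\<in>I - {p}. M i j * t i * t j)) =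
     y * (\<Sum>l\<in>I - {p}. M p l * t l) + quad_form M (I - {p}) t"
    using sym assms(2) by (simp add: sum.distrib quad_form_def sum_distrib_left mult_ac)
  also have "(\<Sum>j\<in>I - {p}. M p j * y * t j) = y * (\<Sum>l\<in>I - {p}. M p l * t l)"
    by (simp add: sum_distrib_left mult_ac)
  finally have "quad_form M I s =
      quad_form M (I - {p}) t + 2 * y * (\<Sum>l\<in>I - {p}. M p l * t l) + M p p * y\<^sup>2"
    by (simp add: power2_eq_square algebra_simps)
  then show ?thesis unfolding s_def .
qed

text \<open>The integrand is minus the derivative in \<open>t p\<close> of \<open>f t\<close> times
  the exponential, with \<open>b p\<close> the derivative of \<open>f\<close>. Integration over the
  half-line leaves the value at \<open>t p = 0\<close>, an integral over the orthant of the facet.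
  Affine \<open>f\<close> suffice: constants yield first moments, coordinates yield second
  moments.\<close>

lemma
  fixes a :: real and b :: "'v \<Rightarrow> real"
  assumes fin: "finite I" and p: "p \<in> I" and c: "0 < c" and coer: "coercive_on c I M"
    and sym: "\<And>i j. i \<in> I \<Longrightarrow> j \<in> I \<Longrightarrow> M i j = M j i"
  defines "f \<equiv> \<lambda>t. a + (\<Sum>j\<in>I. b j * t j)"
  shows integrable_gauss_by_parts:
      "integrable (orthant I)
        (\<lambda>t. (2 * (\<Sum>l\<in>I. M p l * t l) * f t - b p) * exp (- quad_form M I t))" (is ?int)
    and gauss_by_parts:
      "gauss M I (\<lambda>t. 2 * (\<Sum>l\<in>I. M p l * t l) * f t - b p) =
        gauss M (I - {p}) (\<lambda>t. f (t(p := 0)))" (is ?eq)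
proof -
  define J where "J = I - {p}"
  have I: "I = insert p J" "p \<notin> J" "finite J" using p fin by (auto simp: J_def)
  define K where "K = \<bar>a\<bar> + (\<Sum>j\<in>I. \<bar>b j\<bar>)"
  define L where "L = 2 * (\<Sum>l\<in>I. \<bar>M p l\<bar>)"
  define g where "g t = 2 * (\<Sum>l\<in>I. M p l * t l) * f t - b p" for t
  have K: "0 \<le> K" and L: "0 \<le> L" by (auto simp: K_def L_def intro!: add_nonneg_nonneg sum_nonneg)
  have f_bound: "\<bar>f t\<bar> \<le> K * (\<Prod>i\<in>I. 1 + t i)" if "\<And>i. i \<in> I \<Longrightarrow> 0 \<le> t i" for t
    unfolding f_def K_def by (rule affine_bound[OF fin that])
  have g_bound: "\<bar>g t\<bar> \<le> (L * K + \<bar>b p\<bar>) * (\<Prod>i\<in>I. 1 + t i) ^ 2" if t: "\<And>i. i \<in> I \<Longrightarrow> 0 \<le> t i" for t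
  proof -
    let ?P = "\<Prod>i\<in>I. 1 + t i"
    have P: "1 \<le> ?P" using t by (intro prod_ge_1) auto
    have "\<bar>2 * (\<Sum>l\<in>I. M p l * t l)\<bar> \<le> L * ?P"
      using affine_bound[OF fin t, where a = 0 and b = "M p"] by (simp add: L_def abs_mult)
    then have "\<bar>2 * (\<Sum>l\<in>I. M p l * t l)\<bar> * \<bar>f t\<bar> \<le> (L * ?P) * (K * ?P)"
      using f_bound[OF t] K L P by (intro mult_mono) auto
    moreover have "\<bar>b p\<bar> * 1 \<le> \<bar>b p\<bar> * ?P ^ 2" using P by (intro mult_left_mono one_le_power) auto
    moreover have "\<bar>g t\<bar> \<le> \<bar>2 * (\<Sum>l\<in>I. M p l * t l)\<bar> * \<bar>f t\<bar> + \<bar>b p\<bar>"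
      unfolding g_def abs_mult[symmetric] by (rule abs_triangle_ineq4)
    ultimately have "\<bar>g t\<bar> \<le> (L * ?P) * (K * ?P) + \<bar>b p\<bar> * ?P ^ 2" by linarith
    then show ?thesis by (simp add: power2_eq_square algebra_simps)
  qed
  have f_meas: "f \<in> borel_measurable (orthant I)"
    unfolding f_def by (intro borel_measurable_add borel_measurable_sum borel_measurable_times
        borel_measurable_const measurable_orthant_coordinate)
  have g_meas: "g \<in> borel_measurable (orthant I)"
    unfolding g_def[abs_def] by (intro borel_measurable_diff borel_measurable_sum borel_measurable_times
        borel_measurable_const measurable_orthant_coordinate f_meas)
  have int_g: "integrable (orthant I) (\<lambda>t. g t * exp (- quad_form M I t))"
    by (rule integrable_gauss[OF fin c coer g_meas, where a = 2])
      (auto intro!: g_bound orthant_nonneg)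
  then show ?int by (simp add: g_def)
  from int_g have "gauss M I g =
     (\<integral>x. (\<integral>y. g (x(p := y)) * exp (- quad_form M I (x(p := y))) \<partial>half_line) \<partial>orthant J)"
    unfolding gauss_def I(1) by (intro orthant.product_integral_insert) (use I in auto)
  also have "\<dots> = (\<integral>x. f (x(p := 0)) * exp (- quad_form M J x) \<partial>orthant J)"
  proof (rule Bochner_Integration.integral_cong[OF refl])
    fix x assume x: "x \<in> space (orthant J)"
    have x_nonneg: "\<And>i. i \<in> J \<Longrightarrow> 0 \<le> x i" by (rule orthant_nonneg[OF x])
    have upd_nonneg: "\<And>i. i \<in> I \<Longrightarrow> 0 \<le> (x(p := y)) i" if "0 \<le> y" for y
      using x_nonneg that by (auto simp: I(1))
    have upd_space: "x(p := y) \<in> space (orthant I)" if "0 \<le> y" for y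
      using x that I by (auto simp: space_orthant PiE_def Pi_def extensional_def)
    let ?G = "\<lambda>y. f (x(p := y)) * exp (- quad_form M I (x(p := y)))"
    let ?g = "\<lambda>y. g (x(p := y)) * exp (- quad_form M I (x(p := y)))"
    define s where "s = (\<Sum>l\<in>J. M p l * x l)"
    define r where "r = a + (\<Sum>j\<in>J. b j * x j)"
    have upd_sum: "(\<Sum>j\<in>I. h j * (x(p := y)) j) = h p * y + (\<Sum>j\<in>J. h j * x j)" for h y
    proof -
      have "(\<Sum>j\<in>J. h j * (x(p := y)) j) = (\<Sum>j\<in>J. h j * x j)"
        using I(2) by (intro sum.cong) auto
      then show ?thesis using I by simp
    qed
    \<comment> \<open>Along the line in direction \<open>p\<close> all three functions are
      polynomials in \<open>y\<close> of degree at most 2; \<open>s\<close> and \<open>r\<close>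
      collect what does not depend on \<open>y\<close>.\<close>
    have Qy: "quad_form M I (x(p := y)) = quad_form M J x + 2 * y * s + M p p * y\<^sup>2" for y
      unfolding s_def J_def by (rule quad_form_upd[OF fin p sym])
    have fy: "f (x(p := y)) = r + b p * y" for y
      by (simp add: f_def upd_sum r_def del: fun_upd_apply)
    have gy: "g (x(p := y)) = 2 * (s + M p p * y) * (r + b p * y) - b p" for y
      by (simp only: g_def fy upd_sum s_def add.commute)
    have int: "integrable half_line ?g" and lim: "(?G \<longlongrightarrow> 0) at_top"
    proof -
      let ?C = "(\<Prod>i\<in>J. weight c (x i))"
      have C: "0 \<le> ?C" using x_nonneg by (auto intro!: prod_nonneg weight_nonneg)
      have b: "(\<Prod>i\<in>I. 1 + (x(p := y)) i) ^ d * exp (- quad_form M I (x(p := y))) \<le> ?C * weight c y"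
        if "0 \<le> y" "d \<le> 4" for y d
      proof -
        have "(\<Prod>i\<in>I. weight c ((x(p := y)) i)) = weight c y * (\<Prod>i\<in>J. weight c ((x(p := y)) i))"
          using I by simp
        also have "(\<Prod>i\<in>J. weight c ((x(p := y)) i)) = ?C" using I(2) by (intro prod.cong) auto
        finally show ?thesis
          using exp_quad_form_le_weight[OF fin coer upd_space[OF that(1)] that(2)] by (simp add: mult.commute)
      qed
      show "integrable half_line ?g"
      proof (rule Bochner_Integration.integrable_bound)
        show "integrable half_line (\<lambda>y. ((L * K + \<bar>b p\<bar>) * ?C) * weight c y)"
          using integrable_weight[OF c] by simp
        show "?g \<in> borel_measurable half_line"
          unfolding gy Qy by (rule measurable_half_line) measurable
        show "AE y in half_line. norm (?g y) \<le> norm (((L * K + \<bar>b p\<bar>) * ?C) * weight c y)"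
        proof (rule AE_I2)
          fix y assume "y \<in> space half_line"
          then have y: "0 \<le> y" by simp
          have "norm (?g y) = \<bar>g (x(p := y))\<bar> * exp (- quad_form M I (x(p := y)))"
            by (simp add: abs_mult)
          also have "\<dots> \<le> (L * K + \<bar>b p\<bar>) * (\<Prod>i\<in>I. 1 + (x(p := y)) i) ^ 2 * exp (- quad_form M I (x(p := y)))"
            by (intro mult_right_mono g_bound upd_nonneg[OF y]) auto
          also have "\<dots> \<le> (L * K + \<bar>b p\<bar>) * (?C * weight c y)"
            unfolding mult.assoc using K L by (intro mult_left_mono b[OF y]) auto
          also have "\<dots> \<le> norm (((L * K + \<bar>b p\<bar>) * ?C) * weight c y)"
            by (simp add: mult.assoc)
          finally show "norm (?g y) \<le> norm (((L * K + \<bar>b p\<bar>) * ?C) * weight c y)" .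
        qed
      qed
      show "(?G \<longlongrightarrow> 0) at_top"
      proof (rule Lim_null_comparison)
        have "((\<lambda>y. (K * ?C) * weight c y) \<longlongrightarrow> (K * ?C) * 0) at_top"
          by (intro tendsto_intros weight_tendsto_0[OF c])
        then show "((\<lambda>y. (K * ?C) * weight c y) \<longlongrightarrow> 0) at_top" by simp
        show "eventually (\<lambda>y. norm (?G y) \<le> (K * ?C) * weight c y) at_top"
          using eventually_ge_at_top[of 0]
        proof eventually_elim
          case (elim y)
          have "norm (?G y) = \<bar>f (x(p := y))\<bar> * exp (- quad_form M I (x(p := y)))"
            by (simp add: abs_mult)
          also have "\<dots> \<le> K * (\<Prod>i\<in>I. 1 + (x(p := y)) i) * exp (- quad_form M I (x(p := y)))"
            by (intro mult_right_mono f_bound upd_nonneg[OF elim]) auto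
          also have "\<dots> \<le> K * (?C * weight c y)"
            unfolding mult.assoc using K b[OF elim, of 1] by (intro mult_left_mono) auto
          finally show ?case by (simp add: mult.assoc)
        qed
      qed
    qed
    \<comment> \<open>\<open>?G\<close> is a primitive of \<open>- ?g\<close> and vanishes at
      infinity, so only its value at 0 survives.\<close>
    have "(LINT y|half_line. - ?g y) = - ?G 0"
    proof (rule half_line_FTC)
      show "integrable half_line (\<lambda>y. - ?g y)" using int by simp
      show "(?G has_real_derivative - ?g y) (at y)" for y
        unfolding fy gy Qy
        by (auto intro!: derivative_eq_intros simp: algebra_simps power2_eq_square)
      show "isCont (\<lambda>y. - ?g y) y" for y
        unfolding gy Qy by (intro continuous_intros)
    qed (rule lim)
    then show "(\<integral>y. ?g y \<partial>half_line) = f (x(p := 0)) * exp (- quad_form M J x)"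
      by (simp add: Qy)
  qed
  finally show ?eq unfolding g_def[symmetric] J_def gauss_def by simp
qed

section \<open>Moments and derivatives\<close>

lemma gauss_sum:
  assumes "\<And>q. q \<in> S \<Longrightarrow> integrable (orthant I) (\<lambda>t. h q t * exp (- quad_form M I t))"
  shows "gauss M I (\<lambda>t. \<Sum>q\<in>S. a q * h q t) = (\<Sum>q\<in>S. a q * gauss M I (h q))"
proof -
  have "gauss M I (\<lambda>t. \<Sum>q\<in>S. a q * h q t) =
      (\<integral>t. (\<Sum>q\<in>S. a q * (h q t * exp (- quad_form M I t))) \<partial>orthant I)"
    unfolding gauss_def by (simp add: sum_distrib_right mult.assoc)
  also have "\<dots> = (\<Sum>q\<in>S. a q * gauss M I (h q))"
    using assms by (subst Bochner_Integration.integral_sum) (auto simp: gauss_def)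
  finally show ?thesis .
qed

lemma gauss_add:
  assumes "integrable (orthant I) (\<lambda>t. f t * exp (- quad_form M I t))"
    and "integrable (orthant I) (\<lambda>t. g t * exp (- quad_form M I t))"
  shows "gauss M I (\<lambda>t. f t + g t) = gauss M I f + gauss M I g"
  using assms unfolding gauss_def by (simp add: distrib_right)

lemma sum_inverse_matrix:
  assumes fin: "finite I" and i: "i \<in> I"
    and N: "\<And>j. j \<in> I \<Longrightarrow> (\<Sum>l\<in>I. N i l * M l j) = (if i = j then 1 else 0 :: real)"
  shows "(\<Sum>q\<in>I. N i q * (\<Sum>l\<in>I. M q l * t l)) = t i"
proof -
  have "(\<Sum>q\<in>I. N i q * (\<Sum>l\<in>I. M q l * t l)) = (\<Sum>q\<in>I. \<Sum>l\<in>I. N i q * M q l * t l)"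
    by (simp add: sum_distrib_left mult.assoc)
  also have "\<dots> = (\<Sum>l\<in>I. \<Sum>q\<in>I. N i q * M q l * t l)" by (rule sum.swap)
  also have "\<dots> = (\<Sum>l\<in>I. (\<Sum>q\<in>I. N i q * M q l) * t l)" by (simp add: sum_distrib_right)
  also have "\<dots> = (\<Sum>l\<in>I. if i = l then t l else 0)" by (rule sum.cong) (auto simp: N)
  finally show ?thesis using fin i by simp
qed

text \<open>The inverse matrix writes \<open>t i\<close> as a combination of the rows of
  \<open>M\<close> applied to \<open>t\<close>. Integration by parts with the constant function 1
  turns row \<open>q\<close> into half the Gaussian integral of the facet without
  \<open>q\<close>.\<close>

lemma gauss_first_moment:
  assumes fin: "finite I" and i: "i \<in> I" and c: "0 < c" and coer: "coercive_on c I M"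
    and sym: "\<And>i j. i \<in> I \<Longrightarrow> j \<in> I \<Longrightarrow> M i j = M j i"
    and N: "\<And>j. j \<in> I \<Longrightarrow> (\<Sum>l\<in>I. N i l * M l j) = (if i = j then 1 else 0 :: real)"
  shows "gauss M I (\<lambda>t. t i) = 1 / 2 * (\<Sum>q\<in>I. N i q * gauss M (I - {q}) (\<lambda>_. 1))"
proof -
  \<comment> \<open>The constant function 1 is written as an affine one with zero slopes, to match
    the shape of the integration by parts.\<close>
  let ?h = "\<lambda>q t. 2 * (\<Sum>l\<in>I. M q l * t l) * (1 + (\<Sum>j\<in>I. 0 * t j)) - 0"
  have "t i = (\<Sum>q\<in>I. (N i q / 2) * ?h q t)" for t
    using sum_inverse_matrix[of I i N M t, OF fin i N] by simp
  then have "gauss M I (\<lambda>t. t i) = gauss M I (\<lambda>t. \<Sum>q\<in>I. (N i q / 2) * ?h q t)" by simp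
  also have "\<dots> = (\<Sum>q\<in>I. (N i q / 2) * gauss M I (?h q))"
    by (rule gauss_sum) (rule integrable_gauss_by_parts[OF fin _ c coer sym], assumption+)
  also have "\<dots> = (\<Sum>q\<in>I. (N i q / 2) * gauss M (I - {q}) (\<lambda>t. 1 + (\<Sum>j\<in>I. 0 * (t(q := 0)) j)))"
  proof (rule sum.cong[OF refl])
    fix q assume q: "q \<in> I"
    have "gauss M I (?h q) = gauss M (I - {q}) (\<lambda>t. 1 + (\<Sum>j\<in>I. 0 * (t(q := 0)) j))"
      by (rule gauss_by_parts[OF fin q c coer sym, where b = "\<lambda>_. 0"])
    then show "(N i q / 2) * gauss M I (?h q) =
        (N i q / 2) * gauss M (I - {q}) (\<lambda>t. 1 + (\<Sum>j\<in>I. 0 * (t(q := 0)) j))" by (rule arg_cong)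
  qed
  finally show ?thesis by (simp add: sum_distrib_left)
qed

lemma integrable_gauss_one:
  assumes "finite I" "0 < c" "coercive_on c I M"
  shows "integrable (orthant I) (\<lambda>t. 1 * exp (- quad_form M I t))"
  by (rule integrable_gauss[OF assms, where K = 1 and a = 0]) auto

text \<open>As for the first moment, but with \<open>t j\<close> as the affine function. Its slope
  is 1 at \<open>j\<close> only, which produces the term with \<open>N i j\<close>; and it vanishes
  on the facet without \<open>j\<close>, which removes \<open>j\<close> from the sum.\<close>

lemma gauss_second_moment:
  assumes fin: "finite I" and i: "i \<in> I" and j: "j \<in> I" and c: "0 < c" and coer: "coercive_on c I M"
    and sym: "\<And>i j. i \<in> I \<Longrightarrow> j \<in> I \<Longrightarrow> M i j = M j i"
    and N: "\<And>j. j \<in> I \<Longrightarrow> (\<Sum>l\<in>I. N i l * M l j) = (if i = j then 1 else 0 :: real)"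
  shows "gauss M I (\<lambda>t. t i * t j) = 1 / 2 * N i j * gauss M I (\<lambda>_. 1) +
    1 / 2 * (\<Sum>p\<in>I - {j}. N i p * gauss M (I - {p}) (\<lambda>t. t j))"
proof -
  let ?b = "\<lambda>l. if l = j then 1 else 0 :: real"
  let ?h = "\<lambda>q t. 2 * (\<Sum>l\<in>I. M q l * t l) * (0 + (\<Sum>l\<in>I. ?b l * t l)) - ?b q"
  have b: "(\<Sum>l\<in>I. ?b l * t l) = t j" for t :: "'a \<Rightarrow> real"
    using fin j by (simp add: if_distrib[of "\<lambda>x. x * _"] cong: if_cong)
  have int_h: "integrable (orthant I) (\<lambda>t. ?h q t * exp (- quad_form M I t))" if "q \<in> I" for q
    by (rule integrable_gauss_by_parts[OF fin that c coer sym])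
  have "t i * t j = (\<Sum>q\<in>I. (N i q / 2) * ?h q t) + (N i j / 2) * 1" for t
  proof -
    have "(\<Sum>q\<in>I. (N i q / 2) * ?h q t) =
       (\<Sum>q\<in>I. N i q * (\<Sum>l\<in>I. M q l * t l) * t j - (if q = j then N i q / 2 else 0))"
      unfolding b by (rule sum.cong) (auto simp: algebra_simps)
    also have "\<dots> = (\<Sum>q\<in>I. N i q * (\<Sum>l\<in>I. M q l * t l)) * t j - N i j / 2"
      using fin j by (simp add: sum_subtractf sum_distrib_right)
    also have "\<dots> = t i * t j - N i j / 2" by (simp only: sum_inverse_matrix[of I i N M t, OF fin i N])
    finally show ?thesis by simp
  qed
  then have "gauss M I (\<lambda>t. t i * t j) = gauss M I (\<lambda>t. (\<Sum>q\<in>I. (N i q / 2) * ?h q t) + (N i j / 2) * 1)"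
    by simp
  also have "\<dots> = gauss M I (\<lambda>t. \<Sum>q\<in>I. (N i q / 2) * ?h q t) + gauss M I (\<lambda>t. (N i j / 2) * 1)"
  proof (rule gauss_add)
    have "integrable (orthant I) (\<lambda>t. \<Sum>q\<in>I. (N i q / 2) * (?h q t * exp (- quad_form M I t)))"
      by (intro Bochner_Integration.integrable_sum integrable_mult_right int_h)
    then show "integrable (orthant I) (\<lambda>t. (\<Sum>q\<in>I. (N i q / 2) * ?h q t) * exp (- quad_form M I t))"
      by (simp only: sum_distrib_right mult.assoc)
    show "integrable (orthant I) (\<lambda>t. (N i j / 2) * 1 * exp (- quad_form M I t))"
      unfolding mult.assoc by (intro integrable_mult_right integrable_gauss_one[OF fin c coer])
  qed
  also have "gauss M I (\<lambda>t. (N i j / 2) * 1) = 1 / 2 * N i j * gauss M I (\<lambda>_. 1)"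
    by (simp add: gauss_def)
  also have "gauss M I (\<lambda>t. \<Sum>q\<in>I. (N i q / 2) * ?h q t) = (\<Sum>q\<in>I. (N i q / 2) * gauss M I (?h q))"
    by (rule gauss_sum) (rule int_h)
  also have "\<dots> = (\<Sum>q\<in>I. if q \<in> I - {j} then 1 / 2 * (N i q * gauss M (I - {q}) (\<lambda>t. t j)) else 0)"
  proof (rule sum.cong[OF refl])
    fix q assume q: "q \<in> I"
    have "gauss M I (?h q) = gauss M (I - {q}) (\<lambda>t. 0 + (\<Sum>l\<in>I. ?b l * (t(q := 0)) l))"
      by (rule gauss_by_parts[OF fin q c coer sym])
    also have "\<dots> = (if q = j then 0 else gauss M (I - {q}) (\<lambda>t. t j))"
      unfolding b by (simp add: gauss_def)
    finally show "(N i q / 2) * gauss M I (?h q) =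
        (if q \<in> I - {j} then 1 / 2 * (N i q * gauss M (I - {q}) (\<lambda>t. t j)) else 0)"
      using q by auto
  qed
  also have "\<dots> = 1 / 2 * (\<Sum>q\<in>I - {j}. N i q * gauss M (I - {q}) (\<lambda>t. t j))"
    unfolding sum_distrib_left using fin by (intro sum.mono_neutral_cong_right) auto
  finally show ?thesis by simp
qed

section \<open>Differentiation under the integral sign\<close>

lemma has_derivative_quadratic_remainder:
  assumes D: "bounded_linear D" and d: "0 < d"
    and rem: "\<And>h. norm h \<le> d \<Longrightarrow> norm (f (x + h) - f x - D h) \<le> K * (norm h)\<^sup>2"
  shows "(f has_derivative D) (at x)"
  unfolding has_derivative_at
proof (rule conjI[OF D], rule Lim_null_comparison)
  show "((\<lambda>h. K * norm h) \<longlongrightarrow> 0) (at 0)"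
    using tendsto_mult_left[OF tendsto_norm[OF tendsto_ident_at], of K 0 UNIV] by simp
  have "eventually (\<lambda>h. norm h < d \<and> h \<noteq> 0) (at 0)"
    unfolding eventually_at using d by (intro exI[of _ d]) auto
  then show "eventually (\<lambda>h. norm (norm (f (x + h) - f x - D h) / norm h) \<le> K * norm h) (at 0)"
  proof eventually_elim
    case (elim h)
    then show ?case using rem[of h] by (simp add: divide_le_eq power2_eq_square mult.assoc)
  qed
qed

lemma exp_second_order: "\<bar>exp (- x) - 1 + x\<bar> \<le> x\<^sup>2 * exp \<bar>x\<bar>" for x :: real
proof -
  obtain s where s: "\<bar>s\<bar> \<le> \<bar>- x\<bar>" "exp (- x) = (\<Sum>m<2. (- x) ^ m / fact m) + exp s / fact 2 * (- x)\<^sup>2"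
    using Maclaurin_exp_le[of "- x" 2] by blast
  have "exp (- x) - 1 + x = exp s / 2 * x\<^sup>2"
    using s(2) by (simp add: numeral_2_eq_2)
  moreover have "exp s / 2 * x\<^sup>2 \<le> exp \<bar>x\<bar> * x\<^sup>2"
  proof (rule mult_right_mono)
    have "exp s \<le> exp \<bar>x\<bar>" using s(1) by simp
    moreover have "0 < exp \<bar>x\<bar>" by simp
    ultimately show "exp s / 2 \<le> exp \<bar>x\<bar>" by linarith
  qed simp
  moreover have "0 \<le> exp s / 2 * x\<^sup>2" by simp
  ultimately show ?thesis by (simp only: abs_of_nonneg mult.commute[of "x\<^sup>2"])
qed

lemma quad_form_add: "quad_form (\<lambda>i j. M i j + H i j) I t = quad_form M I t + quad_form H I t"
  by (simp add: quad_form_def distrib_right sum.distrib)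

lemma quad_form_bound:
  fixes H :: "real^'v^'v"
  assumes "\<And>i. 0 \<le> t i"
  shows "\<bar>quad_form (\<lambda>i j. H $ i $ j) UNIV t\<bar> \<le> norm H * (\<Sum>i\<in>UNIV. t i)\<^sup>2"
proof -
  have "\<bar>H $ i $ j\<bar> \<le> norm H" for i j
    by (rule order_trans[OF component_le_norm_cart Finite_Cartesian_Product.norm_nth_le])
  then have "\<bar>H $ i $ j * t i * t j\<bar> \<le> norm H * (t i * t j)" for i j
    using assms by (simp add: abs_mult mult.assoc mult_right_mono)
  then have "\<bar>quad_form (\<lambda>i j. H $ i $ j) UNIV t\<bar> \<le> (\<Sum>i\<in>UNIV. \<Sum>j\<in>UNIV. norm H * (t i * t j))"
    unfolding quad_form_def by (intro order_trans[OF sum_abs] sum_mono order_trans[OF sum_abs])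
  also have "\<dots> = norm H * (\<Sum>i\<in>UNIV. t i)\<^sup>2"
    unfolding power2_eq_square sum_product by (simp add: sum_distrib_left)
  finally show ?thesis .
qed

text \<open>A perturbation of norm at most c/(2n) costs at most half of the coercivity, and the
  decay that is left bounds the second-order remainder by an integrable weight times the squared
  norm. Entries (i, j) and (j, i) count as independent variables.\<close>

lemma gauss_has_derivative:
  fixes X :: "real^'v^'v"
  assumes c: "0 < c" and coer: "coercive_on c UNIV (\<lambda>i j. X $ i $ j)"
  shows "((\<lambda>X. gauss (\<lambda>i j. X $ i $ j) UNIV (\<lambda>_. 1)) has_derivative
    (\<lambda>H. - (\<Sum>i\<in>UNIV. \<Sum>j\<in>UNIV. H $ i $ j * gauss (\<lambda>i j. X $ i $ j) UNIV (\<lambda>t. t i * t j)))) (at X)"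
proof -
  let ?n = "real CARD('v)"
  let ?q = "\<lambda>H. quad_form (\<lambda>i j. H $ i $ j) (UNIV :: 'v set)"
  let ?g = "\<lambda>i j. gauss (\<lambda>i j. X $ i $ j) UNIV (\<lambda>t. t i * t j)"
  let ?W = "\<lambda>t :: 'v \<Rightarrow> real. \<Prod>i\<in>UNIV. weight (c / 2) (t i)"
  let ?R = "LINT t|orthant (UNIV :: 'v set). ?W t"
  have c2: "0 < c / 2" using c by simp
  have n: "0 < ?n" by simp
  have mom: "integrable (orthant UNIV) (\<lambda>t. t i * t j * exp (- ?q X t))" for i j
  proof (rule integrable_gauss[OF finite c coer, where K = 1 and a = 2])
    show "(\<lambda>t. t i * t j) \<in> borel_measurable (orthant UNIV)"
      by (intro borel_measurable_times measurable_orthant_coordinate) auto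
    fix t :: "'v \<Rightarrow> real" assume "t \<in> space (orthant UNIV)"
    then have t: "\<And>i. 0 \<le> t i" by (rule orthant_nonneg) simp
    have "t i \<le> (\<Prod>i\<in>UNIV. 1 + t i)" for i
      using affine_bound[of UNIV t 0 "\<lambda>j. if j = i then 1 else 0"] t
      by (simp add: if_distrib[of "\<lambda>x. x * _"] cong: if_cong)
    then show "\<bar>t i * t j\<bar> \<le> 1 * (\<Prod>i\<in>UNIV. 1 + t i)\<^sup>2"
      using t by (simp add: power2_eq_square abs_mult mult_mono prod_nonneg)
  qed simp
  show ?thesis
  proof (rule has_derivative_quadratic_remainder[where d = "c / (2 * ?n)" and K = ?R])
    show "0 < c / (2 * ?n)" using c n by simp
    show "bounded_linear (\<lambda>H. - (\<Sum>i\<in>UNIV. \<Sum>j\<in>UNIV. H $ i $ j * ?g i j))"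
      unfolding linear_conv_bounded_linear[symmetric]
      by (rule linearI) (simp_all add: sum.distrib distrib_right sum_distrib_left mult.assoc)
    fix H :: "real^'v^'v" assume H: "norm H \<le> c / (2 * ?n)"
    have q: "\<bar>?q H t\<bar> \<le> c / 2 * (\<Sum>i\<in>UNIV. (t i)\<^sup>2)" if "\<And>i. 0 \<le> t i" for t
    proof -
      have "\<bar>?q H t\<bar> \<le> norm H * (\<Sum>i\<in>UNIV. t i)\<^sup>2" by (rule quad_form_bound[OF that])
      \<comment> \<open>The square of a sum of n terms is at most n times the sum of squares; this
        is where the n in the radius c/(2n) comes from.\<close>
      also have "\<dots> \<le> c / (2 * ?n) * ((\<Sum>i\<in>UNIV. (t i)\<^sup>2) * ?n)"
        using H c n sum_squared_le_sum_of_squares[of t UNIV]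
        by (intro mult_mono) auto
      finally show ?thesis using n by simp
    qed
    have qXH: "?q (X + H) t = ?q X t + ?q H t" for t
      using quad_form_add[of "\<lambda>i j. X $ i $ j" "\<lambda>i j. H $ i $ j"] by simp
    have coer2: "coercive_on (c / 2) UNIV (\<lambda>i j. (X + H) $ i $ j)"
      unfolding coercive_on_def
    proof (intro allI impI)
      fix t :: "'v \<Rightarrow> real" assume "\<forall>i\<in>UNIV. 0 \<le> t i"
      then have "\<And>i. 0 \<le> t i" by simp
      then show "c / 2 * (\<Sum>i\<in>UNIV. (t i)\<^sup>2) \<le> ?q (X + H) t"
        using q[of t] coercive_onD[OF coer, of t] unfolding qXH by auto
    qed
    have i1: "integrable (orthant UNIV) (\<lambda>t. exp (- ?q (X + H) t))"
      using integrable_gauss_one[OF finite c2 coer2] by simp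
    have i2: "integrable (orthant UNIV) (\<lambda>t. exp (- ?q X t))"
      using integrable_gauss_one[OF finite c coer] by simp
    have i3: "integrable (orthant UNIV) (\<lambda>t. ?q H t * exp (- ?q X t))"
      and e3: "(LINT t|orthant UNIV. ?q H t * exp (- ?q X t)) = (\<Sum>i\<in>UNIV. \<Sum>j\<in>UNIV. H $ i $ j * ?g i j)"
    proof -
      have e: "?q H t * exp (- ?q X t) =
          (\<Sum>i\<in>UNIV. \<Sum>j\<in>UNIV. H $ i $ j * (t i * t j * exp (- ?q X t)))" for t
        by (simp add: quad_form_def[of "\<lambda>i j. H $ i $ j"] sum_distrib_right mult.assoc)
      show "integrable (orthant UNIV) (\<lambda>t. ?q H t * exp (- ?q X t))"
        unfolding e by (intro Bochner_Integration.integrable_sum integrable_mult_right mom)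
      show "(LINT t|orthant UNIV. ?q H t * exp (- ?q X t)) = (\<Sum>i\<in>UNIV. \<Sum>j\<in>UNIV. H $ i $ j * ?g i j)"
        unfolding e using mom by (simp add: gauss_def)
    qed
    have "norm (gauss (\<lambda>i j. (X + H) $ i $ j) UNIV (\<lambda>_. 1) - gauss (\<lambda>i j. X $ i $ j) UNIV (\<lambda>_. 1) -
       - (\<Sum>i\<in>UNIV. \<Sum>j\<in>UNIV. H $ i $ j * ?g i j)) =
       \<bar>LINT t|orthant UNIV. exp (- ?q (X + H) t) - exp (- ?q X t) + ?q H t * exp (- ?q X t)\<bar>"
      using i1 i2 i3 by (simp add: gauss_def e3)
    also have "\<dots> \<le> (LINT t|orthant UNIV. (norm H)\<^sup>2 * ?W t)"
      unfolding real_norm_def[symmetric]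
    proof (rule order_trans[OF integral_norm_bound integral_mono])
      show "integrable (orthant UNIV) (\<lambda>t. norm (exp (- ?q (X + H) t) - exp (- ?q X t) + ?q H t * exp (- ?q X t)))"
        by (intro integrable_norm Bochner_Integration.integrable_add Bochner_Integration.integrable_diff i1 i2 i3)
      show "integrable (orthant UNIV) (\<lambda>t. (norm H)\<^sup>2 * ?W t)"
        by (intro integrable_mult_right integrable_orthant_weight c2) simp
      fix t :: "'v \<Rightarrow> real" assume sp: "t \<in> space (orthant UNIV)"
      then have t: "\<And>i. 0 \<le> t i" by (rule orthant_nonneg) simp
      let ?S = "\<Sum>i\<in>UNIV. (t i)\<^sup>2"
      let ?P = "\<Prod>i\<in>UNIV. 1 + t i"
      have S: "(\<Sum>i\<in>UNIV. t i) \<le> ?P" "0 \<le> (\<Sum>i\<in>UNIV. t i)"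
        using sum_le_prod_one_plus[of UNIV t] t by (auto intro: sum_nonneg)
      have "exp (- ?q (X + H) t) - exp (- ?q X t) + ?q H t * exp (- ?q X t) =
          exp (- ?q X t) * (exp (- ?q H t) - 1 + ?q H t)"
        unfolding qXH by (simp add: algebra_simps exp_add[symmetric])
      then have "\<bar>exp (- ?q (X + H) t) - exp (- ?q X t) + ?q H t * exp (- ?q X t)\<bar> =
          exp (- ?q X t) * \<bar>exp (- ?q H t) - 1 + ?q H t\<bar>" by (simp add: abs_mult)
      \<comment> \<open>Decay with constant c from \<open>X\<close> against growth with constant c/2
        from the remainder of the exponential leaves decay with c/2. The squared gauge is squared
        once more, which gives exactly the product of weights.\<close>
      also have "\<dots> \<le> exp (- (c * ?S)) * ((norm H * ?P\<^sup>2)\<^sup>2 * exp (c / 2 * ?S))"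
      proof (intro mult_mono)
        show "exp (- ?q X t) \<le> exp (- (c * ?S))" using coercive_onD[OF coer, of t] t by simp
        have "\<bar>?q H t\<bar> \<le> norm H * ?P\<^sup>2"
          using quad_form_bound[of t H, OF t] S mult_left_mono[OF power_mono[OF S, of 2], of "norm H"] by simp
        then have "(?q H t)\<^sup>2 \<le> (norm H * ?P\<^sup>2)\<^sup>2" by (metis abs_ge_zero power2_abs power_mono)
        moreover have "exp \<bar>?q H t\<bar> \<le> exp (c / 2 * ?S)" using q[of t, OF t] by simp
        ultimately show "\<bar>exp (- ?q H t) - 1 + ?q H t\<bar> \<le> (norm H * ?P\<^sup>2)\<^sup>2 * exp (c / 2 * ?S)"
          by (intro order_trans[OF exp_second_order] mult_mono) auto
      qed auto
      also have "\<dots> = (norm H)\<^sup>2 * (?P ^ 4 * exp (- (c / 2 * ?S)))"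
      proof -
        have "exp (- (c * ?S)) * exp (c / 2 * ?S) = exp (- (c / 2 * ?S))"
          by (simp add: exp_add[symmetric])
        then show ?thesis by (simp add: power_mult_distrib mult_ac power_mult[symmetric])
      qed
      also have "?P ^ 4 * exp (- (c / 2 * ?S)) = ?W t"
        using exp_sum[of UNIV "\<lambda>i. - (c / 2 * (t i)\<^sup>2)"]
        by (simp add: weight_def prod.distrib prod_power_distrib sum_distrib_left sum_negf sum_divide_distrib)
      finally show "norm (exp (- ?q (X + H) t) - exp (- ?q X t) + ?q H t * exp (- ?q X t)) \<le> (norm H)\<^sup>2 * ?W t"
        by simp
    qed
    also have "\<dots> = ?R * (norm H)\<^sup>2" by simp
    finally show "norm (gauss (\<lambda>i j. (X + H) $ i $ j) UNIV (\<lambda>_. 1) - gauss (\<lambda>i j. X $ i $ j) UNIV (\<lambda>_. 1) -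
       - (\<Sum>i\<in>UNIV. \<Sum>j\<in>UNIV. H $ i $ j * ?g i j)) \<le> ?R * (norm H)\<^sup>2" .
  qed
qed

section \<open>Derivatives of the determinant and of the root of its absolute value\<close>

lemma has_derivative_det_identity:
  "(det has_derivative (\<lambda>H :: real^'n^'n. \<Sum>i\<in>UNIV. H $ i $ i)) (at (mat 1))"
proof -
  let ?U = "UNIV :: 'n set"
  have "(det has_derivative (\<lambda>H :: real^'n^'n. \<Sum>p | p permutes ?U. of_int (sign p) *
      (\<Sum>i\<in>?U. H $ i $ p i * (\<Prod>j\<in>?U - {i}. mat 1 $ j $ p j)))) (at (mat 1))"
    unfolding det_def[abs_def]
    by (intro has_derivative_sum has_derivative_mult_right has_derivative_prod
        bounded_linear.has_derivative[OF bounded_linear_vec_nth] has_derivative_ident)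
  moreover have "(\<Sum>p | p permutes ?U. of_int (sign p) *
      (\<Sum>i\<in>?U. H $ i $ p i * (\<Prod>j\<in>?U - {i}. mat 1 $ j $ p j))) = (\<Sum>i\<in>?U. H $ i $ i)"
    for H :: "real^'n^'n"
  proof -
    \<comment> \<open>A permutation other than the identity moves at least two points, so after
      deletion of the factor at \<open>i\<close> an off-diagonal entry of the identity matrix
      remains.\<close>
    have zero: "(\<Prod>j\<in>?U - {i}. (mat 1 :: real^'n^'n) $ j $ p j) = 0" if p: "p permutes ?U" "p \<noteq> id" for p i
    proof -
      have "\<exists>j. j \<noteq> i \<and> p j \<noteq> j"
      proof (rule ccontr)
        assume "\<not> ?thesis"
        then have fix_p: "p j = j" if "j \<noteq> i" for j using that by blast
        have "p i = i"
        proof (rule ccontr)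
          assume "p i \<noteq> i"
          then have "p (p i) = p i" by (rule fix_p)
          then show False using permutes_inj[OF p(1)] \<open>p i \<noteq> i\<close> by (simp add: inj_eq)
        qed
        then have "p = id" using fix_p by (metis eq_id_iff)
        with p(2) show False by simp
      qed
      then obtain j where j: "j \<in> ?U - {i}" "p j \<noteq> j" by blast
      then have "(mat 1 :: real^'n^'n) $ j $ p j = 0" by (simp add: mat_def)
      with j(1) show ?thesis by (intro prod_zero) auto
    qed
    have "(\<Sum>p | p permutes ?U. of_int (sign p) *
      (\<Sum>i\<in>?U. H $ i $ p i * (\<Prod>j\<in>?U - {i}. mat 1 $ j $ p j))) =
      (\<Sum>p\<in>{id}. of_int (sign p) * (\<Sum>i\<in>?U. H $ i $ p i * (\<Prod>j\<in>?U - {i}. mat 1 $ j $ p j)))"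
      using permutes_id by (intro sum.mono_neutral_right) (auto simp: zero)
    also have "\<dots> = (\<Sum>i\<in>?U. H $ i $ i)" by (simp add: mat_def)
    finally show ?thesis .
  qed
  ultimately show ?thesis by simp
qed

text \<open>Jacobi's formula, transported from the identity matrix by left multiplication with
  \<open>N\<close>, which changes determinants by a constant factor only.\<close>

lemma has_derivative_det:
  fixes A N :: "real^'n^'n"
  assumes N: "N ** A = mat 1"
  shows "(det has_derivative (\<lambda>H. det A * (\<Sum>i\<in>UNIV. \<Sum>j\<in>UNIV. N $ j $ i * H $ i $ j))) (at A)"
proof -
  have dN: "det A * det N = 1" using N by (metis det_I det_mul mult.commute)
  have lin: "bounded_linear (\<lambda>X :: real^'n^'n. N ** X)"
    unfolding linear_conv_bounded_linear[symmetric]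
    by (rule linearI) (simp_all add: matrix_matrix_mult_def vec_eq_iff sum.distrib distrib_left
        sum_distrib_left mult_ac)
  have "((\<lambda>X. det (N ** X)) has_derivative (\<lambda>H. \<Sum>i\<in>UNIV. (N ** H) $ i $ i)) (at A)"
    by (rule has_derivative_compose[OF bounded_linear_imp_has_derivative[OF lin]])
      (simp add: N has_derivative_det_identity)
  then have "((\<lambda>X. det A * det (N ** X)) has_derivative (\<lambda>H. det A * (\<Sum>i\<in>UNIV. (N ** H) $ i $ i))) (at A)"
    by (rule has_derivative_mult_right)
  moreover have "det A * det (N ** X) = det X" for X
    using dN by (simp add: det_mul mult.assoc[symmetric])
  moreover have "(\<Sum>i\<in>UNIV. (N ** H) $ i $ i) = (\<Sum>i\<in>UNIV. \<Sum>j\<in>UNIV. N $ j $ i * H $ i $ j)" for H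
    by (subst sum.swap) (simp add: matrix_matrix_mult_def)
  ultimately show ?thesis by simp
qed

lemma has_real_derivative_abs:
  fixes x :: real
  assumes "x \<noteq> 0"
  shows "(abs has_real_derivative sgn x) (at x)"
proof (rule has_field_derivative_transform_within_open)
  show "((\<lambda>y. sgn x * y) has_real_derivative sgn x) (at x)"
    by (auto intro!: derivative_eq_intros)
  show "open {y. 0 < sgn x * y}" by (intro open_Collect_less continuous_intros)
qed (use assms in \<open>auto simp: sgn_if zero_less_mult_iff split: if_splits\<close>)

text \<open>The absolute value covers the hyperbolic case, where Gram determinants of nonempty
  simplices are negative. The sign in the derivative of the absolute value cancels against that of
  the determinant, so one formula serves both.\<close>

lemma has_derivative_sqrt_abs_det:
  fixes A N :: "real^'n^'n"
  assumes N: "N ** A = mat 1"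
  shows "((\<lambda>X. sqrt \<bar>det X\<bar>) has_derivative
    (\<lambda>H. sqrt \<bar>det A\<bar> / 2 * (\<Sum>i\<in>UNIV. \<Sum>j\<in>UNIV. N $ j $ i * H $ i $ j))) (at A)"
proof -
  have d0: "det A \<noteq> 0" using N by (metis det_I det_mul mult_zero_right zero_neq_one)
  let ?d = "det A"
  have "((\<lambda>x. sqrt \<bar>x\<bar>) has_real_derivative inverse (sqrt \<bar>?d\<bar>) / 2 * sgn ?d) (at ?d)"
    using d0 by (auto intro!: derivative_eq_intros has_real_derivative_abs)
  moreover have "inverse (sqrt \<bar>?d\<bar>) / 2 * sgn ?d = sqrt \<bar>?d\<bar> / (2 * ?d)"
  proof -
    have "sqrt \<bar>?d\<bar> * sqrt \<bar>?d\<bar> = \<bar>?d\<bar>" "\<bar>?d\<bar> = sgn ?d * ?d" "sgn ?d * sgn ?d = 1" "sqrt \<bar>?d\<bar> \<noteq> 0"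
      using d0 by (simp_all add: sgn_if)
    then show ?thesis using d0 by (simp add: field_simps)
  qed
  ultimately have "((\<lambda>x. sqrt \<bar>x\<bar>) has_derivative (\<lambda>h. sqrt \<bar>?d\<bar> / (2 * ?d) * h)) (at ?d)"
    by (simp only: has_field_derivative_def)
  from has_derivative_compose[OF has_derivative_det[OF N] this] show ?thesis
    using d0 by (simp add: field_simps)
qed

section \<open>Simplices in the model spaces\<close>

text \<open>Reverse Cauchy-Schwarz on the upper sheet. It makes every entry of the negated Gram
  matrix at least 1, the source of positivity on the orthant in the hyperbolic case.\<close>

lemma hyperbolic_bform_le:
  assumes "x \<in> model_space (-1)" "y \<in> model_space (-1)"
  shows "bform (-1) x y \<le> -1"
proof -
  have x: "fst x ^ 2 = 1 + snd x \<bullet> snd x" "0 < fst x" and y: "fst y ^ 2 = 1 + snd y \<bullet> snd y" "0 < fst y"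
    using assms by (auto simp: model_space_def bform_def power2_eq_square)
  have "(1 + norm (snd x) * norm (snd y))\<^sup>2 \<le> (1 + (norm (snd x))\<^sup>2) * (1 + (norm (snd y))\<^sup>2)"
  proof -
    have "0 \<le> (norm (snd x) - norm (snd y))\<^sup>2" by simp
    then show ?thesis by (simp add: power2_eq_square algebra_simps)
  qed
  also have "\<dots> = (fst x * fst y)\<^sup>2"
    by (simp add: power_mult_distrib x(1) y(1) power2_norm_eq_inner)
  finally have "1 + norm (snd x) * norm (snd y) \<le> fst x * fst y"
    by (rule power2_le_imp_le) (use x y in simp)
  moreover have "snd x \<bullet> snd y \<le> norm (snd x) * norm (snd y)" by (rule norm_cauchy_schwarz)
  ultimately show ?thesis by (simp add: bform_def)
qed

lemma nondeg_simplex_subset: "nondeg_simplex \<kappa> I B \<Longrightarrow> J \<subseteq> I \<Longrightarrow> nondeg_simplex \<kappa> J B"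
  unfolding nondeg_simplex_def by (meson image_mono independent_mono inj_on_subset order_trans)

text \<open>Independence of an indexed family rather than of its image: a repeated point shows up as
  the relation \<open>B i - B j = 0\<close>. Coefficients can then be functions on indices
  throughout.\<close>

lemma inj_independent_iff:
  fixes B :: "'v::finite \<Rightarrow> 'b::real_vector"
  shows "inj_on B I \<and> independent (B ` I) \<longleftrightarrow>
    (\<forall>c. (\<Sum>i\<in>I. c i *\<^sub>R B i) = 0 \<longrightarrow> (\<forall>i\<in>I. c i = 0))"
proof (intro iffI allI impI conjI ballI)
  fix c i assume a: "inj_on B I \<and> independent (B ` I)" "(\<Sum>i\<in>I. c i *\<^sub>R B i) = 0" "i \<in> I"
  let ?u = "\<lambda>v. c (inv_into I B v)"
  have "(\<Sum>v\<in>B ` I. ?u v *\<^sub>R v) = (\<Sum>i\<in>I. c i *\<^sub>R B i)"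
    using a(1) by (subst sum.reindex) auto
  then have "?u (B i) = 0"
    using a independentD[of "B ` I" "B ` I" ?u "B i"] by simp
  then show "c i = 0" using a(1,3) by simp
next
  assume a: "\<forall>c. (\<Sum>i\<in>I. c i *\<^sub>R B i) = 0 \<longrightarrow> (\<forall>i\<in>I. c i = 0)"
  show inj: "inj_on B I"
  proof (rule inj_onI, rule ccontr)
    fix i j assume ij: "i \<in> I" "j \<in> I" "B i = B j" "i \<noteq> j"
    let ?c = "\<lambda>l. (if l = i then 1 else 0) - (if l = j then 1 else 0) :: real"
    have "(\<Sum>l\<in>I. ?c l *\<^sub>R B l) = B i - B j"
      using ij by (simp add: scaleR_diff_left sum_subtractf if_distrib[of "\<lambda>x. x *\<^sub>R _"] cong: if_cong)
    then show False using a[rule_format, of ?c i] ij by simp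
  qed
  show "independent (B ` I)"
  proof
    assume "dependent (B ` I)"
    then obtain u v where u: "v \<in> B ` I" "u v \<noteq> 0" "(\<Sum>v\<in>B ` I. u v *\<^sub>R v) = 0"
      using dependent_finite[of "B ` I"] by auto
    then have "(\<Sum>i\<in>I. u (B i) *\<^sub>R B i) = 0" using inj by (simp add: sum.reindex)
    then show False using a[rule_format, of "\<lambda>i. u (B i)"] u by auto
  qed
qed

lemma nondeg_simplex_iff:
  "nondeg_simplex \<kappa> I B \<longleftrightarrow> (\<forall>i\<in>I. B i \<in> model_space \<kappa>) \<and>
    (\<forall>c. (\<Sum>i\<in>I. c i *\<^sub>R B i) = 0 \<longrightarrow> (\<forall>i\<in>I. c i = 0))"
  unfolding nondeg_simplex_def inj_independent_iff[symmetric] by auto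

lemma span_image_eq_sum:
  fixes B :: "'v::finite \<Rightarrow> 'b::real_vector"
  assumes "inj_on B I" "x \<in> span (B ` I)"
  obtains c where "x = (\<Sum>i\<in>I. c i *\<^sub>R B i)"
proof -
  have "finite (B ` I)" by simp
  from span_finite[OF this] obtain u where "x = (\<Sum>v\<in>B ` I. u v *\<^sub>R v)" using assms(2) by auto
  then have "x = (\<Sum>i\<in>I. u (B i) *\<^sub>R B i)" using assms(1) by (simp add: sum.reindex)
  then show ?thesis by (rule that)
qed

lemma sum_in_span_image: "(\<Sum>i\<in>I. c i *\<^sub>R B i) \<in> span (B ` I)"
  by (intro span_sum span_scale span_base imageI)

section \<open>Inverse Gram matrix, altitudes and projection coefficients of a simplex and its
  faces\<close>

locale model_simplex =
  fixes \<kappa> :: real and I :: "'v::{finite,linorder} set" and B :: "'v \<Rightarrow> real \<times> 'a::euclidean_space"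
  assumes curv: "\<kappa> = 1 \<or> \<kappa> = -1" and nondeg: "nondeg_simplex \<kappa> I B"
begin

lemma curv_sq [simp]: "\<kappa> * \<kappa> = 1" "\<kappa> * (\<kappa> * x) = x"
  using curv by auto

lemma in_model: "i \<in> I \<Longrightarrow> B i \<in> model_space \<kappa>"
  using nondeg by (simp add: nondeg_simplex_iff)

lemma form_self: "i \<in> I \<Longrightarrow> bform \<kappa> (B i) (B i) = \<kappa>"
  using in_model by (auto simp: model_space_def)

lemma lin_indep: "(\<Sum>i\<in>I. c i *\<^sub>R B i) = 0 \<Longrightarrow> i \<in> I \<Longrightarrow> c i = 0"
  using nondeg by (auto simp: nondeg_simplex_iff)

text \<open>Faces keep the family \<open>B\<close> and only shrink the index set, so each face has
  its own inverse Gram matrix, to which the same theory applies.\<close>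

lemma face: "J \<subseteq> I \<Longrightarrow> model_simplex \<kappa> J B"
  using curv nondeg nondeg_simplex_subset by (auto simp: model_simplex_def)

text \<open>A vector of the span orthogonal to all vertices has square 0; but it is orthogonal to
  one vertex, and there the form is positive on nonzero vectors. So the form stays nondegenerate on
  spans of nonempty faces even in the Lorentzian case.\<close>

lemma span_nondegenerate:
  assumes "I \<noteq> {}" "z \<in> span (B ` I)" "\<And>i. i \<in> I \<Longrightarrow> bform \<kappa> z (B i) = 0"
  shows "z = 0"
proof (rule ccontr)
  assume z: "z \<noteq> 0"
  obtain i where i: "i \<in> I" using assms(1) by auto
  have "inj_on B I" using nondeg by (simp add: nondeg_simplex_def)
  then obtain c where c: "z = (\<Sum>i\<in>I. c i *\<^sub>R B i)" by (rule span_image_eq_sum) (rule assms(2))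
  have "bform \<kappa> z z = (\<Sum>i\<in>I. c i * bform \<kappa> z (B i))"
    by (subst (2) c) (simp add: bform_simps)
  then have "bform \<kappa> z z = 0" using assms(3) by simp
  moreover have "bform \<kappa> z z > 0"
  proof (rule bform_orthogonal_pos[OF curv _ _ z])
    show "0 < \<kappa> * bform \<kappa> (B i) (B i)" using form_self[OF i] by simp
    show "bform \<kappa> (B i) z = 0" using assms(3)[OF i] by (simp add: bform_commute[of \<kappa> "B i" z])
  qed
  ultimately show False by simp
qed

abbreviation "G p q \<equiv> bform \<kappa> (B p) (B q)"

lemma gram_det_nonzero: "subdet I G \<noteq> 0"
proof (cases "I = {}")
  case False
  show ?thesis
  proof (rule subdet_nonzero, rule ballI)
    fix c p assume c: "\<And>p. p \<in> I \<Longrightarrow> (\<Sum>q\<in>I. G p q * c q) = 0" and p: "p \<in> I"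
    have "(\<Sum>q\<in>I. c q *\<^sub>R B q) = 0"
    proof (rule span_nondegenerate[OF False sum_in_span_image])
      fix i assume "i \<in> I"
      then show "bform \<kappa> (\<Sum>q\<in>I. c q *\<^sub>R B q) (B i) = 0"
        using c[of i] by (simp add: bform_sum_left bform_scaleR_left bform_commute[of \<kappa> "B i"] mult.commute)
    qed
    then show "c p = 0" by (rule lin_indep) (rule p)
  qed
qed simp

lemma ex_gram_inverse:
  "\<exists>N. \<forall>i\<in>I. \<forall>j\<in>I. (\<Sum>l\<in>I. N i l * G l j) = (if i = j then 1 else 0)"
  using subdet_inverse[OF gram_det_nonzero] by metis

definition N :: "'v \<Rightarrow> 'v \<Rightarrow> real" where
  "N = (SOME N. \<forall>i\<in>I. \<forall>j\<in>I. (\<Sum>l\<in>I. N i l * G l j) = (if i = j then 1 else 0))"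

lemma N_inverse: "i \<in> I \<Longrightarrow> j \<in> I \<Longrightarrow> (\<Sum>l\<in>I. N i l * G l j) = (if i = j then 1 else 0)"
  using someI_ex[OF ex_gram_inverse] unfolding N_def by blast

text \<open>The basis of the span dual to the vertices. \<open>N\<close> turns out to be its Gram
  matrix, which yields the symmetry of \<open>N\<close> and the sign of its diagonal.\<close>

definition dual :: "'v \<Rightarrow> real \<times> 'a" where
  "dual i = (\<Sum>l\<in>I. N i l *\<^sub>R B l)"

lemma dual_pairing: "i \<in> I \<Longrightarrow> j \<in> I \<Longrightarrow> bform \<kappa> (dual i) (B j) = (if i = j then 1 else 0)"
  by (simp add: dual_def bform_simps N_inverse)

lemma dual_gram: 
  assumes "i \<in> I" "j \<in> I"
  shows "bform \<kappa> (dual i) (dual j) = N j i"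
proof -
  have "bform \<kappa> (dual i) (dual j) = (\<Sum>l\<in>I. N j l * bform \<kappa> (dual i) (B l))"
    by (simp add: dual_def[of j] bform_simps)
  also have "\<dots> = (\<Sum>l\<in>I. if i = l then N j l else 0)"
    by (rule sum.cong) (auto simp: dual_pairing[OF assms(1)])
  finally show ?thesis using assms by simp
qed

lemma N_sym: "i \<in> I \<Longrightarrow> j \<in> I \<Longrightarrow> N i j = N j i"
  using dual_gram[of i j] dual_gram[of j i] bform_commute[of \<kappa> "dual i" "dual j"] by simp

text \<open>A second vertex is essential: the dual vector is orthogonal to it and therefore has
  positive square. For a single vertex \<open>N i i\<close> equals \<kappa>.\<close>

lemma N_diag_pos:
  assumes "i \<in> I" "I - {i} \<noteq> {}"
  shows "0 < N i i"
proof -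
  obtain j where j: "j \<in> I" "j \<noteq> i" using assms by auto
  have "dual i \<noteq> 0" using dual_pairing[OF assms(1,1)] by auto
  moreover have "bform \<kappa> (B j) (dual i) = 0"
    using dual_pairing[OF assms(1) j(1)] j(2) by (simp add: bform_commute[of \<kappa> "B j"])
  ultimately have "0 < bform \<kappa> (dual i) (dual i)"
    using form_self[OF j(1)] by (intro bform_orthogonal_pos[OF curv, of "B j"]) simp_all
  then show ?thesis using dual_gram assms by simp
qed

text \<open>The dual vector is orthogonal to the opposite facet. Scaled to coefficient 1 at
  \<open>B i\<close> it is the perpendicular from the span of the facet to the vertex.\<close>

lemma altitude:
  assumes "i \<in> I" "I - {i} \<noteq> {}"
  defines "u \<equiv> (1 / N i i) *\<^sub>R dual i"
  shows "u = B i + (\<Sum>s\<in>I - {i}. (N i s / N i i) *\<^sub>R B s)"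
    and "\<And>s. s \<in> I - {i} \<Longrightarrow> bform \<kappa> u (B s) = 0"
    and "bform \<kappa> u u = 1 / N i i"
proof -
  have n: "N i i \<noteq> 0" using N_diag_pos[OF assms(1,2)] by simp
  show "u = B i + (\<Sum>s\<in>I - {i}. (N i s / N i i) *\<^sub>R B s)"
    using n sum.remove[OF finite assms(1), of "\<lambda>l. N i l *\<^sub>R B l"]
    by (simp add: u_def dual_def scaleR_add_right scaleR_right.sum)
  show "bform \<kappa> u (B s) = 0" if "s \<in> I - {i}" for s
    using dual_pairing[OF assms(1), of s] that by (auto simp: u_def bform_simps)
  show "bform \<kappa> u u = 1 / N i i"
    using n dual_gram[OF assms(1,1)] by (simp add: u_def bform_simps)
qed

text \<open>Cramer's rule for a diagonal entry, read off as base times squared height, the squared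
  height being \<open>1 / N i i\<close>.\<close>

lemma subdet_facet:
  assumes "i \<in> I" "I - {i} \<noteq> {}"
  shows "N i i * subdet I G = subdet (I - {i}) G"
  using subdet_gram_height[OF assms(1) altitude(1)[OF assms] altitude(2)[OF assms]]
    altitude(3)[OF assms] N_diag_pos[OF assms] by simp

lemma orth_proj_eq:
  assumes "I \<noteq> {}" "y \<in> span (B ` I)" "\<And>i. i \<in> I \<Longrightarrow> bform \<kappa> (x - y) (B i) = 0"
  shows "orth_proj \<kappa> (B ` I) x = y"
  unfolding orth_proj_def
proof (rule the_equality)
  have inj: "inj_on B I" using nondeg by (simp add: nondeg_simplex_def)
  show "y \<in> span (B ` I) \<and> (\<forall>s\<in>span (B ` I). bform \<kappa> (x - y) s = 0)"
  proof (intro conjI ballI assms(2))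
    fix s assume "s \<in> span (B ` I)"
    with inj obtain c where "s = (\<Sum>i\<in>I. c i *\<^sub>R B i)" by (rule span_image_eq_sum)
    then show "bform \<kappa> (x - y) s = 0" 
      by (simp only: bform_sum_right bform_scaleR_right) (simp add: assms(3))
  qed
  fix z assume z: "z \<in> span (B ` I) \<and> (\<forall>s\<in>span (B ` I). bform \<kappa> (x - z) s = 0)"
  have "z - y = 0"
  proof (rule span_nondegenerate[OF assms(1)])
    show "z - y \<in> span (B ` I)" using z assms(2) by (simp add: span_diff)
    fix i assume i: "i \<in> I"
    then have "bform \<kappa> (x - z) (B i) = 0" using z by (simp add: span_base)
    then show "bform \<kappa> (z - y) (B i) = 0" using assms(3)[OF i] by (simp add: bform_simps)
  qed
  then show "z = y" by simp
qed

text \<open>\<open>B i\<close> minus its projection is the altitude vector, so the coefficients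
  \<open>R\<close>, with value 1 at \<open>i\<close>, are the coefficients of the altitude in the
  vertices.\<close>

lemma Rcoef_eq:
  assumes "i \<in> I" "I - {i} \<noteq> {}" "j \<in> I"
  shows "Rcoef \<kappa> B I i j = N i j / N i i"
proof (cases "j = i")
  case True
  then show ?thesis using N_diag_pos[OF assms(1,2)] by (simp add: Rcoef_def)
next
  case False
  interpret F: model_simplex \<kappa> "I - {i}" B by (rule face) auto
  let ?u = "(1 / N i i) *\<^sub>R dual i"
  let ?y = "\<Sum>s\<in>I - {i}. (- (N i s / N i i)) *\<^sub>R B s"
  have u: "B i - ?y = ?u" using altitude(1)[OF assms(1,2)] by (simp add: sum_negf)
  have "orth_proj \<kappa> (B ` (I - {i})) (B i) = ?y"
  proof (rule F.orth_proj_eq[OF assms(2)])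
    show "?y \<in> span (B ` (I - {i}))" by (rule sum_in_span_image)
    show "bform \<kappa> (B i - ?y) (B s) = 0" if "s \<in> I - {i}" for s
      unfolding u by (rule altitude(2)[OF assms(1,2) that])
  qed
  moreover have "representation (B ` (I - {i})) ?y (B j) = - (N i j / N i i)"
  proof -
    have ind: "independent (B ` (I - {i}))" and inj: "inj_on B (I - {i})"
      using F.nondeg by (auto simp: nondeg_simplex_def)
    have "representation (B ` (I - {i})) ?y (B j) =
        (\<Sum>s\<in>I - {i}. representation (B ` (I - {i})) ((- (N i s / N i i)) *\<^sub>R B s) (B j))"
      by (subst representation_sum[OF ind]) (intro span_scale span_base imageI, assumption, rule refl)
    also have "\<dots> = (\<Sum>s\<in>I - {i}. if s = j then - (N i s / N i i) else 0)"
    proof (rule sum.cong[OF refl])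
      fix s assume s: "s \<in> I - {i}"
      have "representation (B ` (I - {i})) ((- (N i s / N i i)) *\<^sub>R B s) (B j) =
          - (N i s / N i i) * representation (B ` (I - {i})) (B s) (B j)"
        by (subst representation_scale[OF ind]) (use s in \<open>auto intro: span_base\<close>)
      also have "representation (B ` (I - {i})) (B s) (B j) = (if B j = B s then 1 else 0)"
        using representation_basis[OF ind, of "B s"] s by simp
      also have "(B j = B s) = (s = j)" using inj s assms(3) False by (auto simp: inj_on_def)
      finally show "representation (B ` (I - {i})) ((- (N i s / N i i)) *\<^sub>R B s) (B j) =
          (if s = j then - (N i s / N i i) else 0)" by simp
    qed
    finally show ?thesis using assms(3) False by simp
  qed
  ultimately show ?thesis using False assms(3) by (simp add: Rcoef_def)
qed

text \<open>The factor \<kappa> turns the diagonal into 1 and makes the form positive on the cone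
  over the simplex, where the ambient form itself has the sign of \<kappa>.\<close>

definition M :: "'v \<Rightarrow> 'v \<Rightarrow> real" where "M p q = \<kappa> * G p q"

lemma quad_form_M: "quad_form M I t = \<kappa> * bform \<kappa> (\<Sum>i\<in>I. t i *\<^sub>R B i) (\<Sum>i\<in>I. t i *\<^sub>R B i)"
  by (simp add: quad_form_def M_def bform_simps sum_distrib_left mult_ac bform_commute)

lemma M_sym: "M i j = M j i"
  by (simp add: M_def bform_commute[of \<kappa> "B i"])

lemma M_inverse: "i \<in> I \<Longrightarrow> j \<in> I \<Longrightarrow> (\<Sum>l\<in>I. (\<kappa> * N i l) * M l j) = (if i = j then 1 else 0)"
  using N_inverse[of i j] by (simp add: M_def mult_ac)

text \<open>On the sphere, \<open>t i\<close> is the inner product of \<open>dual i\<close> with the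
  point, so Cauchy-Schwarz bounds its square by \<open>N i i\<close> times the form. In hyperbolic
  space all entries of \<open>M\<close> are at least 1, and for nonnegative \<open>t\<close> the
  off-diagonal terms may be dropped.\<close>

lemma coercive: "\<exists>c>0. coercive_on c I M"
proof (cases "\<kappa> = 1")
  case True
  have nn: "0 \<le> N i i" if "i \<in> I" for i
    using dual_gram[OF that that] True by (metis bform_one inner_ge_zero)
  let ?s = "\<Sum>i\<in>I. N i i"
  have s: "0 \<le> ?s" using nn by (intro sum_nonneg) auto
  have "coercive_on (1 / (1 + ?s)) I M"
    unfolding coercive_on_def
  proof (intro allI impI)
    fix t :: "'v \<Rightarrow> real"
    let ?w = "\<Sum>i\<in>I. t i *\<^sub>R B i"
    have q: "quad_form M I t = ?w \<bullet> ?w" by (simp only: quad_form_M) (simp add: True bform_one)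
    have "(t i)\<^sup>2 \<le> quad_form M I t * N i i" if i: "i \<in> I" for i
    proof -
      have "dual i \<bullet> ?w = (\<Sum>j\<in>I. t j * bform \<kappa> (dual i) (B j))"
        by (simp add: True bform_one inner_sum_right)
      also have "\<dots> = (\<Sum>j\<in>I. if i = j then t j else 0)" by (rule sum.cong) (auto simp: dual_pairing[OF i])
      also have "\<dots> = t i" using i by simp
      finally have "t i = dual i \<bullet> ?w" ..
      then have "(t i)\<^sup>2 \<le> (dual i \<bullet> dual i) * (?w \<bullet> ?w)" by (simp only: Cauchy_Schwarz_ineq)
      moreover have "dual i \<bullet> dual i = N i i" using dual_gram[OF i i] by (simp add: True bform_one)
      ultimately show ?thesis by (simp only: q mult.commute)
    qed
    then have "(\<Sum>i\<in>I. (t i)\<^sup>2) \<le> quad_form M I t * ?s"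
      unfolding sum_distrib_left by (rule sum_mono)
    also have "\<dots> \<le> quad_form M I t * (1 + ?s)" using q by (intro mult_left_mono) auto
    finally show "1 / (1 + ?s) * (\<Sum>i\<in>I. (t i)\<^sup>2) \<le> quad_form M I t"
      using s by (simp add: field_simps)
  qed
  then show ?thesis using s by (intro exI[of _ "1 / (1 + ?s)"]) auto
next
  case False
  then have k: "\<kappa> = -1" using curv by simp
  have "coercive_on 1 I M"
    unfolding coercive_on_def
  proof (intro allI impI)
    fix t :: "'v \<Rightarrow> real" assume t: "\<forall>i\<in>I. 0 \<le> t i"
    have "(\<Sum>i\<in>I. (t i)\<^sup>2) = (\<Sum>i\<in>I. \<Sum>j\<in>I. if i = j then t i * t j else 0)"
      by (simp add: power2_eq_square)
    also have "\<dots> \<le> quad_form M I t"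
      unfolding quad_form_def
    proof (intro sum_mono)
      fix i j assume ij: "i \<in> I" "j \<in> I"
      have "B i \<in> model_space (-1)" "B j \<in> model_space (-1)" using in_model ij by (simp_all add: k)
      then have "1 \<le> M i j" using hyperbolic_bform_le[of "B i" "B j"] unfolding M_def by (simp add: k)
      then have "1 * (t i * t j) \<le> M i j * (t i * t j)" using t ij by (intro mult_right_mono) auto
      moreover have "0 \<le> t i * t j" using t ij by simp
      ultimately show "(if i = j then t i * t j else 0) \<le> M i j * t i * t j" by (auto simp: mult.assoc)
    qed
    finally show "1 * (\<Sum>i\<in>I. (t i)\<^sup>2) \<le> quad_form M I t" by simp
  qed
  then show ?thesis by (intro exI[of _ 1]) auto
qed

lemma cone_form_pos:
  assumes "\<And>i. i \<in> I \<Longrightarrow> 0 \<le> t i" "i \<in> I" "t i \<noteq> 0"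
  shows "0 < quad_form M I t"
proof -
  obtain c where c: "0 < c" "coercive_on c I M" using coercive by blast
  have "0 < (\<Sum>i\<in>I. (t i)\<^sup>2)" using assms by (intro sum_pos2[of I i]) auto
  then have "0 < c * (\<Sum>i\<in>I. (t i)\<^sup>2)" using c by simp
  also have "\<dots> \<le> quad_form M I t" using c assms by (intro coercive_onD) auto
  finally show ?thesis .
qed

end

section \<open>Cone coordinates on an orthant\<close>

interpretation lborel_prod: product_sigma_finite "\<lambda>_. lborel :: real measure"
  by (simp add: product_sigma_finite_def sigma_finite_lborel)

abbreviation lborel_PiM :: "'v set \<Rightarrow> ('v \<Rightarrow> real) measure" where
  "lborel_PiM I \<equiv> (\<Pi>\<^sub>M i\<in>I. lborel)"

lemma sigma_finite_lborel_PiM: "finite I \<Longrightarrow> sigma_finite_measure (lborel_PiM I)"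
  by (rule lborel_prod.sigma_finite)

lemma measurable_lborel_PiM_coordinate:
  assumes "i \<in> I"
  shows "(\<lambda>x. x i) \<in> borel_measurable (lborel_PiM I)"
  using measurable_component_singleton[OF assms, of "\<lambda>_. lborel :: real measure"] by simp

lemma measurable_orthant_lborel_PiM: "(\<lambda>x. x) \<in> orthant I \<rightarrow>\<^sub>M lborel_PiM I"
proof -
  have "(\<lambda>x. \<lambda>i\<in>I. x i) \<in> orthant I \<rightarrow>\<^sub>M lborel_PiM I"
    by (rule measurable_restrict) (simp add: measurable_orthant_coordinate)
  moreover have "(\<lambda>i\<in>I. x i) = x" if "x \<in> space (orthant I)" for x
    using that by (auto simp: space_orthant PiE_def extensional_restrict)
  ultimately show ?thesis by (subst measurable_cong) auto
qed

lemma nn_integral_half_line: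
  assumes "f \<in> borel_measurable borel"
  shows "(\<integral>\<^sup>+y. f y \<partial>half_line) = (\<integral>\<^sup>+y. f y * indicator {0..} y \<partial>lborel)"
  unfolding half_line_def by (rule nn_integral_restrict_space) simp

lemma measurable_upd_pair:
  assumes "I = insert i J"
  shows "(\<lambda>z. (fst z)(i := snd z)) \<in> (lborel_PiM J \<Otimes>\<^sub>M lborel) \<rightarrow>\<^sub>M lborel_PiM I"
  using assms by (intro measurable_fun_upd[where J = J]) auto

lemma measurable_upd:
  assumes "i \<notin> J" "x \<in> space (lborel_PiM J)"
  shows "(\<lambda>y. x(i := y)) \<in> borel \<rightarrow>\<^sub>M lborel_PiM (insert i J)"
proof -
  have "(\<lambda>y. (x, y)) \<in> lborel \<rightarrow>\<^sub>M (lborel_PiM J \<Otimes>\<^sub>M lborel)" by (rule measurable_Pair1'[OF assms(2)])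
  from measurable_compose[OF this measurable_upd_pair[OF refl]] show ?thesis by simp
qed

lemma measurable_indicator_nonneg:
  assumes "finite I"
  shows "(indicator {x. \<forall>i\<in>I. 0 \<le> x i} :: _ \<Rightarrow> ennreal) \<in> borel_measurable (lborel_PiM I)"
proof -
  have "{x. \<forall>i\<in>I. 0 \<le> x i} \<inter> space (lborel_PiM I) = {x \<in> space (lborel_PiM I). \<forall>i\<in>I. 0 \<le> x i}" by auto
  also have "\<dots> \<in> sets (lborel_PiM I)"
    using assms by (intro sets.sets_Collect_finite_All)
      (auto intro!: borel_measurable_le measurable_lborel_PiM_coordinate)
  finally show ?thesis by (simp add: borel_measurable_indicator_iff)
qed

text \<open>Passes from the restricted measure to Lebesgue measure, for which affine substitutions
  are available, one coordinate at a time.\<close>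

lemma nn_integral_orthant:
  assumes "finite I" "f \<in> borel_measurable (lborel_PiM I)"
  shows "(\<integral>\<^sup>+x. f x \<partial>orthant I) = (\<integral>\<^sup>+x. f x * indicator {x. \<forall>i\<in>I. 0 \<le> x i} x \<partial>lborel_PiM I)"
  using assms
proof (induction I arbitrary: f rule: finite_induct)
  case empty
  then show ?case by (simp add: PiM_empty nn_integral_count_space_finite)
next
  case (insert i J)
  let ?g = "\<lambda>x. \<integral>\<^sup>+y. f (x(i := y)) * indicator {0..} y \<partial>lborel"
  have f_pair: "(\<lambda>z. f ((fst z)(i := snd z))) \<in> borel_measurable (lborel_PiM J \<Otimes>\<^sub>M lborel)"
    by (rule measurable_compose[OF measurable_upd_pair[OF refl] insert.prems])
  have g: "?g \<in> borel_measurable (lborel_PiM J)"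
    using f_pair by (intro sigma_finite_measure.borel_measurable_nn_integral[OF sigma_finite_lborel])
      (auto simp: case_prod_unfold)
  have ind: "(indicator {x. \<forall>i\<in>insert i J. 0 \<le> x i} :: _ \<Rightarrow> ennreal) \<in> borel_measurable (lborel_PiM (insert i J))"
    using insert.hyps by (intro measurable_indicator_nonneg) simp
  have "(\<integral>\<^sup>+x. f x \<partial>orthant (insert i J)) = (\<integral>\<^sup>+x. (\<integral>\<^sup>+y. f (x(i := y)) \<partial>half_line) \<partial>orthant J)"
    using insert.hyps measurable_compose[OF measurable_orthant_lborel_PiM insert.prems]
    by (intro orthant.product_nn_integral_insert) auto
  also have "\<dots> = (\<integral>\<^sup>+x. ?g x \<partial>orthant J)"
  proof (rule nn_integral_cong)
    fix x assume "x \<in> space (orthant J)"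
    then have "x \<in> space (lborel_PiM J)" using measurable_space[OF measurable_orthant_lborel_PiM] by blast
    then show "(\<integral>\<^sup>+y. f (x(i := y)) \<partial>half_line) = ?g x"
      using insert.hyps by (intro nn_integral_half_line measurable_compose[OF measurable_upd insert.prems])
  qed
  also have "\<dots> = (\<integral>\<^sup>+x. ?g x * indicator {x. \<forall>i\<in>J. 0 \<le> x i} x \<partial>lborel_PiM J)"
    by (rule insert.IH[OF g])
  also have "\<dots> = (\<integral>\<^sup>+x. (\<integral>\<^sup>+y. f (x(i := y)) * indicator {x. \<forall>i\<in>insert i J. 0 \<le> x i} (x(i := y)) \<partial>lborel) \<partial>lborel_PiM J)"
  proof (rule nn_integral_cong)
    fix x :: "'a \<Rightarrow> real" assume x: "x \<in> space (lborel_PiM J)"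
    have "?g x * indicator {x. \<forall>i\<in>J. 0 \<le> x i} x =
        (\<integral>\<^sup>+y. f (x(i := y)) * indicator {0..} y * indicator {x. \<forall>i\<in>J. 0 \<le> x i} x \<partial>lborel)"
      using insert.hyps x by (intro nn_integral_multc[symmetric] borel_measurable_times_ennreal)
        (auto intro: measurable_compose[OF measurable_upd insert.prems])
    also have "\<dots> = (\<integral>\<^sup>+y. f (x(i := y)) * indicator {x. \<forall>i\<in>insert i J. 0 \<le> x i} (x(i := y)) \<partial>lborel)"
      using insert.hyps(2) by (intro nn_integral_cong) (auto simp: indicator_def)
    finally show "?g x * indicator {x. \<forall>i\<in>J. 0 \<le> x i} x = \<dots>" .
  qed
  also have "\<dots> = (\<integral>\<^sup>+x. f x * indicator {x. \<forall>i\<in>insert i J. 0 \<le> x i} x \<partial>lborel_PiM (insert i J))"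
    using insert.hyps insert.prems ind
    by (intro lborel_prod.product_nn_integral_insert[symmetric] borel_measurable_times_ennreal) auto
  finally show ?case .
qed

text \<open>The Jacobian of a dilation, gathered coordinate by coordinate from the one-dimensional
  substitution.\<close>

lemma nn_integral_scale:
  assumes "finite J" "0 < r" "h \<in> borel_measurable (lborel_PiM J)"
  shows "(\<integral>\<^sup>+x. h x \<partial>lborel_PiM J) = ennreal (r ^ card J) * (\<integral>\<^sup>+x. h (\<lambda>i\<in>J. r * x i) \<partial>lborel_PiM J)"
  using assms(1,3)
proof (induction J arbitrary: h rule: finite_induct)
  case empty
  then show ?case by (simp add: PiM_empty nn_integral_count_space_finite)
next
  case (insert i J)
  have r_meas: "(\<lambda>x. \<lambda>j\<in>I. r * x j) \<in> lborel_PiM I \<rightarrow>\<^sub>M lborel_PiM I" for I :: "'a set"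
    by (rule measurable_restrict) (simp add: borel_measurable_times measurable_lborel_PiM_coordinate)
  let ?H = "\<lambda>x. \<integral>\<^sup>+y. h (x(i := r * y)) \<partial>lborel"
  have upd_r: "(\<lambda>z. (fst z)(i := r * snd z)) \<in> (lborel_PiM J \<Otimes>\<^sub>M lborel) \<rightarrow>\<^sub>M lborel_PiM (insert i J)"
    by (intro measurable_fun_upd[where J = J]) auto
  have H: "?H \<in> borel_measurable (lborel_PiM J)"
    using measurable_compose[OF upd_r insert.prems]
    by (intro sigma_finite_measure.borel_measurable_nn_integral[OF sigma_finite_lborel])
      (simp add: case_prod_unfold del: fun_upd_apply)
  have "(\<integral>\<^sup>+x. h x \<partial>lborel_PiM (insert i J)) = (\<integral>\<^sup>+x. (\<integral>\<^sup>+y. h (x(i := y)) \<partial>lborel) \<partial>lborel_PiM J)"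
    using insert.hyps insert.prems by (intro lborel_prod.product_nn_integral_insert) auto
  also have "\<dots> = (\<integral>\<^sup>+x. ennreal r * ?H x \<partial>lborel_PiM J)"
  proof (rule nn_integral_cong)
    fix x :: "'a \<Rightarrow> real" assume x: "x \<in> space (lborel_PiM J)"
    have "(\<lambda>y. h (x(i := y))) \<in> borel_measurable borel"
      using insert.hyps x by (intro measurable_compose[OF measurable_upd insert.prems])
    from nn_integral_real_affine[OF this, of r 0] show "(\<integral>\<^sup>+y. h (x(i := y)) \<partial>lborel) = ennreal r * ?H x"
      using assms(2) by simp
  qed
  also have "\<dots> = ennreal r * (\<integral>\<^sup>+x. ?H x \<partial>lborel_PiM J)" by (rule nn_integral_cmult[OF H])
  also have "(\<integral>\<^sup>+x. ?H x \<partial>lborel_PiM J) =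
      ennreal (r ^ card J) * (\<integral>\<^sup>+x. ?H (\<lambda>j\<in>J. r * x j) \<partial>lborel_PiM J)"
    by (rule insert.IH[OF H])
  also have "(\<integral>\<^sup>+x. ?H (\<lambda>j\<in>J. r * x j) \<partial>lborel_PiM J) =
      (\<integral>\<^sup>+x. (\<integral>\<^sup>+y. h (\<lambda>j\<in>insert i J. r * (x(i := y)) j) \<partial>lborel) \<partial>lborel_PiM J)"
  proof (intro nn_integral_cong arg_cong[of _ _ h])
    fix x :: "'a \<Rightarrow> real" and y :: real
    show "(\<lambda>j\<in>J. r * x j)(i := r * y) = (\<lambda>j\<in>insert i J. r * (x(i := y)) j)"
      using insert.hyps(2) by (auto simp: fun_eq_iff)
  qed
  also have "\<dots> = (\<integral>\<^sup>+x. h (\<lambda>j\<in>insert i J. r * x j) \<partial>lborel_PiM (insert i J))"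
    by (rule lborel_prod.product_nn_integral_insert[symmetric, OF insert.hyps
          measurable_compose[OF r_meas insert.prems]])
  moreover have "ennreal (r ^ card (insert i J)) = ennreal r * ennreal (r ^ card J)"
    using insert.hyps assms(2) by (simp add: ennreal_mult)
  ultimately show ?case by (simp only: mult.assoc)
qed

text \<open>Full barycentric coordinates: the coordinate of \<open>m\<close>, which is not a
  parameter, is restored so that all of them sum to 1.\<close>

definition cone_point :: "'v \<Rightarrow> 'v set \<Rightarrow> ('v \<Rightarrow> real) \<Rightarrow> 'v \<Rightarrow> real" where
  "cone_point m J x = x(m := 1 - (\<Sum>j\<in>J. x j))"

text \<open>Spelled exactly like the parameter domain inside \<open>simplex_volume\<close>, so that
  it can be folded there.\<close>

definition std_simplex :: "'v set \<Rightarrow> ('v \<Rightarrow> real) set" where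
  "std_simplex J = {x \<in> J \<rightarrow>\<^sub>E UNIV. (\<forall>j\<in>J. 0 \<le> x j) \<and> (\<Sum>j\<in>J. x j) \<le> 1}"

lemma measurable_sum_coordinates:
  "(\<lambda>x. \<Sum>j\<in>J. x j) \<in> borel_measurable (lborel_PiM J)"
  by (intro borel_measurable_sum measurable_lborel_PiM_coordinate)

lemma std_simplex_measurable: "finite J \<Longrightarrow> indicator (std_simplex J) \<in> borel_measurable (lborel_PiM J)"
proof -
  assume fin: "finite J"
  have "std_simplex J = {x \<in> space (lborel_PiM J). (\<forall>j\<in>J. 0 \<le> x j) \<and> (\<Sum>j\<in>J. x j) \<le> 1}"
    by (simp add: std_simplex_def space_PiM)
  also have "\<dots> \<in> sets (lborel_PiM J)"
    using fin by (intro sets.sets_Collect_conj sets.sets_Collect_finite_All borel_measurable_le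
        borel_measurable_const measurable_lborel_PiM_coordinate measurable_sum_coordinates)
      (auto intro!: borel_measurable_le measurable_lborel_PiM_coordinate)
  finally show ?thesis by (rule borel_measurable_indicator)
qed

text \<open>The map \<open>(x, r) \<mapsto> r \<cdot> cone_point m J x\<close> parametrises the orthant by the
  simplex and the sum of the coordinates.\<close>
lemma nn_integral_orthant_cone:
  assumes fin: "finite I" and m: "m \<in> I" and f: "f \<in> borel_measurable (lborel_PiM I)"
  defines "J \<equiv> I - {m}"
  shows "(\<integral>\<^sup>+x. f x \<partial>orthant I) =
    (\<integral>\<^sup>+x. indicator (std_simplex J) x *
      (\<integral>\<^sup>+r. ennreal (r ^ card J) * f (\<lambda>i\<in>I. r * cone_point m J x i) \<partial>half_line) \<partial>lborel_PiM J)"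
proof -
  have I: "I = insert m J" "m \<notin> J" "finite J" using m fin by (auto simp: J_def)
  interpret J: sigma_finite_measure "lborel_PiM J" by (rule sigma_finite_lborel_PiM[OF I(3)])
  interpret P: pair_sigma_finite "lborel_PiM J" "lborel :: real measure"
    by (simp add: pair_sigma_finite_def J.sigma_finite_measure_axioms sigma_finite_lborel)
  define S where "S x = (\<Sum>j\<in>J. x j)" for x :: "'a \<Rightarrow> real"
  define E where "E = {x :: 'a \<Rightarrow> real. \<forall>j\<in>J. 0 \<le> x j}"
  have S_meas: "S \<in> borel_measurable (lborel_PiM J)"
    unfolding S_def[abs_def] by (rule measurable_sum_coordinates)
  have fst_i: "(\<lambda>z. fst z i) \<in> borel_measurable (lborel_PiM J \<Otimes>\<^sub>M lborel)" if "i \<in> J" for i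
    using that by (intro measurable_compose[OF measurable_fst measurable_lborel_PiM_coordinate])
  have snd_b: "snd \<in> borel_measurable (lborel_PiM J \<Otimes>\<^sub>M lborel)"
    using measurable_snd[of "lborel_PiM J" lborel] by simp
  have S_fst: "(\<lambda>z. S (fst z)) \<in> borel_measurable (lborel_PiM J \<Otimes>\<^sub>M lborel)"
    by (rule measurable_compose[OF measurable_fst S_meas])
  \<comment> \<open>The new variable \<open>r\<close> is the sum of all coordinates, so
    \<open>r - S x\<close> is the coordinate of \<open>m\<close>; the indicator restates
    nonnegativity of all coordinates in these variables.\<close>
  let ?F = "\<lambda>x r. f (x(m := r - S x)) * indicator {z. fst z \<in> E \<and> S (fst z) \<le> snd z} (x, r)"
  have F_meas: "(\<lambda>z. ?F (fst z) (snd z)) \<in> borel_measurable (lborel_PiM J \<Otimes>\<^sub>M lborel)"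
  proof (intro borel_measurable_times_ennreal)
    have "(\<lambda>z. (fst z)(m := snd z - S (fst z))) \<in> (lborel_PiM J \<Otimes>\<^sub>M lborel) \<rightarrow>\<^sub>M lborel_PiM I"
      using I(1) borel_measurable_diff[OF snd_b S_fst] by (intro measurable_fun_upd[where J = J]) auto
    then show "(\<lambda>z. f ((fst z)(m := snd z - S (fst z)))) \<in> borel_measurable (lborel_PiM J \<Otimes>\<^sub>M lborel)"
      by (rule measurable_compose[OF _ f])
    have "{z. fst z \<in> E \<and> S (fst z) \<le> snd z} \<inter> space (lborel_PiM J \<Otimes>\<^sub>M lborel) =
       {z \<in> space (lborel_PiM J \<Otimes>\<^sub>M lborel). (\<forall>j\<in>J. 0 \<le> fst z j) \<and> S (fst z) \<le> snd z}"
      by (auto simp: E_def)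
    also have "\<dots> \<in> sets (lborel_PiM J \<Otimes>\<^sub>M lborel)"
      using I(3) by (intro sets.sets_Collect_conj sets.sets_Collect_finite_All borel_measurable_le S_fst snd_b)
        (auto intro!: borel_measurable_le fst_i)
    finally show "(\<lambda>z. indicator {z. fst z \<in> E \<and> S (fst z) \<le> snd z} (fst z, snd z) :: ennreal)
        \<in> borel_measurable (lborel_PiM J \<Otimes>\<^sub>M lborel)"
      by (simp add: borel_measurable_indicator_iff)
  qed
  have "(\<integral>\<^sup>+x. f x \<partial>orthant I) = (\<integral>\<^sup>+x. f x * indicator {x. \<forall>i\<in>I. 0 \<le> x i} x \<partial>lborel_PiM I)"
    by (rule nn_integral_orthant[OF fin f])
  also have "\<dots> = (\<integral>\<^sup>+x. (\<integral>\<^sup>+y. f (x(m := y)) * indicator {x. \<forall>i\<in>I. 0 \<le> x i} (x(m := y)) \<partial>lborel) \<partial>lborel_PiM J)"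
  proof -
    have "(\<lambda>x. f x * indicator {x. \<forall>i\<in>I. 0 \<le> x i} x) \<in> borel_measurable (lborel_PiM I)"
      by (intro borel_measurable_times_ennreal f measurable_indicator_nonneg fin)
    then show ?thesis using I unfolding I(1) by (intro lborel_prod.product_nn_integral_insert) auto
  qed
  also have "\<dots> = (\<integral>\<^sup>+x. (\<integral>\<^sup>+r. ?F x r \<partial>lborel) \<partial>lborel_PiM J)"
  proof (rule nn_integral_cong)
    fix x :: "'a \<Rightarrow> real" assume x: "x \<in> space (lborel_PiM J)"
    let ?g = "\<lambda>y. f (x(m := y)) * indicator {x. \<forall>i\<in>I. 0 \<le> x i} (x(m := y))"
    have ind: "indicator {x. \<forall>i\<in>I. 0 \<le> x i} (x(m := y)) = (indicator {0..} y * indicator E x :: ennreal)" for y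
      using I(2) by (auto simp: I(1) E_def indicator_def)
    have "(\<lambda>y. f (x(m := y)) * (indicator {0..} y * indicator E x)) \<in> borel_measurable borel"
      using f x I unfolding I(1)
      by (intro borel_measurable_times_ennreal measurable_compose[OF measurable_upd]) auto
    then have "?g \<in> borel_measurable borel" by (simp only: ind)
    from nn_integral_real_affine[OF this, of 1 "- S x"]
    have "(\<integral>\<^sup>+y. ?g y \<partial>lborel) = (\<integral>\<^sup>+r. ?g (- S x + 1 * r) \<partial>lborel)" by simp
    also have "\<dots> = (\<integral>\<^sup>+r. ?F x r \<partial>lborel)"
      unfolding ind by (intro nn_integral_cong) (auto simp: indicator_def)
    finally show "(\<integral>\<^sup>+y. ?g y \<partial>lborel) = (\<integral>\<^sup>+r. ?F x r \<partial>lborel)" .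
  qed
  also have "\<dots> = (\<integral>\<^sup>+r. (\<integral>\<^sup>+x. ?F x r \<partial>lborel_PiM J) \<partial>lborel)"
    using F_meas by (intro P.Fubini'[symmetric]) (simp add: case_prod_unfold del: fun_upd_apply)
  also have "\<dots> = (\<integral>\<^sup>+r. (\<integral>\<^sup>+x. indicator (std_simplex J) x *
      (ennreal (r ^ card J) * f (\<lambda>i\<in>I. r * cone_point m J x i) * indicator {0..} r) \<partial>lborel_PiM J) \<partial>lborel)"
  proof (rule nn_integral_cong_AE)
    \<comment> \<open>At \<open>r = 0\<close> the dilation is not invertible, but this is a null
      set; for negative \<open>r\<close> both sides vanish.\<close>
    have "AE r in lborel. r \<noteq> (0::real)" by (rule AE_lborel_singleton)
    then show "AE r in lborel. (\<integral>\<^sup>+x. ?F x r \<partial>lborel_PiM J) = (\<integral>\<^sup>+x. indicator (std_simplex J) x *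
      (ennreal (r ^ card J) * f (\<lambda>i\<in>I. r * cone_point m J x i) * indicator {0..} r) \<partial>lborel_PiM J)"
    proof eventually_elim
      case (elim r)
      show ?case
      proof (cases "0 < r")
        case False
        then have "r < 0" using elim by simp
        have "0 \<le> S x" if "x \<in> E" for x using that by (auto simp: S_def E_def intro: sum_nonneg)
        then have z: "?F x r = 0" for x using \<open>r < 0\<close> by (force simp: indicator_def)
        show ?thesis unfolding z using \<open>r < 0\<close> by simp
      next
        case True
        have F_r: "(\<lambda>x. ?F x r) \<in> borel_measurable (lborel_PiM J)"
          using measurable_compose[OF measurable_Pair2'[of r lborel "lborel_PiM J"] F_meas] by simp
        \<comment> \<open>Dilating the parameters by \<open>r\<close> produces the Jacobian and
          brings them into the standard simplex.\<close>
        have "(\<integral>\<^sup>+x. ?F x r \<partial>lborel_PiM J) =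
            ennreal (r ^ card J) * (\<integral>\<^sup>+x. ?F (\<lambda>i\<in>J. r * x i) r \<partial>lborel_PiM J)"
          by (rule nn_integral_scale[OF I(3) True F_r])
        also have "\<dots> = (\<integral>\<^sup>+x. ennreal (r ^ card J) * ?F (\<lambda>i\<in>J. r * x i) r \<partial>lborel_PiM J)"
        proof (rule nn_integral_cmult[symmetric])
          have "(\<lambda>x. \<lambda>i\<in>J. r * x i) \<in> lborel_PiM J \<rightarrow>\<^sub>M lborel_PiM J"
            by (rule measurable_restrict) (simp add: borel_measurable_times measurable_lborel_PiM_coordinate)
          then show "(\<lambda>x. ?F (\<lambda>i\<in>J. r * x i) r) \<in> borel_measurable (lborel_PiM J)"
            by (rule measurable_compose[OF _ F_r])
        qed
        also have "\<dots> = (\<integral>\<^sup>+x. indicator (std_simplex J) x *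
            (ennreal (r ^ card J) * f (\<lambda>i\<in>I. r * cone_point m J x i) * indicator {0..} r) \<partial>lborel_PiM J)"
        proof (rule nn_integral_cong)
          fix x :: "'a \<Rightarrow> real" assume x: "x \<in> space (lborel_PiM J)"
          let ?y = "\<lambda>i\<in>J. r * x i"
          have Sy: "S ?y = r * S x" by (simp add: S_def sum_distrib_left)
          have 1: "?y(m := r - S ?y) = (\<lambda>i\<in>I. r * cone_point m J x i)"
            unfolding Sy using I(2) by (auto simp: fun_eq_iff I(1) cone_point_def S_def algebra_simps)
          have "?y \<in> E \<longleftrightarrow> x \<in> E" using True by (auto simp: E_def zero_le_mult_iff)
          moreover have "S ?y \<le> r \<longleftrightarrow> S x \<le> 1" unfolding Sy using True by simp
          ultimately have 2: "indicator {z. fst z \<in> E \<and> S (fst z) \<le> snd z} (?y, r) = (indicator (std_simplex J) x :: ennreal)"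
            using x by (auto simp: indicator_def std_simplex_def E_def S_def space_PiM)
          show "ennreal (r ^ card J) * ?F ?y r = indicator (std_simplex J) x *
            (ennreal (r ^ card J) * f (\<lambda>i\<in>I. r * cone_point m J x i) * indicator {0..} r)"
            unfolding 1 2 using True by (simp add: mult_ac)
        qed
        finally show ?thesis .
      qed
    qed
  qed
  also have "\<dots> = (\<integral>\<^sup>+x. (\<integral>\<^sup>+r. indicator (std_simplex J) x *
      (ennreal (r ^ card J) * f (\<lambda>i\<in>I. r * cone_point m J x i) * indicator {0..} r) \<partial>lborel) \<partial>lborel_PiM J)"
  proof (rule P.Fubini')
    have cp: "(\<lambda>z. \<lambda>i\<in>I. snd z * cone_point m J (fst z) i) \<in> (lborel_PiM J \<Otimes>\<^sub>M lborel) \<rightarrow>\<^sub>M lborel_PiM I"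
    proof (rule measurable_restrict)
      fix i assume "i \<in> I"
      then have "(\<lambda>z. cone_point m J (fst z) i) \<in> borel_measurable (lborel_PiM J \<Otimes>\<^sub>M lborel)"
        using fst_i borel_measurable_diff[OF borel_measurable_const S_fst, of 1]
        by (cases "i = m") (auto simp: cone_point_def I(1) S_def)
      from borel_measurable_times[OF snd_b this]
      show "(\<lambda>z. snd z * cone_point m J (fst z) i) \<in> (lborel_PiM J \<Otimes>\<^sub>M lborel) \<rightarrow>\<^sub>M lborel" by simp
    qed
    show "(\<lambda>(x, r). indicator (std_simplex J) x *
      (ennreal (r ^ card J) * f (\<lambda>i\<in>I. r * cone_point m J x i) * indicator {0..} r))
      \<in> borel_measurable (lborel_PiM J \<Otimes>\<^sub>M lborel)"
      unfolding case_prod_unfold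
      by (intro borel_measurable_times_ennreal measurable_compose[OF cp f]
          measurable_compose[OF measurable_fst std_simplex_measurable[OF I(3)]]
          measurable_compose[OF snd_b]) auto
  qed
  also have "\<dots> = (\<integral>\<^sup>+x. indicator (std_simplex J) x *
      (\<integral>\<^sup>+r. ennreal (r ^ card J) * f (\<lambda>i\<in>I. r * cone_point m J x i) \<partial>half_line) \<partial>lborel_PiM J)"
  proof (rule nn_integral_cong)
    fix x :: "'a \<Rightarrow> real" assume x: "x \<in> space (lborel_PiM J)"
    have "(\<lambda>r. \<lambda>i\<in>I. r * cone_point m J x i) \<in> borel \<rightarrow>\<^sub>M lborel_PiM I"
      by (rule measurable_restrict) simp
    then have g: "(\<lambda>r. ennreal (r ^ card J) * f (\<lambda>i\<in>I. r * cone_point m J x i)) \<in> borel_measurable borel"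
      by (intro borel_measurable_times_ennreal measurable_compose[OF _ f]) auto
    show "(\<integral>\<^sup>+r. indicator (std_simplex J) x *
      (ennreal (r ^ card J) * f (\<lambda>i\<in>I. r * cone_point m J x i) * indicator {0..} r) \<partial>lborel) =
      indicator (std_simplex J) x *
      (\<integral>\<^sup>+r. ennreal (r ^ card J) * f (\<lambda>i\<in>I. r * cone_point m J x i) \<partial>half_line)"
      unfolding nn_integral_half_line[OF g]
      by (rule nn_integral_cmult, rule borel_measurable_times_ennreal) (use g in simp_all)
  qed
  finally show ?thesis .
qed

section \<open>Volume of a simplex as a Gaussian integral\<close>

text \<open>The integral along a ray of the cone; with \<open>n\<close> the dimension it is the
  constant that relates the Gaussian integral to the volume.\<close>

definition radial_moment :: "nat \<Rightarrow> real" where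
  "radial_moment n = (LINT r|half_line. r ^ n * exp (- r\<^sup>2))"

lemma integrable_radial_moment: "integrable half_line (\<lambda>r. r ^ n * exp (- r\<^sup>2))"
  and radial_moment_even: "radial_moment (2 * k) = sqrt pi / 2 * (fact (2 * k) / (2 ^ (2 * k) * fact k))"
  and radial_moment_odd: "radial_moment (2 * k + 1) = fact k / 2"
proof -
  have comm: "(\<lambda>r::real. r ^ n * exp (- r\<^sup>2)) = (\<lambda>r. exp (- r\<^sup>2) * r ^ n)" for n
    by (simp add: mult.commute fun_eq_iff)
  have int: "integrable half_line (\<lambda>r. r ^ n * exp (- r\<^sup>2)) \<longleftrightarrow>
      integrable lborel (\<lambda>x::real. indicator {0..} x *\<^sub>R (exp (- x\<^sup>2) * x ^ n))" for n
    unfolding half_line_def comm by (rule integrable_restrict_space) simp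
  have eq: "radial_moment n = (\<integral>x. indicator {0..} x *\<^sub>R (exp (- x\<^sup>2) * x ^ n) \<partial>(lborel :: real measure))" for n
    unfolding radial_moment_def half_line_def comm by (rule integral_restrict_space) simp
  show "integrable half_line (\<lambda>r. r ^ n * exp (- r\<^sup>2))"
  proof (cases "even n")
    case True
    then obtain k where "n = 2 * k" by (elim evenE)
    then show ?thesis using gaussian_moment_even_pos[of k] by (simp add: int has_bochner_integral_iff)
  next
    case False
    then obtain k where "n = 2 * k + 1" by (elim oddE)
    then show ?thesis unfolding int using gaussian_moment_odd_pos[of k] by (simp add: has_bochner_integral_iff)
  qed
  show "radial_moment (2 * k) = sqrt pi / 2 * (fact (2 * k) / (2 ^ (2 * k) * fact k))"
    unfolding eq by (rule has_bochner_integral_integral_eq[OF gaussian_moment_even_pos])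
  show "radial_moment (2 * k + 1) = fact k / 2"
    unfolding eq by (rule has_bochner_integral_integral_eq[OF gaussian_moment_odd_pos])
qed

lemma radial_moment_pos: "0 < radial_moment n"
proof (cases "even n")
  case True
  then obtain k where "n = 2 * k" by (elim evenE)
  then show ?thesis by (simp only: radial_moment_even) simp
next
  case False
  then obtain k where "n = 2 * k + 1" by (elim oddE)
  then show ?thesis by (simp only: radial_moment_odd) simp
qed

text \<open>Read off from the closed forms for the two parities. With n = k - 2 the factor is (k -
  1)/2, the source of the constant k (k - 2)!.\<close>

lemma radial_moment_rec: "radial_moment (n + 2) = (real n + 1) / 2 * radial_moment n"
proof (cases "even n")
  case True
  then obtain k where k: "n = 2 * k" by (elim evenE)
  have "radial_moment (n + 2) = radial_moment (2 * Suc k)" by (simp add: k)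
  also have "\<dots> = (real n + 1) / 2 * radial_moment n"
  proof -
    define x where "x = real k + 1"
    have "x \<noteq> 0" by (simp add: x_def)
    have 1: "fact (2 * Suc k) = 2 * x * ((2 * real k + 1) * fact (2 * k))"
      by (simp add: x_def algebra_simps)
    have 2: "(2::real) ^ (2 * Suc k) = 4 * 2 ^ (2 * k)" and 3: "fact (Suc k) = x * fact k"
      by (simp_all add: x_def)
    show ?thesis unfolding k radial_moment_even 1 2 3 using \<open>x \<noteq> 0\<close> by (simp add: divide_simps)
  qed
  finally show ?thesis .
next
  case False
  then obtain k where k: "n = 2 * k + 1" by (elim oddE)
  have "radial_moment (n + 2) = radial_moment (2 * Suc k + 1)" by (simp add: k)
  also have "\<dots> = (real n + 1) / 2 * radial_moment n"
    unfolding k radial_moment_odd by (simp add: field_simps)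
  finally show ?thesis .
qed

text \<open>Substitution of \<open>sqrt q * r\<close> for the variable; the exponent
  \<open>Suc n\<close> counts the \<open>n\<close> powers and the differential.\<close>

lemma nn_integral_radial:
  assumes q: "0 < q"
  shows "(\<integral>\<^sup>+r. ennreal (r ^ n * exp (- (q * r\<^sup>2))) \<partial>half_line) =
    ennreal (radial_moment n / sqrt q ^ Suc n)"
proof -
  let ?g = "\<lambda>r. ennreal (r ^ n * exp (- r\<^sup>2)) * indicator {0..} r"
  have "ennreal (radial_moment n) = (\<integral>\<^sup>+r. ennreal (r ^ n * exp (- r\<^sup>2)) \<partial>half_line)"
    unfolding radial_moment_def
    by (rule nn_integral_eq_integral[symmetric, OF integrable_radial_moment]) (auto intro!: AE_I2)
  also have "\<dots> = (\<integral>\<^sup>+r. ?g r \<partial>lborel)" by (rule nn_integral_half_line) measurable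
  also have "\<dots> = ennreal \<bar>sqrt q\<bar> * (\<integral>\<^sup>+r. ?g (0 + sqrt q * r) \<partial>lborel)"
    using q by (intro nn_integral_real_affine) auto
  also have "(\<integral>\<^sup>+r. ?g (0 + sqrt q * r) \<partial>lborel) =
      (\<integral>\<^sup>+r. ennreal (sqrt q ^ n) * (ennreal (r ^ n * exp (- (q * r\<^sup>2))) * indicator {0..} r) \<partial>lborel)"
  proof (rule nn_integral_cong)
    fix r :: real
    show "?g (0 + sqrt q * r) = ennreal (sqrt q ^ n) * (ennreal (r ^ n * exp (- (q * r\<^sup>2))) * indicator {0..} r)"
    proof (cases "0 \<le> r")
      case True
      then show ?thesis using q
        by (simp add: power_mult_distrib ennreal_mult[symmetric] mult.assoc indicator_def)
    next
      case False
      then show ?thesis using q by (simp add: indicator_def zero_le_mult_iff)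
    qed
  qed
  also have "\<dots> = ennreal (sqrt q ^ n) * (\<integral>\<^sup>+r. ennreal (r ^ n * exp (- (q * r\<^sup>2))) * indicator {0..} r \<partial>lborel)"
    by (rule nn_integral_cmult) measurable
  also have "(\<integral>\<^sup>+r. ennreal (r ^ n * exp (- (q * r\<^sup>2))) * indicator {0..} r \<partial>lborel) =
      (\<integral>\<^sup>+r. ennreal (r ^ n * exp (- (q * r\<^sup>2))) \<partial>half_line)"
    by (rule nn_integral_half_line[symmetric]) measurable
  finally have e: "ennreal (radial_moment n) = ennreal (sqrt q ^ Suc n) *
      (\<integral>\<^sup>+r. ennreal (r ^ n * exp (- (q * r\<^sup>2))) \<partial>half_line)" (is "_ = _ * ?X")
    using q by (simp add: ennreal_mult mult.assoc)
  have s: "0 < sqrt q ^ Suc n" using q by simp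
  have "ennreal (radial_moment n / sqrt q ^ Suc n) = ennreal (1 / sqrt q ^ Suc n) * ennreal (radial_moment n)"
    using s radial_moment_pos[of n] by (subst ennreal_mult[symmetric]) auto
  also have "\<dots> = (ennreal (1 / sqrt q ^ Suc n) * ennreal (sqrt q ^ Suc n)) * ?X"
    unfolding e by (simp add: mult.assoc)
  also have "ennreal (1 / sqrt q ^ Suc n) * ennreal (sqrt q ^ Suc n) = 1"
    using s by (subst ennreal_mult[symmetric]) auto
  finally show ?thesis by simp
qed

section \<open>The volume density of a radially projected affine simplex\<close>

lemma radial_proj_line_derivative:
  assumes q: "bform \<kappa> w w \<noteq> 0"
  shows "((\<lambda>y. radial_proj \<kappa> (w + (y - y0) *\<^sub>R e)) has_vector_derivative
    (1 / sqrt \<bar>bform \<kappa> w w\<bar>) *\<^sub>R (e - (bform \<kappa> w e / bform \<kappa> w w) *\<^sub>R w)) (at y0)"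
proof -
  let ?q = "bform \<kappa> w w"
  let ?b = "bform \<kappa> w e"
  have form: "bform \<kappa> (w + (y - y0) *\<^sub>R e) (w + (y - y0) *\<^sub>R e) =
      ?q + 2 * (y - y0) * ?b + (y - y0)\<^sup>2 * bform \<kappa> e e" for y
    by (simp add: bform_simps bform_commute[of \<kappa> e w] power2_eq_square algebra_simps)
  have "((\<lambda>y. ?q + 2 * (y - y0) * ?b + (y - y0)\<^sup>2 * bform \<kappa> e e) has_real_derivative 2 * ?b) (at y0)"
    by (auto intro!: derivative_eq_intros)
  moreover have "((\<lambda>x. 1 / sqrt \<bar>x\<bar>) has_real_derivative - (1 / (2 * sqrt \<bar>?q\<bar> * ?q))) (at (?q + 2 * (y0 - y0) * ?b + (y0 - y0)\<^sup>2 * bform \<kappa> e e))"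
  proof -
    have sq: "sqrt \<bar>?q\<bar> * sqrt \<bar>?q\<bar> = \<bar>?q\<bar>" "\<bar>?q\<bar> = sgn ?q * ?q" "sqrt \<bar>?q\<bar> \<noteq> 0" "sgn ?q * sgn ?q = 1"
      using q by (simp_all add: sgn_if)
    have "((\<lambda>x. 1 / sqrt \<bar>x\<bar>) has_real_derivative
        - (inverse (sqrt \<bar>?q\<bar>) / 2 * sgn ?q) / (sqrt \<bar>?q\<bar> * sqrt \<bar>?q\<bar>)) (at ?q)"
      using q by (auto intro!: derivative_eq_intros has_real_derivative_abs)
    moreover have "- (inverse (sqrt \<bar>?q\<bar>) / 2 * sgn ?q) / (sqrt \<bar>?q\<bar> * sqrt \<bar>?q\<bar>) = - (1 / (2 * sqrt \<bar>?q\<bar> * ?q))"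
    proof -
      have "sgn ?q / \<bar>?q\<bar> = 1 / ?q" using q by (simp add: sgn_if)
      moreover have "- (inverse (sqrt \<bar>?q\<bar>) / 2 * sgn ?q) / \<bar>?q\<bar> = - (sgn ?q / \<bar>?q\<bar> * (1 / (2 * sqrt \<bar>?q\<bar>)))"
      proof -
        have "- (inverse s / 2 * a) / b = - (a / b * (1 / (2 * s)))" for a b s :: real
          by (cases "s = 0"; cases "b = 0") (simp_all add: field_simps)
        then show ?thesis .
      qed
      ultimately show ?thesis unfolding sq(1) by (simp only:) simp
    qed
    ultimately show ?thesis by simp
  qed
  ultimately have "((\<lambda>y. 1 / sqrt \<bar>?q + 2 * (y - y0) * ?b + (y - y0)\<^sup>2 * bform \<kappa> e e\<bar>) has_real_derivative
      - (1 / (2 * sqrt \<bar>?q\<bar> * ?q)) * (2 * ?b)) (at y0)"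
    by (rule DERIV_chain2[rotated])
  then have "((\<lambda>y. (1 / sqrt \<bar>?q + 2 * (y - y0) * ?b + (y - y0)\<^sup>2 * bform \<kappa> e e\<bar>) *\<^sub>R (w + (y - y0) *\<^sub>R e))
      has_vector_derivative ((1 / sqrt \<bar>?q + 2 * (y0 - y0) * ?b + (y0 - y0)\<^sup>2 * bform \<kappa> e e\<bar>) *\<^sub>R e +
        (- (1 / (2 * sqrt \<bar>?q\<bar> * ?q)) * (2 * ?b)) *\<^sub>R (w + (y0 - y0) *\<^sub>R e))) (at y0)"
    by (rule has_vector_derivative_scaleR) (auto intro!: derivative_eq_intros)
  \<comment> \<open>Collecting terms leaves the part of \<open>e\<close> orthogonal to
    \<open>w\<close>, scaled by the length of \<open>w\<close>: the derivative is tangent to the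
    model space.\<close>
  moreover have "(1 / sqrt \<bar>?q + 2 * (y0 - y0) * ?b + (y0 - y0)\<^sup>2 * bform \<kappa> e e\<bar>) *\<^sub>R e +
        (- (1 / (2 * sqrt \<bar>?q\<bar> * ?q)) * (2 * ?b)) *\<^sub>R (w + (y0 - y0) *\<^sub>R e) =
      (1 / sqrt \<bar>?q\<bar>) *\<^sub>R (e - (?b / ?q) *\<^sub>R w)"
    by (simp add: scaleR_diff_right)
  ultimately show ?thesis unfolding radial_proj_def form by simp
qed

lemma subdet_scale: "subdet J (\<lambda>p q. a * X p q) = a ^ card J * subdet J X"
proof -
  let ?D = "\<lambda>p q :: 'a. if p = q then a else 0 :: real"
  have "subdet J (\<lambda>p q. a * X p q) = subdet J (\<lambda>p q. \<Sum>k\<in>J. ?D p k * X k q)"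
    by (rule subdet_cong) (simp add: if_distrib[of "\<lambda>x. x * _"] cong: if_cong)
  also have "\<dots> = subdet J ?D * subdet J X" by (rule subdet_mult)
  also have "subdet J ?D = (\<Prod>i\<in>UNIV. complete_mat J ?D $ i $ i)"
    unfolding subdet_det by (rule det_diagonal) (simp add: complete_mat_def)
  also have "\<dots> = (\<Prod>i\<in>J. a)"
    by (rule prod.mono_neutral_cong_right) (auto simp: complete_mat_def)
  finally show ?thesis by simp
qed

context model_simplex
begin

lemma cone_point_quad_form_pos:
  assumes m: "m \<in> I" and t: "t \<in> std_simplex (I - {m})"
  shows "0 < quad_form M I (cone_point m (I - {m}) t)"
proof -
  let ?J = "I - {m}"
  have nn: "0 \<le> cone_point m ?J t i" if "i \<in> I" for i
    using t that by (auto simp: cone_point_def std_simplex_def)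
  have "\<exists>i\<in>I. cone_point m ?J t i \<noteq> 0"
  proof (rule ccontr)
    assume "\<not> ?thesis"
    then have z: "\<And>i. i \<in> I \<Longrightarrow> cone_point m ?J t i = 0" by blast
    have "t j = 0" if "j \<in> ?J" for j
      using z[of j] that by (auto simp: cone_point_def split: if_splits)
    then show False using z[OF m] by (simp add: cone_point_def)
  qed
  then show ?thesis using cone_form_pos nn by blast
qed

text \<open>The tangent vectors are the \<open>v p\<close>, the parts of the edge vectors
  \<open>e p\<close> orthogonal to the point \<open>w\<close>, divided by the length of
  \<open>w\<close>. Shears relate \<open>w\<close> and the \<open>v p\<close> to the vertices, so
  the Gram determinant of the \<open>v p\<close> is that of the vertices divided by
  \<open>q\<close>; the scaling supplies the other \<open>card J\<close> powers of
  \<open>q\<close>.\<close>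

lemma volume_integrand:
  fixes m :: 'v and t :: "'v \<Rightarrow> real"
  assumes m: "m \<in> I"
  defines "J \<equiv> I - {m}"
  defines "\<phi> \<equiv> \<lambda>t. radial_proj \<kappa> ((1 - (\<Sum>j\<in>J. t j)) *\<^sub>R B m + (\<Sum>j\<in>J. t j *\<^sub>R B j))"
  assumes t: "t \<in> std_simplex J"
  shows "sqrt (subdet J (\<lambda>p q. bform \<kappa> (vector_derivative (\<lambda>s. \<phi> (t(p := s))) (at (t p)))
      (vector_derivative (\<lambda>s. \<phi> (t(q := s))) (at (t q))))) =
    gram_norm \<kappa> I B / sqrt (quad_form M I (cone_point m J t)) ^ card I"
proof -
  have I: "I = insert m J" "m \<notin> J" using m by (auto simp: J_def)
  define w where "w = (1 - (\<Sum>j\<in>J. t j)) *\<^sub>R B m + (\<Sum>j\<in>J. t j *\<^sub>R B j)"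
  define e where "e p = B p - B m" for p
  define q where "q = bform \<kappa> w w"
  define v where "v p = e p - (bform \<kappa> w (e p) / q) *\<^sub>R w" for p
  have w_sum: "w = (\<Sum>i\<in>I. cone_point m J t i *\<^sub>R B i)"
  proof -
    have "(\<Sum>j\<in>J. cone_point m J t j *\<^sub>R B j) = (\<Sum>j\<in>J. t j *\<^sub>R B j)"
      using I(2) by (intro sum.cong) (auto simp: cone_point_def)
    then show ?thesis using I by (simp add: w_def cone_point_def)
  qed
  have w_e: "w = B m + (\<Sum>j\<in>J. t j *\<^sub>R e j)"
    by (simp add: w_def e_def scaleR_diff_right sum_subtractf scaleR_left.sum[symmetric] algebra_simps)
  have Q: "quad_form M I (cone_point m J t) = \<kappa> * q"
    by (simp only: quad_form_M q_def w_sum)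
  have "0 < quad_form M I (cone_point m J t)"
    using cone_point_quad_form_pos[OF m, of t] t by (simp add: J_def)
  then have q_pos: "0 < \<kappa> * q" by (simp add: Q)
  then have q0: "q \<noteq> 0" by auto
  have q_abs: "\<bar>q\<bar> = \<kappa> * q" using q_pos curv by auto
  have D: "vector_derivative (\<lambda>s. \<phi> (t(p := s))) (at (t p)) = (1 / sqrt \<bar>q\<bar>) *\<^sub>R v p" if p: "p \<in> J" for p
  proof -
    have "(1 - (\<Sum>j\<in>J. (t(p := s)) j)) *\<^sub>R B m + (\<Sum>j\<in>J. (t(p := s)) j *\<^sub>R B j) = w + (s - t p) *\<^sub>R e p" for s
    proof -
      have a: "(\<Sum>j\<in>J. (t(p := s)) j) = (\<Sum>j\<in>J. t j) + (s - t p)"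
        using p by (simp add: sum.remove[of J p])
      have b: "(\<Sum>j\<in>J. (t(p := s)) j *\<^sub>R B j) = (\<Sum>j\<in>J. t j *\<^sub>R B j) + (s - t p) *\<^sub>R B p"
        using p by (simp add: sum.remove[of J p] scaleR_diff_left)
      show ?thesis unfolding a b w_def e_def by (simp add: algebra_simps)
    qed
    then have "(\<lambda>s. \<phi> (t(p := s))) = (\<lambda>s. radial_proj \<kappa> (w + (s - t p) *\<^sub>R e p))"
      by (simp only: \<phi>_def)
    moreover have "((\<lambda>s. radial_proj \<kappa> (w + (s - t p) *\<^sub>R e p)) has_vector_derivative (1 / sqrt \<bar>q\<bar>) *\<^sub>R v p) (at (t p))"
      unfolding v_def q_def by (rule radial_proj_line_derivative) (use q0 q_def in simp)
    ultimately show ?thesis by (simp only: vector_derivative_at)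
  qed
  let ?V = "\<lambda>p q. bform \<kappa> (v p) (v q)"
  have orth: "bform \<kappa> w (v p) = 0" for p
    using q0 by (simp add: v_def bform_simps q_def[symmetric])
  \<comment> \<open>Positivity allows the absolute value of the full determinant to be split; it
    holds because the \<open>v p\<close> are independent and orthogonal to \<open>w\<close>.\<close>
  have V_pos: "0 < subdet J ?V"
  proof (rule subdet_pos)
    fix c assume c: "\<exists>p\<in>J. c p \<noteq> (0::real)"
    let ?y = "\<Sum>p\<in>J. c p *\<^sub>R v p"
    have y: "?y \<noteq> 0"
    proof
      assume y0: "?y = 0"
      \<comment> \<open>A vanishing combination of the \<open>v p\<close> says that the same
        combination of edges is \<open>l\<close> times \<open>w\<close>. In terms of the vertices
        this is a relation with coefficients \<open>d\<close>, whose sum is \<open>- l\<close>;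
        independence makes them all zero, hence \<open>l = 0\<close> and
        \<open>c = 0\<close>.\<close>
      define l where "l = (\<Sum>p\<in>J. c p * (bform \<kappa> w (e p) / q))"
      define d where "d i = (if i = m then - (\<Sum>p\<in>J. c p) - l * (1 - (\<Sum>j\<in>J. t j)) else c i - l * t i)" for i
      have "?y = (\<Sum>p\<in>J. c p *\<^sub>R e p) - l *\<^sub>R w"
        by (simp add: v_def scaleR_diff_right sum_subtractf l_def scaleR_sum_left)
      also have "\<dots> = (\<Sum>p\<in>J. c p *\<^sub>R B p) - (\<Sum>p\<in>J. c p) *\<^sub>R B m - l *\<^sub>R w"
        by (simp add: e_def scaleR_diff_right sum_subtractf scaleR_sum_left)
      also have "\<dots> = d m *\<^sub>R B m + ((\<Sum>p\<in>J. c p *\<^sub>R B p) - (\<Sum>j\<in>J. (l * t j) *\<^sub>R B j))"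
        by (simp add: w_def d_def scaleR_diff_left scaleR_diff_right scaleR_add_right scaleR_right.sum right_diff_distrib)
      also have "(\<Sum>p\<in>J. c p *\<^sub>R B p) - (\<Sum>j\<in>J. (l * t j) *\<^sub>R B j) = (\<Sum>j\<in>J. d j *\<^sub>R B j)"
        unfolding sum_subtractf[symmetric] using I(2)
        by (intro sum.cong) (auto simp: d_def scaleR_diff_left)
      finally have "(\<Sum>i\<in>I. d i *\<^sub>R B i) = 0" using y0 I by simp
      then have d0: "d i = 0" if "i \<in> I" for i using that by (rule lin_indep)
      have cj: "c j = l * t j" if "j \<in> J" for j
        using d0[of j] that I by (auto simp: d_def split: if_splits)
      have "(\<Sum>p\<in>J. c p) = l * (\<Sum>j\<in>J. t j)" by (simp add: cj sum_distrib_left)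
      then have "l = 0" using d0[OF m] by (simp add: d_def algebra_simps)
      then show False using c cj by auto
    qed
    have "bform \<kappa> w ?y = 0" by (simp add: bform_simps orth)
    then have "0 < bform \<kappa> ?y ?y" using q_pos y by (intro bform_orthogonal_pos[OF curv, of w]) (auto simp: q_def)
    then show "0 < (\<Sum>p\<in>J. \<Sum>q\<in>J. c p * ?V p q * c q)"
      by (simp add: bform_simps sum_distrib_left mult_ac bform_commute)
  qed
  have det: "subdet I G = q * subdet J ?V"
  proof -
    \<comment> \<open>Three shears: vertices to edge vectors at \<open>m\<close>, the base point
      \<open>B m\<close> to \<open>w\<close>, and edges to their parts orthogonal to
      \<open>w\<close>. The last family has a block diagonal Gram matrix.\<close>
    define C1 where "C1 p = (if p = m then B m else e p)" for p
    define C2 where "C2 p = (if p = m then w else e p)" for p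
    define C3 where "C3 p = (if p = m then w else v p)" for p
    have "subdet I (\<lambda>p q. bform \<kappa> (C1 p) (C1 q)) = subdet I G"
      by (rule subdet_gram_add_from_one[OF m, where c = "\<lambda>_. -1"]) (auto simp: C1_def e_def)
    moreover have "subdet I (\<lambda>p q. bform \<kappa> (C2 p) (C2 q)) = subdet I (\<lambda>p q. bform \<kappa> (C1 p) (C1 q))"
    proof (rule subdet_gram_add_to_one[OF m, where c = t])
      have "(\<Sum>s\<in>J. t s *\<^sub>R C1 s) = (\<Sum>s\<in>J. t s *\<^sub>R e s)" using I(2) by (intro sum.cong) (auto simp: C1_def)
      then show "C2 m = C1 m + (\<Sum>s\<in>I - {m}. t s *\<^sub>R C1 s)" by (simp add: C2_def C1_def w_e J_def)
    qed (simp add: C2_def C1_def)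
    moreover have "subdet I (\<lambda>p q. bform \<kappa> (C3 p) (C3 q)) = subdet I (\<lambda>p q. bform \<kappa> (C2 p) (C2 q))"
      by (rule subdet_gram_add_from_one[OF m, where c = "\<lambda>p. - (bform \<kappa> w (e p) / q)"])
        (auto simp: C3_def C2_def v_def)
    moreover have "subdet I (\<lambda>p q. bform \<kappa> (C3 p) (C3 q)) = q * subdet J ?V"
    proof -
      have "subdet I (\<lambda>p q. bform \<kappa> (C3 p) (C3 q)) =
          bform \<kappa> (C3 m) (C3 m) * subdet (I - {m}) (\<lambda>p q. bform \<kappa> (C3 p) (C3 q))"
        by (rule subdet_remove[OF m]) (auto simp: C3_def orth bform_commute[of \<kappa> _ w])
      also have "subdet (I - {m}) (\<lambda>p q. bform \<kappa> (C3 p) (C3 q)) = subdet J ?V"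
        unfolding J_def by (rule subdet_cong) (auto simp: C3_def)
      finally show ?thesis by (simp add: C3_def q_def)
    qed
    ultimately show ?thesis by simp
  qed
  have "subdet J (\<lambda>p q. bform \<kappa> (vector_derivative (\<lambda>s. \<phi> (t(p := s))) (at (t p)))
      (vector_derivative (\<lambda>s. \<phi> (t(q := s))) (at (t q)))) = subdet J (\<lambda>p r. (1 / \<bar>q\<bar>) * ?V p r)"
    by (rule subdet_cong) (simp add: D bform_simps)
  also have "\<dots> = (1 / \<bar>q\<bar>) ^ card J * subdet J ?V" by (rule subdet_scale)
  also have "\<dots> = \<bar>subdet I G\<bar> / \<bar>q\<bar> ^ card I"
  proof -
    have "card I = Suc (card J)" using I by simp
    then show ?thesis using q0 V_pos by (simp add: det abs_mult power_one_over divide_simps)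
  qed
  finally show ?thesis
    unfolding Q q_abs[symmetric] gram_norm_def by (simp add: real_sqrt_divide real_sqrt_power)
qed

end

lemma quad_form_scale: "quad_form M I (\<lambda>i\<in>I. r * t i) = r\<^sup>2 * quad_form M I t"
  by (simp add: quad_form_def sum_distrib_left power2_eq_square mult_ac)

lemma quad_form_measurable_lborel_PiM: "quad_form M I \<in> borel_measurable (lborel_PiM I)"
  unfolding quad_form_def[abs_def]
  by (intro borel_measurable_sum borel_measurable_times borel_measurable_const measurable_lborel_PiM_coordinate)

lemma gram_norm_UNIV:
  "gram_norm \<kappa> UNIV B = sqrt \<bar>det (\<chi> i j. bform \<kappa> (B i) (B j))\<bar>"
  by (simp add: gram_norm_def subdet_def)

text \<open>Serves twice: to collect the two Gram entries of an edge, and to collect the two orders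
  in which a pair of vertices can be removed.\<close>

lemma sum_off_diagonal:
  fixes f :: "'v::{finite,linorder} \<Rightarrow> 'v \<Rightarrow> real"
  assumes "\<And>i. f i i = 0"
  shows "(\<Sum>i\<in>UNIV. \<Sum>j\<in>UNIV. f i j) = (\<Sum>(i, j)\<in>{(i, j). i < j}. f i j + f j i)"
proof -
  have "(\<Sum>i\<in>UNIV. \<Sum>j\<in>UNIV. f i j) = (\<Sum>(i, j)\<in>UNIV \<times> UNIV. f i j)"
    by (rule sum.cartesian_product)
  also have "\<dots> = (\<Sum>(i, j)\<in>{(i, j). i < j} \<union> {(i, j). j < i}. f i j)"
    by (rule sum.mono_neutral_right) (auto simp: assms not_less intro: antisym)
  also have "\<dots> = (\<Sum>(i, j)\<in>{(i, j). i < j}. f i j) + (\<Sum>(i, j)\<in>{(i, j). j < i}. f i j)"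
    by (rule sum.union_disjoint) auto
  also have "(\<Sum>(i, j)\<in>{(i, j). j < i}. f i j) = (\<Sum>(i, j)\<in>{(i, j). i < j}. f j i)"
    by (rule sum.reindex_bij_witness[where i = prod.swap and j = prod.swap]) auto
  finally show ?thesis by (simp add: sum.distrib case_prod_unfold)
qed

context model_simplex
begin

text \<open>Both sides reduce to the integral of \<open>1 / sqrt Q ^ card I\<close> over the
  standard simplex: the volume through its density, the Gaussian by integration along each ray of
  the cone. A single vertex is included, as the faces of codimension 2 of a triangle
  require.\<close>

lemma simplex_volume_gauss:
  assumes ne: "I \<noteq> {}"
  shows "simplex_volume \<kappa> I B * radial_moment (card I - 1) = gram_norm \<kappa> I B * gauss M I (\<lambda>_. 1)"
proof -
  define m where "m = Min I"
  define J where "J = I - {m}"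
  have m: "m \<in> I" using ne by (simp add: m_def)
  have cI: "card I = Suc (card J)" using card.remove[OF finite m] by (simp add: J_def)
  have mJ: "m \<notin> J" "I = insert m J" using m by (auto simp: J_def)
  let ?Q = "\<lambda>x. quad_form M I (cone_point m J x)"
  define h where "h x = indicator (std_simplex J) x * (1 / sqrt (?Q x) ^ card I)" for x
  have Q_pos: "0 < ?Q x" if "x \<in> std_simplex J" for x
    using cone_point_quad_form_pos[OF m] that by (simp add: J_def)
  have Q_meas: "?Q \<in> borel_measurable (lborel_PiM J)"
  proof -
    have cp: "(\<lambda>x. \<lambda>i\<in>I. cone_point m J x i) \<in> lborel_PiM J \<rightarrow>\<^sub>M lborel_PiM I"
    proof (rule measurable_restrict)
      fix i assume "i \<in> I"
      then show "(\<lambda>x. cone_point m J x i) \<in> lborel_PiM J \<rightarrow>\<^sub>M lborel"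
        using borel_measurable_diff[OF borel_measurable_const measurable_sum_coordinates, of 1 J] mJ
        by (cases "i = m") (auto simp: cone_point_def measurable_lborel_PiM_coordinate)
    qed
    have "?Q x = quad_form M I (\<lambda>i\<in>I. cone_point m J x i)" for x
      by (rule quad_form_cong) simp
    then show ?thesis
      using measurable_compose[OF cp quad_form_measurable_lborel_PiM] by simp
  qed
  have h_meas: "h \<in> borel_measurable (lborel_PiM J)"
    unfolding h_def[abs_def]
    by (intro borel_measurable_times std_simplex_measurable borel_measurable_divide borel_measurable_power
        borel_measurable_const measurable_compose[OF Q_meas borel_measurable_sqrt]) simp
  have h_nonneg: "0 \<le> h x" for x
    using Q_pos[of x] by (cases "x \<in> std_simplex J") (auto simp: h_def)
  have vol: "simplex_volume \<kappa> I B = gram_norm \<kappa> I B * (LINT x|lborel_PiM J. h x)"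
  proof -
    have "simplex_volume \<kappa> I B = (LINT x|lborel_PiM J. gram_norm \<kappa> I B * h x)"
      unfolding simplex_volume_def param_volume_def Let_def m_def[symmetric] J_def[symmetric]
        std_simplex_def[symmetric] set_lebesgue_integral_def
    proof (rule Bochner_Integration.integral_cong[OF refl])
      fix x assume "x \<in> space (lborel_PiM J)"
      show "indicat_real (std_simplex J) x *\<^sub>R sqrt (subdet J (\<lambda>p q. bform \<kappa>
        (vector_derivative (\<lambda>s. radial_proj \<kappa> ((1 - sum (x(p := s)) J) *\<^sub>R B m + (\<Sum>j\<in>J. (x(p := s)) j *\<^sub>R B j))) (at (x p)))
        (vector_derivative (\<lambda>s. radial_proj \<kappa> ((1 - sum (x(q := s)) J) *\<^sub>R B m + (\<Sum>j\<in>J. (x(q := s)) j *\<^sub>R B j))) (at (x q))))) =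
        gram_norm \<kappa> I B * h x"
        using volume_integrand[OF m, of x, folded J_def]
        by (cases "x \<in> std_simplex J") (simp_all add: h_def del: fun_upd_apply)
    qed
    then show ?thesis by simp
  qed
  obtain c where c: "0 < c" "coercive_on c I M" using coercive by blast
  \<comment> \<open>The computation runs with nonnegative extended integrals, where Fubini asks only
    for measurability, and returns to real numbers at the end.\<close>
  have "ennreal (gauss M I (\<lambda>_. 1)) = (\<integral>\<^sup>+x. ennreal (exp (- quad_form M I x)) \<partial>orthant I)"
    using integrable_gauss_one[OF finite c] unfolding gauss_def
    by (subst nn_integral_eq_integral) auto
  also have "\<dots> = (\<integral>\<^sup>+x. indicator (std_simplex J) x * (\<integral>\<^sup>+r. ennreal (r ^ card J) *
      ennreal (exp (- quad_form M I (\<lambda>i\<in>I. r * cone_point m J x i))) \<partial>half_line) \<partial>lborel_PiM J)"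
    unfolding J_def
  proof (rule nn_integral_orthant_cone[OF finite m])
    have "(\<lambda>y. ennreal (exp (- y))) \<in> borel_measurable borel" by measurable
    from measurable_compose[OF quad_form_measurable_lborel_PiM this]
    show "(\<lambda>x. ennreal (exp (- quad_form M I x))) \<in> borel_measurable (lborel_PiM I)" .
  qed
  also have "\<dots> = (\<integral>\<^sup>+x. ennreal (radial_moment (card J)) * ennreal (h x) \<partial>lborel_PiM J)"
  proof (rule nn_integral_cong)
    fix x
    have "(\<integral>\<^sup>+r. ennreal (r ^ card J) * ennreal (exp (- quad_form M I (\<lambda>i\<in>I. r * cone_point m J x i))) \<partial>half_line) =
        ennreal (radial_moment (card J)) * ennreal (1 / sqrt (?Q x) ^ card I)" if "x \<in> std_simplex J"
    proof -
      have "(\<integral>\<^sup>+r. ennreal (r ^ card J) * ennreal (exp (- quad_form M I (\<lambda>i\<in>I. r * cone_point m J x i))) \<partial>half_line) =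
         (\<integral>\<^sup>+r. ennreal (r ^ card J * exp (- (?Q x * r\<^sup>2))) \<partial>half_line)"
        by (rule nn_integral_cong) (simp add: quad_form_scale ennreal_mult mult.commute)
      also have "\<dots> = ennreal (radial_moment (card J) / sqrt (?Q x) ^ Suc (card J))"
        by (rule nn_integral_radial[OF Q_pos[OF that]])
      also have "\<dots> = ennreal (radial_moment (card J)) * ennreal (1 / sqrt (?Q x) ^ card I)"
        using Q_pos[OF that] radial_moment_pos[of "card J"] by (simp add: cI ennreal_mult[symmetric])
      finally show ?thesis .
    qed
    then show "indicator (std_simplex J) x * (\<integral>\<^sup>+r. ennreal (r ^ card J) *
      ennreal (exp (- quad_form M I (\<lambda>i\<in>I. r * cone_point m J x i))) \<partial>half_line) =
      ennreal (radial_moment (card J)) * ennreal (h x)"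
      by (cases "x \<in> std_simplex J") (simp_all add: h_def)
  qed
  also have "\<dots> = ennreal (radial_moment (card J)) * (\<integral>\<^sup>+x. ennreal (h x) \<partial>lborel_PiM J)"
    using h_meas by (intro nn_integral_cmult) simp
  finally have e: "ennreal (gauss M I (\<lambda>_. 1)) =
      ennreal (radial_moment (card J)) * (\<integral>\<^sup>+x. ennreal (h x) \<partial>lborel_PiM J)" .
  have g0: "0 \<le> gauss M I (\<lambda>_. 1)" unfolding gauss_def by (rule integral_nonneg_AE) auto
  have "(LINT x|lborel_PiM J. h x) = enn2real (\<integral>\<^sup>+x. ennreal (h x) \<partial>lborel_PiM J)"
    using h_nonneg by (intro integral_eq_nn_integral h_meas) auto
  moreover have "gauss M I (\<lambda>_. 1) = radial_moment (card J) * enn2real (\<integral>\<^sup>+x. ennreal (h x) \<partial>lborel_PiM J)"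
    using arg_cong[OF e, of enn2real] g0 radial_moment_pos[of "card J"] by (simp add: enn2real_mult)
  ultimately show ?thesis by (simp add: vol cI)
qed

section \<open>Moments in terms of faces of codimension 2\<close>

lemma card_ge_3_minus_two:
  assumes "3 \<le> card I"
  shows "I - {p} \<noteq> {}" and "I - {p} - {q} \<noteq> {}"
proof -
  show "I - {p} - {q} \<noteq> {}"
  proof
    assume "I - {p} - {q} = {}"
    then have "I \<subseteq> {p, q}" by auto
    from card_mono[OF _ this] have "card I \<le> card {p, q}" by simp
    also have "\<dots> \<le> 2" by (simp add: card_insert_if)
    finally show False using assms by simp
  qed
  then show "I - {p} \<noteq> {}" by auto
qed

text \<open>The moment formula is applied to the facet, with its own inverse \<open>E.N\<close>.
  Cramer's rule enters twice: \<open>N p p\<close> times the full determinant is that of the facet,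
  and an entry of \<open>E.N\<close> times the latter is \<open>R\<close> times a determinant of
  codimension 2. One \<kappa> remains from inverting \<open>M\<close>.\<close>

lemma facet_first_moment:
  assumes p: "p \<in> I" and j: "j \<in> I - {p}" and card: "3 \<le> card I"
  shows "N p p * subdet I G * gauss M (I - {p}) (\<lambda>t. t j) = 1 / 2 * \<kappa> *
    (\<Sum>q\<in>I - {p}. Rcoef \<kappa> B (I - {p}) q j * subdet (I - {p, q}) G * gauss M (I - {p, q}) (\<lambda>_. 1))"
proof -
  interpret E: model_simplex \<kappa> "I - {p}" B by (rule face) auto
  note ne = card_ge_3_minus_two(1)[OF card] and ne2 = card_ge_3_minus_two(2)[OF card]
  have pq: "I - {p} - {q} = I - {p, q}" for q by auto
  obtain c where c: "0 < c" "coercive_on c (I - {p}) M" using E.coercive by blast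
  have "gauss M (I - {p}) (\<lambda>t. t j) =
     1 / 2 * (\<Sum>q\<in>I - {p}. (\<kappa> * E.N j q) * gauss M (I - {p} - {q}) (\<lambda>_. 1))"
    by (rule gauss_first_moment[where N = "\<lambda>i l. \<kappa> * E.N i l", OF _ j c M_sym]) (use E.M_inverse[OF j] in auto)
  then have "N p p * subdet I G * gauss M (I - {p}) (\<lambda>t. t j) =
     subdet (I - {p}) G * (1 / 2 * (\<Sum>q\<in>I - {p}. (\<kappa> * E.N j q) * gauss M (I - {p, q}) (\<lambda>_. 1)))"
    by (simp add: subdet_facet[OF p ne] pq)
  also have "\<dots> = 1 / 2 * \<kappa> * (\<Sum>q\<in>I - {p}. (E.N j q * subdet (I - {p}) G) * gauss M (I - {p, q}) (\<lambda>_. 1))"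
    by (simp add: sum_distrib_left mult_ac)
  also have "(\<Sum>q\<in>I - {p}. (E.N j q * subdet (I - {p}) G) * gauss M (I - {p, q}) (\<lambda>_. 1)) =
     (\<Sum>q\<in>I - {p}. Rcoef \<kappa> B (I - {p}) q j * subdet (I - {p, q}) G * gauss M (I - {p, q}) (\<lambda>_. 1))"
  proof (rule sum.cong[OF refl])
    fix q assume q: "q \<in> I - {p}"
    have "E.N j q = Rcoef \<kappa> B (I - {p}) q j * E.N q q"
      using E.Rcoef_eq[OF q ne2 j] E.N_diag_pos[OF q ne2] E.N_sym[OF j q] by simp
    then show "(E.N j q * subdet (I - {p}) G) * gauss M (I - {p, q}) (\<lambda>_. 1) =
       Rcoef \<kappa> B (I - {p}) q j * subdet (I - {p, q}) G * gauss M (I - {p, q}) (\<lambda>_. 1)"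
      using E.subdet_facet[OF q ne2] by (simp add: pq mult.assoc)
  qed
  finally show ?thesis .
qed

text \<open>The two determinants differ by two diagonal entries of inverse Gram matrices, both
  positive. This removes the absolute values in \<open>gram_norm\<close> without splitting into the
  two geometries.\<close>

lemma subdet_codim2_sign:
  assumes p: "p \<in> I" and q: "q \<in> I - {p}" and card: "3 \<le> card I"
  shows "\<bar>subdet (I - {p, q}) G\<bar> = sgn (subdet I G) * subdet (I - {p, q}) G"
proof -
  interpret E: model_simplex \<kappa> "I - {p}" B by (rule face) auto
  note ne = card_ge_3_minus_two(1)[OF card] and ne2 = card_ge_3_minus_two(2)[OF card]
  have "I - {p} - {q} = I - {p, q}" by auto
  then have "subdet (I - {p, q}) G = (E.N q q * N p p) * subdet I G"
    using E.subdet_facet[OF q ne2] subdet_facet[OF p ne] by (simp add: mult.assoc)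
  moreover have "0 < E.N q q * N p p" using E.N_diag_pos[OF q ne2] N_diag_pos[OF p ne] by simp
  moreover have "\<bar>a * d\<bar> = sgn d * (a * d)" if "0 < a" for a d :: real
    using that by (cases d "0 :: real" rule: linorder_cases) (simp_all add: abs_mult)
  ultimately show ?thesis by simp
qed

text \<open>The partial derivative of the volume in the Gram entry (i, j), with (i, j) and (j, i)
  counted as independent. The two terms come from the root of the determinant and from the Gaussian
  integral.\<close>

definition edge_coeff :: "'v \<Rightarrow> 'v \<Rightarrow> real" where
  "edge_coeff i j = gram_norm \<kappa> I B * (N i j / 2 * gauss M I (\<lambda>_. 1) - \<kappa> * gauss M I (\<lambda>t. t i * t j)) /
     radial_moment (card I - 1)"

text \<open>Multiplication by \<open>gram_norm\<close> provides its square, that is, sign times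
  determinant, to which Cramer's rule applies. The factor \<open>card I - 2\<close>, which is k - 1,
  comes from the quotient of the two radial constants.\<close>

lemma edge_coeff_eq:
  assumes i: "i \<in> I" and j: "j \<in> I" and card: "3 \<le> card I"
  shows "2 * (real (card I) - 2) * gram_norm \<kappa> I B * edge_coeff i j =
    - \<kappa> * (\<Sum>p\<in>I. \<Sum>q\<in>I - {p}. Rcoef \<kappa> B I p i * Rcoef \<kappa> B (I - {p}) q j *
      gram_norm \<kappa> (I - {p, q}) B * simplex_volume \<kappa> (I - {p, q}) B)"
proof -
  let ?n = "card I"
  let ?J = "\<lambda>K. gauss M K (\<lambda>_. 1)"
  let ?r = "radial_moment (?n - 1)" and ?r2 = "radial_moment (?n - 3)"
  have r: "?r = (real ?n - 2) / 2 * ?r2"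
  proof -
    have "?n - 1 = (?n - 3) + 2" using card by simp
    then have "?r = (real (?n - 3) + 1) / 2 * ?r2" by (simp only: radial_moment_rec)
    then show ?thesis using card by (simp add: of_nat_diff)
  qed
  note ne = card_ge_3_minus_two(1)[OF card]
  obtain c where c: "0 < c" "coercive_on c I M" using coercive by blast
  have g: "gauss M I (\<lambda>t. t i * t j) = 1 / 2 * (\<kappa> * N i j) * ?J I +
    1 / 2 * (\<Sum>p\<in>I - {j}. (\<kappa> * N i p) * gauss M (I - {p}) (\<lambda>t. t j))"
    by (rule gauss_second_moment[where N = "\<lambda>i l. \<kappa> * N i l", OF _ i j c M_sym]) (use M_inverse[OF i] in auto)
  have s2: "(gram_norm \<kappa> I B)\<^sup>2 = sgn (subdet I G) * subdet I G"
    using abs_sgn[of "subdet I G"] by (simp add: gram_norm_def mult.commute)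
  have k2: "\<kappa> * (x * \<kappa>) = x" for x using curv by auto
  have "gram_norm \<kappa> I B * edge_coeff i j * ?r = (gram_norm \<kappa> I B)\<^sup>2 * (N i j / 2 * ?J I - \<kappa> * gauss M I (\<lambda>t. t i * t j))"
    using radial_moment_pos[of "?n - 1"] by (simp add: edge_coeff_def power2_eq_square)
  \<comment> \<open>Since \<kappa> squares to 1, the first term of the second moment is exactly the
    determinant's contribution.\<close>
  also have "N i j / 2 * ?J I - \<kappa> * gauss M I (\<lambda>t. t i * t j) =
     - 1 / 2 * (\<Sum>p\<in>I - {j}. N i p * gauss M (I - {p}) (\<lambda>t. t j))"
    unfolding g by (simp add: sum_distrib_left distrib_left mult.assoc k2 sum_divide_distrib sum_negf)
  also have "(gram_norm \<kappa> I B)\<^sup>2 * (- 1 / 2 * (\<Sum>p\<in>I - {j}. N i p * gauss M (I - {p}) (\<lambda>t. t j))) =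
    - 1 / 2 * sgn (subdet I G) * (\<Sum>p\<in>I - {j}. Rcoef \<kappa> B I p i * (N p p * subdet I G * gauss M (I - {p}) (\<lambda>t. t j)))"
  proof -
    \<comment> \<open>\<open>R\<close> for the vertex \<open>p\<close> is normalised by
      \<open>N p p\<close>, so the entry is first reflected by the symmetry of
      \<open>N\<close>.\<close>
    have "N i p = Rcoef \<kappa> B I p i * N p p" if "p \<in> I" for p
      using Rcoef_eq[OF that ne i] N_diag_pos[OF that ne] N_sym[OF i that] by simp
    then have "(\<Sum>p\<in>I - {j}. Rcoef \<kappa> B I p i * (N p p * subdet I G * gauss M (I - {p}) (\<lambda>t. t j))) =
       (\<Sum>p\<in>I - {j}. subdet I G * (N i p * gauss M (I - {p}) (\<lambda>t. t j)))"
      by (intro sum.cong) (auto simp: mult_ac)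
    then show ?thesis unfolding s2 by (simp add: sum_distrib_left[symmetric])
  qed
  also have "(\<Sum>p\<in>I - {j}. Rcoef \<kappa> B I p i * (N p p * subdet I G * gauss M (I - {p}) (\<lambda>t. t j))) =
    (\<Sum>p\<in>I - {j}. Rcoef \<kappa> B I p i * (1 / 2 * \<kappa> *
    (\<Sum>q\<in>I - {p}. Rcoef \<kappa> B (I - {p}) q j * subdet (I - {p, q}) G * ?J (I - {p, q}))))"
  proof (rule sum.cong[OF refl])
    fix p assume "p \<in> I - {j}"
    then have "N p p * subdet I G * gauss M (I - {p}) (\<lambda>t. t j) = 1 / 2 * \<kappa> *
      (\<Sum>q\<in>I - {p}. Rcoef \<kappa> B (I - {p}) q j * subdet (I - {p, q}) G * ?J (I - {p, q}))"
      using j by (intro facet_first_moment card) auto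
    then show "Rcoef \<kappa> B I p i * (N p p * subdet I G * gauss M (I - {p}) (\<lambda>t. t j)) =
      Rcoef \<kappa> B I p i * (1 / 2 * \<kappa> *
        (\<Sum>q\<in>I - {p}. Rcoef \<kappa> B (I - {p}) q j * subdet (I - {p, q}) G * ?J (I - {p, q})))"
      by (simp only:)
  qed
  \<comment> \<open>The missing index \<open>p = j\<close> is restored by the convention that
    \<open>R\<close> of the facet without \<open>j\<close> vanishes at \<open>j\<close>.\<close>
  also have "\<dots> = (\<Sum>p\<in>I. Rcoef \<kappa> B I p i * (1 / 2 * \<kappa> *
    (\<Sum>q\<in>I - {p}. Rcoef \<kappa> B (I - {p}) q j * subdet (I - {p, q}) G * ?J (I - {p, q}))))"
  proof (rule sum.mono_neutral_left)
    have "Rcoef \<kappa> B (I - {j}) q j = 0" if "q \<in> I - {j}" for q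
      using that by (auto simp: Rcoef_def)
    then have z: "(\<Sum>q\<in>I - {j}. Rcoef \<kappa> B (I - {j}) q j * subdet (I - {j, q}) G * ?J (I - {j, q})) = 0"
      by (intro sum.neutral) simp
    show "\<forall>p\<in>I - (I - {j}). Rcoef \<kappa> B I p i * (1 / 2 * \<kappa> *
      (\<Sum>q\<in>I - {p}. Rcoef \<kappa> B (I - {p}) q j * subdet (I - {p, q}) G * ?J (I - {p, q}))) = 0"
      using z by auto
  qed auto
  also have "- 1 / 2 * sgn (subdet I G) * \<dots> = - 1 / 4 * \<kappa> * (\<Sum>p\<in>I. \<Sum>q\<in>I - {p}.
    Rcoef \<kappa> B I p i * Rcoef \<kappa> B (I - {p}) q j * (sgn (subdet I G) * subdet (I - {p, q}) G) * ?J (I - {p, q}))"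
    by (simp add: sum_distrib_left mult_ac)
  also have "(\<Sum>p\<in>I. \<Sum>q\<in>I - {p}.
    Rcoef \<kappa> B I p i * Rcoef \<kappa> B (I - {p}) q j * (sgn (subdet I G) * subdet (I - {p, q}) G) * ?J (I - {p, q})) =
    (\<Sum>p\<in>I. \<Sum>q\<in>I - {p}. ?r2 * (Rcoef \<kappa> B I p i * Rcoef \<kappa> B (I - {p}) q j *
      gram_norm \<kappa> (I - {p, q}) B * simplex_volume \<kappa> (I - {p, q}) B))"
  proof (intro sum.cong refl)
    fix p q assume p: "p \<in> I" and q: "q \<in> I - {p}"
    interpret F: model_simplex \<kappa> "I - {p, q}" B by (rule face) auto
    have "card (I - {p, q}) = ?n - 2" using p q by (subst card_Diff_subset) auto
    then have cF: "card (I - {p, q}) - 1 = ?n - 3" and nz: "card (I - {p, q}) \<noteq> 0" using card by simp_all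
    from nz have cF2: "I - {p, q} \<noteq> {}" by (metis card.empty)
    have "(sgn (subdet I G) * subdet (I - {p, q}) G) * ?J (I - {p, q}) =
        (gram_norm \<kappa> (I - {p, q}) B)\<^sup>2 * ?J (I - {p, q})"
      using subdet_codim2_sign[OF p q card] by (simp add: gram_norm_def)
    \<comment> \<open>One of the two factors \<open>gram_norm\<close> turns the Gaussian integral
      into the volume of the face; the other stays in the formula.\<close>
    also have "\<dots> = gram_norm \<kappa> (I - {p, q}) B * (simplex_volume \<kappa> (I - {p, q}) B * ?r2)"
      using F.simplex_volume_gauss[OF cF2, unfolded cF] by (simp add: power2_eq_square mult.assoc)
    finally show "Rcoef \<kappa> B I p i * Rcoef \<kappa> B (I - {p}) q j * (sgn (subdet I G) * subdet (I - {p, q}) G) * ?J (I - {p, q}) =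
      ?r2 * (Rcoef \<kappa> B I p i * Rcoef \<kappa> B (I - {p}) q j *
      gram_norm \<kappa> (I - {p, q}) B * simplex_volume \<kappa> (I - {p, q}) B)" by (simp add: mult_ac)
  qed
  also have "\<dots> = ?r2 * (\<Sum>p\<in>I. \<Sum>q\<in>I - {p}. Rcoef \<kappa> B I p i * Rcoef \<kappa> B (I - {p}) q j *
      gram_norm \<kappa> (I - {p, q}) B * simplex_volume \<kappa> (I - {p, q}) B)" (is "_ = ?r2 * ?S")
    by (simp add: sum_distrib_left)
  finally have "gram_norm \<kappa> I B * edge_coeff i j * ((real ?n - 2) / 2 * ?r2) = - 1 / 4 * \<kappa> * (?r2 * ?S)"
    by (simp only: r)
  then have eq: "(2 * (real ?n - 2) * gram_norm \<kappa> I B * edge_coeff i j) * ?r2 = (- \<kappa> * ?S) * ?r2"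
    by (simp add: field_simps)
  have "?r2 \<noteq> 0" using radial_moment_pos[of "?n - 3"] by simp
  then show ?thesis using eq by (rule mult_right_cancel[THEN iffD1])
qed

text \<open>The two summands of \<open>Rcoef2\<close> are the two orders of removing a pair of
  vertices; both orders lead to the same face.\<close>

lemma sum_ordered_pairs_Rcoef2:
  fixes V :: "'v set \<Rightarrow> real"
  shows "(\<Sum>p\<in>UNIV. \<Sum>q\<in>UNIV - {p}. Rcoef \<kappa> B UNIV p i * Rcoef \<kappa> B (UNIV - {p}) q j * V (UNIV - {p, q})) =
    (\<Sum>(p, q)\<in>{(p, q). p < q}. Rcoef2 \<kappa> B UNIV p q i j * V (UNIV - {p, q}))"
proof -
  let ?f = "\<lambda>p q. if p = q then 0 else
    Rcoef \<kappa> B UNIV p i * Rcoef \<kappa> B (UNIV - {p}) q j * V (UNIV - {p, q})"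
  have "(\<Sum>p\<in>UNIV. \<Sum>q\<in>UNIV - {p}. Rcoef \<kappa> B UNIV p i * Rcoef \<kappa> B (UNIV - {p}) q j * V (UNIV - {p, q})) =
      (\<Sum>p\<in>UNIV. \<Sum>q\<in>UNIV. ?f p q)"
    by (intro sum.cong refl sum.mono_neutral_cong_left) auto
  also have "\<dots> = (\<Sum>(p, q)\<in>{(p, q). p < q}. ?f p q + ?f q p)" by (rule sum_off_diagonal) simp
  also have "\<dots> = (\<Sum>(p, q)\<in>{(p, q). p < q}. Rcoef2 \<kappa> B UNIV p q i j * V (UNIV - {p, q}))"
    by (rule sum.cong) (auto simp: Rcoef2_def distrib_right insert_commute)
  finally show ?thesis .
qed

end

section \<open>Volume as a function of the Gram matrix\<close>

lemma has_derivative_vec_lambda: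
  fixes f :: "'n::finite \<Rightarrow> 'b::real_normed_vector \<Rightarrow> 'c::euclidean_space"
  assumes "\<And>i. (f i has_derivative f' i) (at x)"
  shows "((\<lambda>x. \<chi> i. f i x) has_derivative (\<lambda>h. \<chi> i. f' i h)) (at x)"
proof -
  have ax: "(\<chi> i. g i) = (\<Sum>i\<in>UNIV. axis i (g i))" for g :: "'n \<Rightarrow> 'c"
    by (simp add: vec_eq_iff axis_def)
  have bl: "bounded_linear (axis i :: 'c \<Rightarrow> 'c^'n)" for i
    unfolding linear_conv_bounded_linear[symmetric]
    by (rule linearI) (simp_all add: axis_def vec_eq_iff)
  have "((\<lambda>x. axis i (f i x) :: 'c^'n) has_derivative (\<lambda>h. axis i (f' i h))) (at x)" for i
    by (rule bounded_linear.has_derivative[OF bl assms])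
  then show ?thesis unfolding ax by (rule has_derivative_sum)
qed

text \<open>Defined on all matrices, whether or not they come from a simplex, so that a Frechet
  derivative on the full matrix space makes sense.\<close>

definition volume_of_gram :: "real \<Rightarrow> real^'v^'v \<Rightarrow> real" where
  "volume_of_gram \<kappa> X = sqrt \<bar>det X\<bar> * gauss (\<lambda>i j. \<kappa> * X $ i $ j) UNIV (\<lambda>_. 1) /
     radial_moment (CARD('v) - 1)"

definition gram_mat :: "real \<Rightarrow> ('v \<Rightarrow> real \<times> 'a::euclidean_space) \<Rightarrow> real^'v^'v" where
  "gram_mat \<kappa> B = (\<chi> i j. bform \<kappa> (B i) (B j))"

lemma gram_mat_nth [simp]: "gram_mat \<kappa> B $ i $ j = bform \<kappa> (B i) (B j)"
  by (simp add: gram_mat_def)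

lemma simplex_volume_eq_volume_of_gram:
  fixes B :: "'v::{finite,linorder} \<Rightarrow> real \<times> 'a::euclidean_space"
  assumes "\<kappa> = 1 \<or> \<kappa> = -1" "nondeg_simplex \<kappa> UNIV B"
  shows "simplex_volume \<kappa> UNIV B = volume_of_gram \<kappa> (gram_mat \<kappa> B)"
proof -
  interpret model_simplex \<kappa> UNIV B using assms by (simp add: model_simplex_def)
  have "M = (\<lambda>i j. \<kappa> * gram_mat \<kappa> B $ i $ j)" by (simp add: M_def fun_eq_iff)
  then show ?thesis
    using simplex_volume_gauss radial_moment_pos[of "CARD('v) - 1"]
    by (simp add: volume_of_gram_def gram_norm_UNIV gram_mat_def[symmetric] field_simps)
qed

locale full_model_simplex = model_simplex \<kappa> UNIV B
  for \<kappa> :: real and B :: "'v::{finite,linorder} \<Rightarrow> real \<times> 'a::euclidean_space"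
begin

lemma volume_of_gram_has_derivative:
  "(volume_of_gram \<kappa> has_derivative (\<lambda>H. \<Sum>i\<in>UNIV. \<Sum>j\<in>UNIV. edge_coeff i j * H $ i $ j)) (at (gram_mat \<kappa> B))"
proof -
  let ?X = "gram_mat \<kappa> B"
  let ?r = "radial_moment (CARD('v) - 1)"
  let ?J = "gauss M UNIV (\<lambda>_. 1)"
  let ?g = "\<lambda>i j. gauss M UNIV (\<lambda>t. t i * t j)"
  let ?s = "gram_norm \<kappa> UNIV B"
  obtain c where c: "0 < c" "coercive_on c UNIV M" using coercive by blast
  have M_mat: "(\<lambda>i j. (\<kappa> *\<^sub>R ?X) $ i $ j) = M" by (simp add: M_def fun_eq_iff)
  have s: "sqrt \<bar>det ?X\<bar> = ?s" by (simp add: gram_norm_UNIV gram_mat_def)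
  have "(\<chi> i j. N i j) ** ?X = mat 1"
    using N_inverse by (simp add: matrix_matrix_mult_def mat_def vec_eq_iff)
  from has_derivative_sqrt_abs_det[OF this]
  have d1: "((\<lambda>X. sqrt \<bar>det X\<bar>) has_derivative
      (\<lambda>H. ?s / 2 * (\<Sum>i\<in>UNIV. \<Sum>j\<in>UNIV. N j i * H $ i $ j))) (at ?X)" by (simp add: s)
  have "((\<lambda>X. gauss (\<lambda>i j. (\<kappa> *\<^sub>R X) $ i $ j) UNIV (\<lambda>_. 1)) has_derivative
      (\<lambda>H. - (\<Sum>i\<in>UNIV. \<Sum>j\<in>UNIV. (\<kappa> *\<^sub>R H) $ i $ j * ?g i j))) (at ?X)"
    using has_derivative_compose[OF has_derivative_scaleR_right[OF has_derivative_ident]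
        gauss_has_derivative[OF c(1), of "\<kappa> *\<^sub>R ?X"]] c(2) unfolding M_mat by simp
  then have d2: "((\<lambda>X. gauss (\<lambda>i j. \<kappa> * X $ i $ j) UNIV (\<lambda>_. 1)) has_derivative
      (\<lambda>H. - (\<Sum>i\<in>UNIV. \<Sum>j\<in>UNIV. \<kappa> * H $ i $ j * ?g i j))) (at ?X)" by simp
  have M_mat': "(\<lambda>i j. \<kappa> * ?X $ i $ j) = M" by (simp add: M_def fun_eq_iff)
  have "(volume_of_gram \<kappa> has_derivative (\<lambda>H. (?s * - (\<Sum>i\<in>UNIV. \<Sum>j\<in>UNIV. \<kappa> * H $ i $ j * ?g i j) +
      ?s / 2 * (\<Sum>i\<in>UNIV. \<Sum>j\<in>UNIV. N j i * H $ i $ j) * ?J) * (1 / ?r))) (at ?X)"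
  proof -
    have "volume_of_gram \<kappa> = (\<lambda>X :: ((real, 'v) vec, 'v) vec. sqrt \<bar>det X\<bar> * gauss (\<lambda>i j. \<kappa> * X $ i $ j) UNIV (\<lambda>_. 1) * (1 / ?r))"
      by (simp add: volume_of_gram_def fun_eq_iff)
    then show ?thesis
      using has_derivative_mult_left[OF has_derivative_mult[OF d1 d2], of "1 / ?r"]
      unfolding M_mat' s by (simp only:)
  qed
  moreover have "(?s * - (\<Sum>i\<in>UNIV. \<Sum>j\<in>UNIV. \<kappa> * H $ i $ j * ?g i j) +
      ?s / 2 * (\<Sum>i\<in>UNIV. \<Sum>j\<in>UNIV. N j i * H $ i $ j) * ?J) * (1 / ?r) =
      (\<Sum>i\<in>UNIV. \<Sum>j\<in>UNIV. edge_coeff i j * H $ i $ j)" for H :: "((real, 'v) vec, 'v) vec"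
  proof -
    have "edge_coeff i j * H $ i $ j =
       (?s * - (\<kappa> * H $ i $ j * ?g i j) + ?s / 2 * (N j i * H $ i $ j) * ?J) * (1 / ?r)" for i j
    proof -
      have n: "N j i = N i j" by (rule N_sym) auto
      show ?thesis unfolding edge_coeff_def n divide_inverse by (simp add: algebra_simps)
    qed
    then show ?thesis
      by (simp add: sum.distrib sum_distrib_left sum_distrib_right sum_negf mult.assoc
          sum_divide_distrib diff_divide_distrib sum_subtractf)
  qed
  ultimately show ?thesis by simp
qed

lemma edge_coeff_sym: "edge_coeff i j = edge_coeff j i"
proof -
  have n: "N j i = N i j" by (rule N_sym) auto
  show ?thesis unfolding edge_coeff_def n by (simp add: mult.commute)
qed

text \<open>If the entry were 1 or -1, then \<open>B j\<close> minus \<kappa> times that entry times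
  \<open>B i\<close> would be orthogonal to both vertices, hence zero. So distances stay strictly
  inside the range where they can be recovered from Gram entries.\<close>

lemma gram_entry_strict:
  assumes "i \<noteq> j"
  shows "(G i j)\<^sup>2 \<noteq> 1"
proof
  assume s: "(G i j)\<^sup>2 = 1"
  interpret E: model_simplex \<kappa> "{i, j}" B by (rule face) simp
  let ?c = "\<lambda>l. if l = i then - (\<kappa> * G i j) else 1"
  let ?z = "\<Sum>l\<in>{i, j}. ?c l *\<^sub>R B l"
  have "?z = 0"
  proof (rule E.span_nondegenerate[OF _ sum_in_span_image])
    fix l assume "l \<in> {i, j}"
    then show "bform \<kappa> ?z (B l) = 0"
      using assms s form_self[of i] form_self[of j]
      by (auto simp: bform_simps bform_commute[of \<kappa> "B j" "B i"] power2_eq_square mult_ac)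
  qed simp
  from E.lin_indep[OF this, of j] show False using assms by simp
qed

text \<open>A Gram matrix \<open>A\<close> close to that of \<open>B\<close> is realised by
  \<open>B j + (\<Sum>k. S k j *\<^sub>R dual k)\<close> for a symmetric \<open>S\<close> with \<open>2 S + S N S = A - G\<close>, which
  Brouwer's theorem provides.\<close>
lemma gram_realization:
  "eventually (\<lambda>A. (\<forall>i j. A $ i $ j = A $ j $ i) \<longrightarrow> (\<forall>i. A $ i $ i = \<kappa>) \<longrightarrow>
    (\<exists>B' :: 'v \<Rightarrow> real \<times> 'a. nondeg_simplex \<kappa> UNIV B' \<and> gram_mat \<kappa> B' = A)) (nhds (gram_mat \<kappa> B))"
proof -
  define C where "C = (\<Sum>k\<in>UNIV. \<Sum>l\<in>UNIV. \<bar>N k l\<bar>)"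
  define D where "D = (\<Sum>k\<in>UNIV. \<bar>fst (dual k)\<bar>)"
  define f where "f = Min (range (\<lambda>j. if \<kappa> = -1 then fst (B j) else 1))"
  have CD: "0 \<le> C" "0 \<le> D" by (auto simp: C_def D_def intro!: sum_nonneg)
  have f_pos: "0 < f"
    using in_model by (auto simp: f_def model_space_def)
  have f_le: "f \<le> fst (B j)" if "\<kappa> = -1" for j
  proof -
    have "f \<le> (if \<kappa> = -1 then fst (B j) else 1)" unfolding f_def by (rule Min_le) auto
    then show ?thesis using that by simp
  qed
  \<comment> \<open>The first bound keeps the quadratic term of the equation for \<open>S\<close>
    below \<epsilon>; the second keeps the coordinate \<open>x0\<close> of the moved points
    positive. Here \<open>f\<close> is the least such coordinate, with the dummy value 1 on the
    sphere.\<close>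
  define \<epsilon> where "\<epsilon> = min (1 / (1 + C)) (f / (2 * (1 + D)))"
  have \<epsilon>: "0 < \<epsilon>" using CD f_pos by (simp add: \<epsilon>_def)
  have \<epsilon>C: "\<epsilon> * C \<le> 1"
  proof -
    have "\<epsilon> * C \<le> (1 / (1 + C)) * (1 + C)" using CD by (intro mult_mono) (auto simp: \<epsilon>_def)
    then show ?thesis using CD by simp
  qed
  have \<epsilon>D: "\<epsilon> * D < f"
  proof -
    have "\<epsilon> * D \<le> (f / (2 * (1 + D))) * (1 + D)" using CD f_pos by (intro mult_mono) (auto simp: \<epsilon>_def)
    also have "\<dots> = f / 2" using CD by (simp add: field_simps)
    finally show ?thesis using f_pos by simp
  qed
  have close: "eventually (\<lambda>A. \<forall>i j. \<bar>A $ i $ j - G i j\<bar> \<le> \<epsilon>) (nhds (gram_mat \<kappa> B))"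
  proof -
    have "eventually (\<lambda>A. \<bar>A $ i $ j - G i j\<bar> < \<epsilon>) (nhds (gram_mat \<kappa> B))" for i j
    proof (rule order_tendstoD(2)[OF _ \<epsilon>])
      have "((\<lambda>A. \<bar>A $ i $ j - G i j\<bar>) \<longlongrightarrow> \<bar>gram_mat \<kappa> B $ i $ j - G i j\<bar>) (nhds (gram_mat \<kappa> B))"
        by (intro tendsto_intros filterlim_ident)
      then show "((\<lambda>A. \<bar>A $ i $ j - G i j\<bar>) \<longlongrightarrow> 0) (nhds (gram_mat \<kappa> B))" by simp
    qed
    then have "eventually (\<lambda>A. \<forall>i j. \<bar>A $ i $ j - G i j\<bar> < \<epsilon>) (nhds (gram_mat \<kappa> B))"
      by (intro eventually_all_finite)
    then show ?thesis by eventually_elim (auto intro: less_imp_le)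
  qed
  have det_nz: "eventually (\<lambda>A. det A \<noteq> 0) (nhds (gram_mat \<kappa> B))"
  proof -
    have "det (gram_mat \<kappa> B) \<noteq> 0"
      using gram_det_nonzero by (simp add: subdet_def gram_mat_def)
    moreover have "continuous_on UNIV (det :: ((real, 'v) vec, 'v) vec \<Rightarrow> real)"
      unfolding det_def[abs_def] by (intro continuous_intros)
    then have "(det \<longlongrightarrow> det (gram_mat \<kappa> B)) (nhds (gram_mat \<kappa> B))"
      by (simp add: continuous_on_eq_continuous_at isCont_def tendsto_at_iff_tendsto_nhds)
    ultimately show ?thesis by (intro tendsto_imp_eventually_ne)
  qed
  from close det_nz show ?thesis
  proof eventually_elim
    case (elim A)
    show ?case
    proof (intro impI)
      assume sym: "\<forall>i j. A $ i $ j = A $ j $ i" and diag: "\<forall>i. A $ i $ i = \<kappa>"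
      define K where "K = {S :: ((real, 'v) vec, 'v) vec. (\<forall>i j. \<bar>S $ i $ j\<bar> \<le> \<epsilon>) \<and> (\<forall>i j. S $ i $ j = S $ j $ i)}"
      \<comment> \<open>Fixed points of \<open>T\<close> solve the equation for \<open>S\<close>.
        The box \<open>K\<close> is mapped to itself: the difference of Gram matrices and the
        quadratic term contribute at most \<epsilon> each, and their sum is halved.\<close>
      define T where "T S = (\<chi> i j. ((A $ i $ j - G i j) -
        (\<Sum>k\<in>UNIV. \<Sum>l\<in>UNIV. S $ k $ i * N k l * S $ l $ j)) / 2)" for S :: "((real, 'v) vec, 'v) vec"
      have "bounded K"
        unfolding bounded_iff
      proof (intro exI ballI)
        fix S assume S: "S \<in> K"
        have "norm S \<le> (\<Sum>i\<in>UNIV. norm (S $ i))" unfolding norm_vec_def by (rule L2_set_le_sum) simp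
        also have "\<dots> \<le> (\<Sum>i\<in>(UNIV :: 'v set). \<Sum>j\<in>(UNIV :: 'v set). \<epsilon>)"
        proof (rule sum_mono)
          fix i
          have "norm (S $ i) \<le> (\<Sum>j\<in>UNIV. \<bar>S $ i $ j\<bar>)" by (rule norm_le_l1_cart)
          also have "\<dots> \<le> (\<Sum>j\<in>(UNIV :: 'v set). \<epsilon>)" using S by (intro sum_mono) (simp add: K_def)
          finally show "norm (S $ i) \<le> (\<Sum>j\<in>(UNIV :: 'v set). \<epsilon>)" .
        qed
        finally show "norm S \<le> (\<Sum>i\<in>(UNIV :: 'v set). \<Sum>j\<in>(UNIV :: 'v set). \<epsilon>)" .
      qed
      moreover have "closed K"
        unfolding K_def by (intro closed_Collect_conj closed_Collect_all closed_Collect_le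
            closed_Collect_eq continuous_intros)
      ultimately have "compact K" by (simp add: compact_eq_bounded_closed)
      moreover have "convex K"
      proof (rule convexI)
        fix S S' u v assume S: "S \<in> K" "S' \<in> K" and uv: "0 \<le> u" "0 \<le> v" "u + v = (1::real)"
        have "\<bar>u * S $ i $ j + v * S' $ i $ j\<bar> \<le> \<epsilon>" for i j
        proof -
          have "\<bar>u * S $ i $ j + v * S' $ i $ j\<bar> \<le> u * \<bar>S $ i $ j\<bar> + v * \<bar>S' $ i $ j\<bar>"
            using uv by (metis abs_mult abs_of_nonneg abs_triangle_ineq)
          also have "\<dots> \<le> u * \<epsilon> + v * \<epsilon>" using S uv by (intro add_mono mult_left_mono) (auto simp: K_def)
          finally show ?thesis using uv by (simp add: distrib_right[symmetric])
        qed
        then show "u *\<^sub>R S + v *\<^sub>R S' \<in> K" using S by (auto simp: K_def)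
      qed
      moreover have "K \<noteq> {}" using \<epsilon> by (auto simp: K_def intro!: exI[of _ 0])
      moreover have "continuous_on K T" unfolding T_def[abs_def] by (intro continuous_intros) simp
      moreover have "T \<in> K \<rightarrow> K"
      proof
        fix S assume S: "S \<in> K"
        then have S_le: "\<And>i j. \<bar>S $ i $ j\<bar> \<le> \<epsilon>" and S_sym: "\<And>i j. S $ i $ j = S $ j $ i" by (auto simp: K_def)
        have "\<bar>T S $ i $ j\<bar> \<le> \<epsilon>" for i j
        proof -
          have "\<bar>\<Sum>k\<in>UNIV. \<Sum>l\<in>UNIV. S $ k $ i * N k l * S $ l $ j\<bar> \<le>
             (\<Sum>k\<in>UNIV. \<Sum>l\<in>UNIV. \<bar>S $ k $ i * N k l * S $ l $ j\<bar>)"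
            by (intro order_trans[OF sum_abs] sum_mono sum_abs)
          also have "\<dots> \<le> (\<Sum>k\<in>UNIV. \<Sum>l\<in>UNIV. \<epsilon> * \<bar>N k l\<bar> * \<epsilon>)"
            unfolding abs_mult using \<epsilon> S_le by (intro sum_mono mult_mono) auto
          also have "\<dots> = (\<epsilon> * C) * \<epsilon>" by (simp add: C_def sum_distrib_left sum_distrib_right mult_ac)
          also have "\<dots> \<le> 1 * \<epsilon>" using \<epsilon>C \<epsilon> by (intro mult_right_mono) auto
          finally have "\<bar>\<Sum>k\<in>UNIV. \<Sum>l\<in>UNIV. S $ k $ i * N k l * S $ l $ j\<bar> \<le> \<epsilon>" by simp
          moreover have "\<bar>A $ i $ j - G i j\<bar> \<le> \<epsilon>" using elim(1) by blast
          ultimately show ?thesis unfolding T_def by simp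
        qed
        moreover have "T S $ i $ j = T S $ j $ i" for i j
        proof -
          have "(\<Sum>k\<in>UNIV. \<Sum>l\<in>UNIV. S $ k $ i * N k l * S $ l $ j) =
              (\<Sum>l\<in>UNIV. \<Sum>k\<in>UNIV. S $ l $ j * N l k * S $ k $ i)"
            by (subst sum.swap) (intro sum.cong refl, simp add: N_sym mult_ac)
          then show ?thesis using sym by (simp add: T_def bform_commute[of \<kappa> "B i" "B j"])
        qed
        ultimately show "T S \<in> K" by (simp add: K_def)
      qed
      ultimately obtain S where S: "S \<in> K" "T S = S" by (rule brouwer)
      then have S_le: "\<And>i j. \<bar>S $ i $ j\<bar> \<le> \<epsilon>" and S_sym: "\<And>i j. S $ i $ j = S $ j $ i" by (auto simp: K_def)
      \<comment> \<open>The displacement stays in the span of the vertices, so the dimension of the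
        ambient space does not enter; paired with \<open>B i\<close> it gives
        \<open>S $ i $ j\<close>.\<close>
      define E where "E j = (\<Sum>k\<in>UNIV. S $ k $ j *\<^sub>R dual k)" for j
      define B' where "B' j = B j + E j" for j
      have BE: "bform \<kappa> (B i) (E j) = S $ i $ j" for i j
      proof -
        have "bform \<kappa> (B i) (E j) = (\<Sum>k\<in>UNIV. if k = i then S $ k $ j else 0)"
          unfolding E_def bform_sum_right bform_scaleR_right
          by (rule sum.cong) (auto simp: dual_pairing bform_commute[of \<kappa> "B i"])
        then show ?thesis by simp
      qed
      have EE: "bform \<kappa> (E i) (E j) = (\<Sum>k\<in>UNIV. \<Sum>l\<in>UNIV. S $ k $ i * N k l * S $ l $ j)" for i j
      proof -
        have "bform \<kappa> (E i) (E j) = (\<Sum>k\<in>UNIV. S $ k $ i * bform \<kappa> (dual k) (E j))"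
          by (simp only: E_def[of i] bform_sum_left bform_scaleR_left)
        also have "\<dots> = (\<Sum>k\<in>UNIV. S $ k $ i * (\<Sum>l\<in>UNIV. S $ l $ j * N k l))"
          by (simp add: E_def bform_sum_right bform_scaleR_right dual_gram N_sym)
        finally show ?thesis by (simp add: sum_distrib_left mult_ac)
      qed
      have gram: "bform \<kappa> (B' i) (B' j) = A $ i $ j" for i j
      proof -
        have "bform \<kappa> (B' i) (B' j) = G i j + S $ i $ j + S $ j $ i + bform \<kappa> (E i) (E j)"
          using BE[of i j] BE[of j i]
          by (simp add: B'_def bform_add_left bform_add_right bform_commute[of \<kappa> "E i" "B j"])
        moreover have "S $ i $ j = T S $ i $ j" by (simp add: S(2))
        then have "2 * S $ i $ j = A $ i $ j - G i j - bform \<kappa> (E i) (E j)"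
          by (simp add: T_def EE)
        ultimately show ?thesis using S_sym[of i j] by simp
      qed
      have "B' j \<in> model_space \<kappa>" for j
      proof -
        have "0 < fst (B' j)" if k: "\<kappa> = -1"
        proof -
          have "\<bar>fst (E j)\<bar> \<le> (\<Sum>k\<in>UNIV. \<bar>S $ k $ j * fst (dual k)\<bar>)"
            unfolding E_def fst_sum by (simp add: sum_abs)
          also have "\<dots> \<le> (\<Sum>k\<in>UNIV. \<epsilon> * \<bar>fst (dual k)\<bar>)"
            unfolding abs_mult using S_le by (intro sum_mono mult_right_mono) auto
          also have "\<dots> = \<epsilon> * D" by (simp add: D_def sum_distrib_left)
          finally show ?thesis using \<epsilon>D f_le[OF k, of j] by (simp add: B'_def)
        qed
        then show ?thesis using gram[of j j] diag by (auto simp: model_space_def)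
      qed
      \<comment> \<open>Independence comes from the determinant: a linear relation among the points
        is a kernel vector of \<open>A\<close>.\<close>
      moreover have "c i = 0" if c: "(\<Sum>i\<in>UNIV. c i *\<^sub>R B' i) = 0" for c i
      proof (rule subdet_kernel_trivial[where I = UNIV and A = "\<lambda>i j. A $ i $ j"])
        show "subdet UNIV (\<lambda>i j. A $ i $ j) \<noteq> 0" using elim(2) by (simp add: subdet_def)
        fix p
        have "(\<Sum>q\<in>UNIV. A $ p $ q * c q) = bform \<kappa> (B' p) (\<Sum>i\<in>UNIV. c i *\<^sub>R B' i)"
          unfolding bform_sum_right bform_scaleR_right gram by (simp add: mult.commute)
        then show "(\<Sum>q\<in>UNIV. A $ p $ q * c q) = 0" by (simp add: c)
      qed simp
      ultimately have "nondeg_simplex \<kappa> UNIV B'" by (auto simp: nondeg_simplex_iff)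
      moreover have "gram_mat \<kappa> B' = A" by (simp add: vec_eq_iff gram)
      ultimately show "\<exists>B' :: 'v \<Rightarrow> real \<times> 'a. nondeg_simplex \<kappa> UNIV B' \<and> gram_mat \<kappa> B' = A" by blast
    qed
  qed
qed

end

section \<open>Edge lengths and dihedral angles\<close>

definition gram_entry :: "real \<Rightarrow> real \<Rightarrow> real" where
  "gram_entry \<kappa> l = (if \<kappa> = 1 then cos l else - cosh l)"

definition gram_entry_deriv :: "real \<Rightarrow> real \<Rightarrow> real" where
  "gram_entry_deriv \<kappa> l = (if \<kappa> = 1 then - sin l else - sinh l)"

lemma gram_entry_has_derivative: "(gram_entry \<kappa> has_real_derivative gram_entry_deriv \<kappa> l) (at l)"
  unfolding gram_entry_def[abs_def] gram_entry_deriv_def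
  by (cases "\<kappa> = 1") (auto intro!: derivative_eq_intros)

text \<open>Taking \<open>min\<close> and \<open>max\<close> reads only the entries above the
  diagonal, in agreement with \<open>as_function_of_lengths\<close>, and forces symmetry.\<close>

definition gram_of_lengths ::
    "real \<Rightarrow> ((real, 'v::{finite,linorder}) vec, 'v) vec \<Rightarrow> ((real, 'v) vec, 'v) vec" where
  "gram_of_lengths \<kappa> L = (\<chi> i j. if i = j then \<kappa> else gram_entry \<kappa> (L $ min i j $ max i j))"

lemma spherical_bform_le:
  assumes "x \<in> model_space 1" "y \<in> model_space 1"
  shows "\<bar>bform 1 x y\<bar> \<le> 1"
  using Cauchy_Schwarz_ineq2[of x y] assms by (simp add: model_space_def bform_one norm_eq_sqrt_inner)

lemma gram_entry_geodist:
  assumes "\<kappa> = 1 \<or> \<kappa> = -1" "x \<in> model_space \<kappa>" "y \<in> model_space \<kappa>"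
  shows "gram_entry \<kappa> (geodist \<kappa> x y) = bform \<kappa> x y"
  using assms hyperbolic_bform_le[of x y] spherical_bform_le[of x y]
  by (auto simp: gram_entry_def geodist_def cos_arccos_abs)

lemma geodist_commute: "geodist \<kappa> x y = geodist \<kappa> y x"
  unfolding geodist_def bform_commute[of \<kappa> x y] ..

lemma gram_mat_eq_gram_of_lengths:
  assumes \<kappa>: "\<kappa> = 1 \<or> \<kappa> = -1" and B: "nondeg_simplex \<kappa> UNIV B"
    and L: "\<And>i j. i < j \<Longrightarrow> edge_lengths \<kappa> B $ i $ j = L $ i $ j"
  shows "gram_mat \<kappa> B = gram_of_lengths \<kappa> L"
proof -
  interpret full_model_simplex \<kappa> B using \<kappa> B by (simp add: full_model_simplex_def model_simplex_def)
  have "bform \<kappa> (B i) (B j) = gram_of_lengths \<kappa> L $ i $ j" for i j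
  proof (cases i j rule: linorder_cases)
    case less
    have "bform \<kappa> (B i) (B j) = gram_entry \<kappa> (geodist \<kappa> (B i) (B j))"
      by (rule gram_entry_geodist[OF curv in_model in_model, symmetric]) simp_all
    then show ?thesis using L[OF less] less less_imp_neq[OF less] by (simp add: gram_of_lengths_def edge_lengths_def)
  next
    case equal
    then show ?thesis using form_self by (simp add: gram_of_lengths_def)
  next
    case greater
    have "bform \<kappa> (B i) (B j) = gram_entry \<kappa> (geodist \<kappa> (B j) (B i))"
      unfolding geodist_commute[of \<kappa> "B j"]
      by (rule gram_entry_geodist[OF curv in_model in_model, symmetric]) simp_all
    then show ?thesis using L[OF greater] greater less_imp_neq[OF greater] by (simp add: gram_of_lengths_def edge_lengths_def)
  qed
  then show ?thesis by (simp add: vec_eq_iff)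
qed

lemma gram_of_lengths_has_derivative:
  "(gram_of_lengths \<kappa> has_derivative (\<lambda>h. \<chi> i j. if i = j then 0 else
     gram_entry_deriv \<kappa> (L $ min i j $ max i j) * h $ min i j $ max i j)) (at L)"
  unfolding gram_of_lengths_def[abs_def]
proof (intro has_derivative_vec_lambda)
  fix i j :: 'a
  have "((\<lambda>L. L $ min i j $ max i j) has_derivative (\<lambda>h. h $ min i j $ max i j)) (at L)"
    by (intro bounded_linear.has_derivative[OF bounded_linear_vec_nth] has_derivative_ident)
  then have "((\<lambda>L. gram_entry \<kappa> (L $ min i j $ max i j)) has_derivative
      (\<lambda>h. gram_entry_deriv \<kappa> (L $ min i j $ max i j) * h $ min i j $ max i j)) (at L)"
    using has_derivative_compose gram_entry_has_derivative unfolding has_field_derivative_def by blast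
  then show "((\<lambda>L. if i = j then \<kappa> else gram_entry \<kappa> (L $ min i j $ max i j)) has_derivative
      (\<lambda>h. if i = j then 0 else gram_entry_deriv \<kappa> (L $ min i j $ max i j) * h $ min i j $ max i j)) (at L)"
    by (cases "i = j") auto
qed

context full_model_simplex
begin

abbreviation "lengths \<equiv> edge_lengths \<kappa> B"

lemma gram_of_lengths_self: "gram_of_lengths \<kappa> lengths = gram_mat \<kappa> B"
  by (rule gram_mat_eq_gram_of_lengths[OF curv nondeg, symmetric]) simp

text \<open>Strictness matters: these conditions are open, so they persist for nearby lengths, where
  the inverse functions then recover each length from its Gram entry.\<close>

lemma geodist_bounds:
  assumes "i \<noteq> j"
  shows "0 < geodist \<kappa> (B i) (B j)" and "\<kappa> = 1 \<Longrightarrow> geodist \<kappa> (B i) (B j) < pi"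
proof -
  have s: "G i j \<noteq> 1" "G i j \<noteq> -1" using gram_entry_strict[OF assms] by auto
  have sph: "-1 < G i j \<and> G i j < 1" if "\<kappa> = 1"
    using s spherical_bform_le[of "B i" "B j"] in_model that by fastforce
  have hyp: "1 < - G i j" if "\<kappa> = -1"
    using s hyperbolic_bform_le[of "B i" "B j"] in_model that by fastforce
  show "0 < geodist \<kappa> (B i) (B j)"
    using curv
  proof
    assume "\<kappa> = 1"
    then show ?thesis using sph arccos_lt_bounded by (simp add: geodist_def)
  next
    assume "\<kappa> = -1"
    then show ?thesis using hyp arcosh_real_strict_mono[of 1 "- G i j"] by (simp add: geodist_def)
  qed
  show "geodist \<kappa> (B i) (B j) < pi" if "\<kappa> = 1"
    using sph[OF that] arccos_lt_bounded that by (simp add: geodist_def)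
qed

text \<open>Continuity carries realisability from Gram matrices over to lengths. The strict bounds
  ensure that the realising simplex has the prescribed lengths and not merely the prescribed cosines
  or hyperbolic cosines.\<close>

lemma length_realization:
  "eventually (\<lambda>L. \<exists>B' :: 'v \<Rightarrow> real \<times> 'a. nondeg_simplex \<kappa> UNIV B' \<and>
    (\<forall>i j. i < j \<longrightarrow> edge_lengths \<kappa> B' $ i $ j = L $ i $ j)) (nhds lengths)"
proof -
  have "isCont (gram_of_lengths \<kappa>) lengths"
    by (rule has_derivative_continuous[OF gram_of_lengths_has_derivative])
  then have "(gram_of_lengths \<kappa> \<longlongrightarrow> gram_of_lengths \<kappa> lengths) (nhds lengths)"
    by (simp only: isCont_def tendsto_at_iff_tendsto_nhds)
  then have "(gram_of_lengths \<kappa> \<longlongrightarrow> gram_mat \<kappa> B) (nhds lengths)"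
    by (simp only: gram_of_lengths_self)
  then have real: "eventually (\<lambda>L. (\<forall>i j. gram_of_lengths \<kappa> L $ i $ j = gram_of_lengths \<kappa> L $ j $ i) \<longrightarrow>
    (\<forall>i. gram_of_lengths \<kappa> L $ i $ i = \<kappa>) \<longrightarrow>
    (\<exists>B' :: 'v \<Rightarrow> real \<times> 'a. nondeg_simplex \<kappa> UNIV B' \<and> gram_mat \<kappa> B' = gram_of_lengths \<kappa> L)) (nhds lengths)"
    by (rule eventually_compose_filterlim[OF gram_realization])
  have entry: "((\<lambda>L. L $ i $ j) \<longlongrightarrow> lengths $ i $ j) (nhds lengths)" for i j
    by (intro tendsto_intros filterlim_ident)
  have "eventually (\<lambda>L. i \<noteq> j \<longrightarrow> 0 < L $ i $ j \<and> (\<kappa> = 1 \<longrightarrow> L $ i $ j < pi)) (nhds lengths)" for i j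
  proof (cases "i = j")
    case False
    have "eventually (\<lambda>L. 0 < L $ i $ j) (nhds lengths)"
      using order_tendstoD(1)[OF entry] geodist_bounds(1)[OF False] by (simp add: edge_lengths_def)
    moreover have "eventually (\<lambda>L. \<kappa> = 1 \<longrightarrow> L $ i $ j < pi) (nhds lengths)"
    proof (cases "\<kappa> = 1")
      case True
      then show ?thesis using order_tendstoD(2)[OF entry, of i j pi] geodist_bounds(2)[OF False]
        by (simp add: edge_lengths_def)
    qed simp
    ultimately show ?thesis by eventually_elim simp
  qed simp
  then have "eventually (\<lambda>L. \<forall>i j. i \<noteq> j \<longrightarrow> 0 < L $ i $ j \<and> (\<kappa> = 1 \<longrightarrow> L $ i $ j < pi)) (nhds lengths)"
    by (intro eventually_all_finite)
  with real show ?thesis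
  proof eventually_elim
    case (elim L)
    have "gram_of_lengths \<kappa> L $ i $ j = gram_of_lengths \<kappa> L $ j $ i" for i j
      by (simp add: gram_of_lengths_def min.commute max.commute)
    moreover have "gram_of_lengths \<kappa> L $ i $ i = \<kappa>" for i by (simp add: gram_of_lengths_def)
    ultimately obtain B' :: "'v \<Rightarrow> real \<times> 'a"
      where B': "nondeg_simplex \<kappa> UNIV B'" "gram_mat \<kappa> B' = gram_of_lengths \<kappa> L" using elim(1) by blast
    have "edge_lengths \<kappa> B' $ i $ j = L $ i $ j" if "i < j" for i j
    proof -
      have "bform \<kappa> (B' i) (B' j) = gram_mat \<kappa> B' $ i $ j" by simp
      also have "\<dots> = gram_entry \<kappa> (L $ i $ j)"
        unfolding B'(2) using that less_imp_neq[OF that] by (simp add: gram_of_lengths_def)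
      finally have e: "bform \<kappa> (B' i) (B' j) = gram_entry \<kappa> (L $ i $ j)" .
      have "0 < L $ i $ j \<and> (\<kappa> = 1 \<longrightarrow> L $ i $ j < pi)"
        using elim(2) less_imp_neq[OF that] by blast
      then show ?thesis
        using e curv by (auto simp: edge_lengths_def geodist_def gram_entry_def arccos_cos arcosh_cosh_real)
    qed
    then show ?case using B'(1) by blast
  qed
qed

text \<open>All simplices with the given lengths share one Gram matrix, so a quantity that factors
  through it has a unique value, as the definite description demands, without any congruence being
  constructed.\<close>

lemma as_function_of_lengths_eq:
  fixes B' :: "'v \<Rightarrow> real \<times> 'a"
  assumes \<Phi>: "\<And>B' :: 'v \<Rightarrow> real \<times> 'a. nondeg_simplex \<kappa> UNIV B' \<Longrightarrow> \<Phi> B' = \<phi> (gram_mat \<kappa> B')"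
    and B': "nondeg_simplex \<kappa> UNIV B'" "\<And>i j. i < j \<Longrightarrow> edge_lengths \<kappa> B' $ i $ j = L $ i $ j"
  shows "as_function_of_lengths \<kappa> \<Phi> L = \<phi> (gram_of_lengths \<kappa> L)"
  unfolding as_function_of_lengths_def
proof (rule the_equality)
  show "\<exists>B. nondeg_simplex \<kappa> UNIV B \<and> (\<forall>i j. i < j \<longrightarrow> edge_lengths \<kappa> B $ i $ j = L $ i $ j) \<and>
      \<phi> (gram_of_lengths \<kappa> L) = \<Phi> B"
    using B' \<Phi>[OF B'(1)] gram_mat_eq_gram_of_lengths[OF curv B'] by (intro exI[of _ B']) simp
  fix y
  assume "\<exists>B. nondeg_simplex \<kappa> UNIV B \<and> (\<forall>i j. i < j \<longrightarrow> edge_lengths \<kappa> B $ i $ j = L $ i $ j) \<and> y = \<Phi> B"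
  then obtain B'' where B'': "nondeg_simplex \<kappa> UNIV B''"
    "\<And>i j. i < j \<Longrightarrow> edge_lengths \<kappa> B'' $ i $ j = L $ i $ j" "y = \<Phi> B''" by blast
  show "y = \<phi> (gram_of_lengths \<kappa> L)"
    using \<Phi>[OF B''(1)] gram_mat_eq_gram_of_lengths[OF curv B''(1,2)] B''(3) by simp
qed

text \<open>Chain rule through the Gram matrix. Realisability of all nearby lengths makes the
  description agree with the composite function on a whole neighbourhood.\<close>

lemma as_function_of_lengths_has_derivative:
  assumes \<Phi>: "\<And>B' :: 'v \<Rightarrow> real \<times> 'a. nondeg_simplex \<kappa> UNIV B' \<Longrightarrow> \<Phi> B' = \<phi> (gram_mat \<kappa> B')"
    and d: "(\<phi> has_derivative D) (at (gram_mat \<kappa> B))"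
  shows "(as_function_of_lengths \<kappa> \<Phi> has_derivative
    (\<lambda>h. D (\<chi> i j. if i = j then 0 else
      gram_entry_deriv \<kappa> (lengths $ min i j $ max i j) * h $ min i j $ max i j))) (at lengths)"
proof (rule has_derivative_transform_eventually)
  show "((\<lambda>L. \<phi> (gram_of_lengths \<kappa> L)) has_derivative (\<lambda>h. D (\<chi> i j. if i = j then 0 else
      gram_entry_deriv \<kappa> (lengths $ min i j $ max i j) * h $ min i j $ max i j))) (at lengths)"
    by (rule has_derivative_compose[OF gram_of_lengths_has_derivative]) (simp add: gram_of_lengths_self d)
  have "eventually (\<lambda>L. \<phi> (gram_of_lengths \<kappa> L) = as_function_of_lengths \<kappa> \<Phi> L) (nhds lengths)"
    using length_realization
  proof eventually_elim
    case (elim L)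
    then obtain B' :: "'v \<Rightarrow> real \<times> 'a" where B': "nondeg_simplex \<kappa> UNIV B'"
      "\<And>i j. i < j \<Longrightarrow> edge_lengths \<kappa> B' $ i $ j = L $ i $ j" by blast
    show ?case using as_function_of_lengths_eq[where \<Phi> = \<Phi> and \<phi> = \<phi>, OF \<Phi> B'] by simp
  qed
  then show "\<forall>\<^sub>F L in at lengths. \<phi> (gram_of_lengths \<kappa> L) = as_function_of_lengths \<kappa> \<Phi> L"
    and "\<phi> (gram_of_lengths \<kappa> lengths) = as_function_of_lengths \<kappa> \<Phi> lengths"
    unfolding eventually_nhds_conv_at by auto
qed simp

text \<open>The coefficients of the orthogonal projection onto the span of the face. They involve
  inner products only, so they carry over to any simplex in which these are the same.\<close>

definition face_coeff :: "'v set \<Rightarrow> real \<times> 'a \<Rightarrow> 'v \<Rightarrow> real" where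
  "face_coeff F x s = (\<Sum>r\<in>F. bform \<kappa> x (B r) * model_simplex.N \<kappa> F B r s)"

lemma face_coeff_orthogonal:
  assumes t: "t \<in> F"
  shows "bform \<kappa> (x - (\<Sum>s\<in>F. face_coeff F x s *\<^sub>R B s)) (B t) = 0"
proof -
  interpret F: model_simplex \<kappa> F B by (rule face) simp
  have "(\<Sum>s\<in>F. face_coeff F x s *\<^sub>R B s) = (\<Sum>s\<in>F. \<Sum>r\<in>F. (bform \<kappa> x (B r) * F.N r s) *\<^sub>R B s)"
    by (simp add: face_coeff_def scaleR_sum_left)
  also have "\<dots> = (\<Sum>r\<in>F. bform \<kappa> x (B r) *\<^sub>R F.dual r)"
    by (subst sum.swap) (simp add: F.dual_def scaleR_right.sum)
  finally have "bform \<kappa> (\<Sum>s\<in>F. face_coeff F x s *\<^sub>R B s) (B t) =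
      (\<Sum>r\<in>F. bform \<kappa> x (B r) * bform \<kappa> (F.dual r) (B t))"
    by (simp add: bform_sum_left bform_scaleR_left)
  also have "\<dots> = (\<Sum>r\<in>F. if r = t then bform \<kappa> x (B r) else 0)"
    by (rule sum.cong) (auto simp: F.dual_pairing[OF _ t])
  also have "\<dots> = bform \<kappa> x (B t)" using t by simp
  finally show ?thesis by (simp add: bform_diff_left)
qed

end

section \<open>The normal plane at the face opposite to an edge\<close>

locale full_model_simplex_edge = full_model_simplex +
  fixes p q :: 'a
  assumes pq: "p \<noteq> q" and card3: "3 \<le> CARD('a)"
begin

definition "F = UNIV - {p, q}"
definition "a = face_coeff F (B p)"
definition "b = face_coeff F (B q)"
definition "u = B p - (\<Sum>s\<in>F. a s *\<^sub>R B s)"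
definition "v = B q - (\<Sum>s\<in>F. b s *\<^sub>R B s)"
text \<open>The inner product of the projections of \<open>B p\<close> and \<open>B q\<close> to the
  span of the face, while \<open>\<rho>\<close> is the product of the lengths of their normal parts.
  The Gram entry at \<open>p\<close>, \<open>q\<close> is thus \<open>c0\<close> plus
  \<open>\<rho>\<close> times the cosine of the dihedral angle.\<close>

definition "c0 = (\<Sum>s\<in>F. a s * G s q)"
definition "\<rho> = sqrt (bform \<kappa> u u) * sqrt (bform \<kappa> v v)"

lemma F_nonempty: "F \<noteq> {}"
  using card_ge_3_minus_two(2)[OF card3, of p q] by (auto simp: F_def)

lemma F_notin: "p \<notin> F" "q \<notin> F" "x \<notin> F \<longleftrightarrow> x = p \<or> x = q"
  by (auto simp: F_def)

lemma u_orth: "s \<in> F \<Longrightarrow> bform \<kappa> u (B s) = 0"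
  unfolding u_def a_def by (rule face_coeff_orthogonal)

lemma v_orth: "s \<in> F \<Longrightarrow> bform \<kappa> v (B s) = 0"
  unfolding v_def b_def by (rule face_coeff_orthogonal)

lemma orth_pos:
  assumes "\<And>s. s \<in> F \<Longrightarrow> bform \<kappa> z (B s) = 0" "z \<noteq> 0"
  shows "0 < bform \<kappa> z z"
proof -
  obtain s where s: "s \<in> F" using F_nonempty by auto
  show ?thesis
  proof (rule bform_orthogonal_pos[OF curv _ _ assms(2)])
    show "0 < \<kappa> * bform \<kappa> (B s) (B s)" using form_self[of s] by simp
    show "bform \<kappa> (B s) z = 0" using assms(1)[OF s] by (simp add: bform_commute[of \<kappa> "B s" z])
  qed
qed

text \<open>Stated for an arbitrary simplex \<open>C\<close> but with the coefficients
  \<open>a\<close>, \<open>b\<close> of \<open>B\<close>, since it is applied also when the edge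
  \<open>p q\<close> has another length. The coefficients at \<open>C p\<close> and
  \<open>C q\<close> are \<open>x\<close> and \<open>y\<close>, so independence decides.\<close>

lemma combination_nonzero:
  fixes C :: "'a \<Rightarrow> real \<times> 'b"
  assumes C: "nondeg_simplex \<kappa> UNIV C" and xy: "x \<noteq> 0 \<or> y \<noteq> 0"
  shows "x *\<^sub>R (C p - (\<Sum>s\<in>F. a s *\<^sub>R C s)) + y *\<^sub>R (C q - (\<Sum>s\<in>F. b s *\<^sub>R C s)) \<noteq> 0" (is "?z \<noteq> 0")
proof
  assume z: "?z = 0"
  let ?c = "\<lambda>l. if l = p then x else if l = q then y else - (x * a l + y * b l)"
  have U: "UNIV = insert p (insert q F)" by (auto simp: F_def)
  have "(\<Sum>l\<in>UNIV. ?c l *\<^sub>R C l) = x *\<^sub>R C p + (y *\<^sub>R C q + (\<Sum>l\<in>F. ?c l *\<^sub>R C l))"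
    unfolding U using pq F_notin by simp
  also have "(\<Sum>l\<in>F. ?c l *\<^sub>R C l) = (\<Sum>l\<in>F. - (x *\<^sub>R (a l *\<^sub>R C l) + y *\<^sub>R (b l *\<^sub>R C l)))"
    using F_notin by (intro sum.cong) (auto simp: scaleR_add_left algebra_simps)
  also have "x *\<^sub>R C p + (y *\<^sub>R C q + \<dots>) = ?z"
    by (simp add: scaleR_diff_right scaleR_right.sum sum_negf sum.distrib sum_subtractf)
  finally have c: "(\<Sum>l\<in>UNIV. ?c l *\<^sub>R C l) = 0" using z by simp
  have "\<forall>c. (\<Sum>i\<in>UNIV. c i *\<^sub>R C i) = 0 \<longrightarrow> (\<forall>i\<in>UNIV. c i = 0)"
    using C unfolding nondeg_simplex_iff by blast
  from this[THEN spec, THEN mp, OF c] have "\<forall>i\<in>UNIV. ?c i = 0" .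
  then have "?c p = 0" "?c q = 0" by (simp_all only: ball_UNIV)
  then show False using xy pq by simp
qed

lemma u_nonzero: "u \<noteq> 0" and v_nonzero: "v \<noteq> 0"
  using combination_nonzero[OF nondeg, of 1 0] combination_nonzero[OF nondeg, of 0 1]
  by (auto simp: u_def v_def)

lemma uu_pos: "0 < bform \<kappa> u u" and vv_pos: "0 < bform \<kappa> v v"
  using orth_pos[OF u_orth u_nonzero] orth_pos[OF v_orth v_nonzero] by auto

lemma \<rho>_pos: "0 < \<rho>"
  using uu_pos vv_pos by (simp add: \<rho>_def)

lemma \<rho>_sq: "\<rho>\<^sup>2 = bform \<kappa> u u * bform \<kappa> v v"
  using uu_pos vv_pos by (simp add: \<rho>_def power_mult_distrib)

text \<open>The Gram-Schmidt coefficient: subtracting \<open>t\<close> times \<open>u\<close> from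
  \<open>v\<close> leaves the part of \<open>v\<close> orthogonal to \<open>u\<close>.\<close>

definition "t = bform \<kappa> u v / bform \<kappa> u u"

lemma normal_form:
  "bform \<kappa> (v - t *\<^sub>R u) (v - t *\<^sub>R u) * bform \<kappa> u u = bform \<kappa> u u * bform \<kappa> v v - (bform \<kappa> u v)\<^sup>2"
  using uu_pos
  by (simp add: t_def bform_diff_left bform_diff_right bform_scaleR_left bform_scaleR_right
      bform_commute[of \<kappa> v u] power2_eq_square field_simps)

text \<open>Strict Cauchy-Schwarz in the normal plane: the part of \<open>v\<close> orthogonal to
  \<open>u\<close> is nonzero and normal to the face, so its square is positive. Hence the dihedral
  angle lies strictly between 0 and pi.\<close>

lemma uv_strict: "(bform \<kappa> u v)\<^sup>2 < \<rho>\<^sup>2"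
proof -
  have "v - t *\<^sub>R u \<noteq> 0" using combination_nonzero[OF nondeg, of "- t" 1] by (simp add: u_def v_def)
  then have "0 < bform \<kappa> (v - t *\<^sub>R u) (v - t *\<^sub>R u)"
    using u_orth v_orth by (intro orth_pos) (simp_all add: bform_diff_left bform_scaleR_left)
  then have "0 < bform \<kappa> (v - t *\<^sub>R u) (v - t *\<^sub>R u) * bform \<kappa> u u" using uu_pos by simp
  then show ?thesis unfolding normal_form \<rho>_sq by simp
qed

lemma uv_eq: "bform \<kappa> u v = G p q - c0"
proof -
  have "bform \<kappa> u (\<Sum>s\<in>F. b s *\<^sub>R B s) = 0" 
    unfolding bform_sum_right bform_scaleR_right using u_orth by simp
  then have "bform \<kappa> u v = bform \<kappa> u (B q)" by (simp add: v_def bform_diff_right)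
  then show ?thesis by (simp add: u_def c0_def bform_diff_left bform_sum_left bform_scaleR_left)
qed

text \<open>Base times squared height twice: over the facet without \<open>q\<close> the height
  vector is the part of \<open>v\<close> orthogonal to \<open>u\<close>, and over the face
  \<open>F\<close> it is \<open>u\<close>. The product of the squared heights is the 2 by 2 Gram
  determinant of \<open>u\<close> and \<open>v\<close>, so the root is \<open>\<rho>\<close> times
  the sine of the angle.\<close>

lemma gram_norm_factor: "gram_norm \<kappa> UNIV B = gram_norm \<kappa> F B * sqrt (\<rho>\<^sup>2 - (bform \<kappa> u v)\<^sup>2)"
proof -
  have "subdet UNIV G = bform \<kappa> (v - t *\<^sub>R u) (v - t *\<^sub>R u) * subdet (UNIV - {q}) G"
  proof (rule subdet_gram_height)
    let ?c = "\<lambda>s. if s = p then - t else t * a s - b s"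
    have "UNIV - {q} = insert p F" using pq by (auto simp: F_def)
    moreover have "(\<Sum>s\<in>F. ?c s *\<^sub>R B s) = t *\<^sub>R (\<Sum>s\<in>F. a s *\<^sub>R B s) - (\<Sum>s\<in>F. b s *\<^sub>R B s)"
      unfolding scaleR_right.sum sum_subtractf[symmetric]
      using F_notin by (intro sum.cong) (auto simp: scaleR_diff_left)
    ultimately show "v - t *\<^sub>R u = B q + (\<Sum>s\<in>UNIV - {q}. ?c s *\<^sub>R B s)"
      using F_notin by (simp add: u_def v_def scaleR_diff_right)
    fix s assume s: "s \<in> UNIV - {q}"
    show "bform \<kappa> (v - t *\<^sub>R u) (B s) = 0"
    proof (cases "s = p")
      case False
      then show ?thesis using s u_orth[of s] v_orth[of s]
        by (simp add: F_def bform_diff_left bform_scaleR_left)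
    next
      case True
      have B: "B p = u + (\<Sum>s\<in>F. a s *\<^sub>R B s)" by (simp add: u_def)
      have z: "bform \<kappa> (v - t *\<^sub>R u) (\<Sum>s\<in>F. a s *\<^sub>R B s) = 0"
        unfolding bform_sum_right bform_scaleR_right
        using u_orth v_orth by (simp add: bform_diff_left bform_scaleR_left)
      have "bform \<kappa> (v - t *\<^sub>R u) u = 0"
        using uu_pos by (simp add: t_def bform_diff_left bform_scaleR_left bform_commute[of \<kappa> v u])
      with z show ?thesis unfolding True by (subst B) (simp add: bform_add_right)
    qed
  qed simp
  also have "subdet (UNIV - {q}) G = bform \<kappa> u u * subdet (UNIV - {q} - {p}) G"
  proof (rule subdet_gram_height)
    have Fqp: "UNIV - {q} - {p} = F" by (auto simp: F_def)
    show "p \<in> UNIV - {q}" using pq by simp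
    show "u = B p + (\<Sum>s\<in>UNIV - {q} - {p}. (- a s) *\<^sub>R B s)" unfolding Fqp by (simp add: u_def sum_negf)
    show "bform \<kappa> u (B s) = 0" if "s \<in> UNIV - {q} - {p}" for s using u_orth that unfolding Fqp .
  qed
  also have "UNIV - {q} - {p} = F" by (auto simp: F_def)
  finally have "subdet UNIV G = (\<rho>\<^sup>2 - (bform \<kappa> u v)\<^sup>2) * subdet F G"
    using normal_form by (simp add: \<rho>_sq mult.assoc[symmetric])
  then show ?thesis using uv_strict by (simp add: gram_norm_def abs_mult real_sqrt_mult)
qed

text \<open>Changing the length of the edge \<open>p q\<close> alone leaves \<open>a\<close>, \<open>b\<close> and the Gram data of
  \<open>u\<close>, \<open>v\<close> unchanged, except for \<open>u \<cdot> v\<close>.\<close>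
lemma dihedral_angle_eq:
  fixes B' :: "'a \<Rightarrow> real \<times> 'b"
  assumes B': "nondeg_simplex \<kappa> UNIV B'"
    and same: "\<And>x y. {x, y} \<noteq> {p, q} \<Longrightarrow> bform \<kappa> (B' x) (B' y) = G x y"
  shows "dihedral_angle \<kappa> UNIV B' p q = arccos ((bform \<kappa> (B' p) (B' q) - c0) / \<rho>)"
    and "(bform \<kappa> (B' p) (B' q) - c0)\<^sup>2 < \<rho>\<^sup>2"
proof -
  interpret B': full_model_simplex \<kappa> B'
    using curv B' by (simp add: full_model_simplex_def model_simplex_def)
  interpret F': model_simplex \<kappa> F B' by (rule B'.face) simp
  define u' where "u' = B' p - (\<Sum>s\<in>F. a s *\<^sub>R B' s)"
  define v' where "v' = B' q - (\<Sum>s\<in>F. b s *\<^sub>R B' s)"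
  have neq: "{x, s} \<noteq> {p, q}" if "s \<in> F" for x s using that F_notin by auto
  have u'_orth: "bform \<kappa> u' (B' s) = 0" if s: "s \<in> F" for s
  proof -
    have "bform \<kappa> u' (B' s) = bform \<kappa> u (B s)"
      using same[OF neq[OF s]] by (simp add: u'_def u_def bform_diff_left bform_sum_left bform_scaleR_left)
    then show ?thesis using u_orth[OF s] by simp
  qed
  have v'_orth: "bform \<kappa> v' (B' s) = 0" if s: "s \<in> F" for s
  proof -
    have "bform \<kappa> v' (B' s) = bform \<kappa> v (B s)"
      using same[OF neq[OF s]] by (simp add: v'_def v_def bform_diff_left bform_sum_left bform_scaleR_left)
    then show ?thesis using v_orth[OF s] by simp
  qed
  have span: "bform \<kappa> w (\<Sum>s\<in>F. c s *\<^sub>R C s) = 0" if "\<And>s. s \<in> F \<Longrightarrow> bform \<kappa> w (C s) = 0" for w c and C :: "'a \<Rightarrow> real \<times> 'b"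
    unfolding bform_sum_right bform_scaleR_right using that by simp
  have pr_p: "orth_proj \<kappa> (B' ` F) (B' p) = (\<Sum>s\<in>F. a s *\<^sub>R B' s)"
    by (rule F'.orth_proj_eq[OF F_nonempty sum_in_span_image]) (use u'_orth in \<open>simp add: u'_def\<close>)
  have pr_q: "orth_proj \<kappa> (B' ` F) (B' q) = (\<Sum>s\<in>F. b s *\<^sub>R B' s)"
    by (rule F'.orth_proj_eq[OF F_nonempty sum_in_span_image]) (use v'_orth in \<open>simp add: v'_def\<close>)
  have pp: "{p, p} \<noteq> {p, q}" "{q, q} \<noteq> {p, q}" using pq by auto
  have sym: "bform \<kappa> (B' s) (B' x) = G s x" if "s \<in> F" for s x
    using same[OF neq[OF that, of x]] by (simp add: bform_commute[of \<kappa> "B' s"] bform_commute[of \<kappa> "B s"])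
  have uu: "bform \<kappa> u' u' = bform \<kappa> u u"
  proof -
    have "bform \<kappa> u' u' = bform \<kappa> u' (B' p)"
      using span[where C = B', OF u'_orth, of a] by (subst (2) u'_def) (simp add: bform_diff_right)
    also have "\<dots> = bform \<kappa> u (B p)"
      using same[OF pp(1)] sym by (simp add: u'_def u_def bform_diff_left bform_sum_left bform_scaleR_left)
    also have "\<dots> = bform \<kappa> u u"
      using span[where C = B, OF u_orth, of a] by (subst (3) u_def) (simp add: bform_diff_right)
    finally show ?thesis .
  qed
  have vv: "bform \<kappa> v' v' = bform \<kappa> v v"
  proof -
    have "bform \<kappa> v' v' = bform \<kappa> v' (B' q)"
      using span[where C = B', OF v'_orth, of b] by (subst (2) v'_def) (simp add: bform_diff_right)
    also have "\<dots> = bform \<kappa> v (B q)"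
      using same[OF pp(2)] sym by (simp add: v'_def v_def bform_diff_left bform_sum_left bform_scaleR_left)
    also have "\<dots> = bform \<kappa> v v"
      using span[where C = B, OF v_orth, of b] by (subst (3) v_def) (simp add: bform_diff_right)
    finally show ?thesis .
  qed
  \<comment> \<open>The only pairing of the normal parts that sees the Gram entry at
    \<open>p\<close>, \<open>q\<close>.\<close>
  have uv: "bform \<kappa> u' v' = bform \<kappa> (B' p) (B' q) - c0"
  proof -
    have "bform \<kappa> u' v' = bform \<kappa> u' (B' q)"
      using span[where C = B', OF u'_orth, of b] by (simp add: v'_def bform_diff_right)
    also have "\<dots> = bform \<kappa> (B' p) (B' q) - c0"
      using sym by (simp add: u'_def c0_def bform_diff_left bform_sum_left bform_scaleR_left)
    finally show ?thesis .
  qed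
  show "dihedral_angle \<kappa> UNIV B' p q = arccos ((bform \<kappa> (B' p) (B' q) - c0) / \<rho>)"
    unfolding dihedral_angle_def Let_def F_def[symmetric] pr_p pr_q u'_def[symmetric] v'_def[symmetric] uu vv uv \<rho>_def ..
  have "v' - (bform \<kappa> u' v' / bform \<kappa> u u) *\<^sub>R u' \<noteq> 0"
    using combination_nonzero[OF B', of "- (bform \<kappa> u' v' / bform \<kappa> u u)" 1]
    unfolding u'_def[symmetric] v'_def[symmetric] by simp
  moreover obtain s where s: "s \<in> F" using F_nonempty by auto
  let ?z = "v' - (bform \<kappa> u' v' / bform \<kappa> u u) *\<^sub>R u'"
  have "bform \<kappa> (B' s) ?z = 0"
    using u'_orth[OF s] v'_orth[OF s]
    by (simp add: bform_diff_right bform_scaleR_right bform_commute[of \<kappa> "B' s"])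
  ultimately have "0 < bform \<kappa> ?z ?z"
    using B'.form_self[of s] by (intro bform_orthogonal_pos[OF curv, of "B' s"]) simp_all
  then have "0 < bform \<kappa> ?z ?z * bform \<kappa> u u" using uu_pos by simp
  also have "bform \<kappa> ?z ?z * bform \<kappa> u u = bform \<kappa> u u * bform \<kappa> v v - (bform \<kappa> u' v')\<^sup>2"
    using uu_pos by (simp add: bform_diff_left bform_diff_right bform_scaleR_left bform_scaleR_right
      bform_commute[of \<kappa> v' u'] uu vv power2_eq_square field_simps)
  finally show "(bform \<kappa> (B' p) (B' q) - c0)\<^sup>2 < \<rho>\<^sup>2" by (simp add: \<rho>_sq uv)
qed

end

section \<open>Varying one dihedral angle\<close>

context full_model_simplex_edge
begin

definition gram_of_angle :: "real \<Rightarrow> ((real, 'a) vec, 'a) vec" where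
  "gram_of_angle \<theta> = (\<chi> x y. if {x, y} = {p, q} then c0 + \<rho> * cos \<theta> else G x y)"

lemma gram_of_angle_iff:
  fixes B' :: "'a \<Rightarrow> real \<times> 'b"
  shows "gram_mat \<kappa> B' = gram_of_angle \<theta> \<longleftrightarrow>
    (\<forall>x y. {x, y} \<noteq> {p, q} \<longrightarrow> bform \<kappa> (B' x) (B' y) = G x y) \<and>
    bform \<kappa> (B' p) (B' q) = c0 + \<rho> * cos \<theta>" (is "?l \<longleftrightarrow> ?r")
proof
  assume l: ?l
  have "bform \<kappa> (B' x) (B' y) = gram_of_angle \<theta> $ x $ y" for x y
    using l by (metis gram_mat_nth)
  then show ?r by (simp add: gram_of_angle_def)
next
  assume r: ?r
  have "bform \<kappa> (B' x) (B' y) = gram_of_angle \<theta> $ x $ y" for x y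
  proof (cases "{x, y} = {p, q}")
    case True
    then have "(x = p \<and> y = q) \<or> (x = q \<and> y = p)" by (simp add: doubleton_eq_iff)
    then have "bform \<kappa> (B' x) (B' y) = bform \<kappa> (B' p) (B' q)"
      by (auto simp: bform_commute[of \<kappa> "B' q" "B' p"])
    then show ?thesis using r True by (simp add: gram_of_angle_def)
  next
    case False
    then show ?thesis using r by (simp add: gram_of_angle_def)
  qed
  then show ?l by (simp add: vec_eq_iff)
qed

text \<open>The strict inequality puts the normalised inner product into the open interval, where
  cos inverts arccos and the angle avoids 0 and pi.\<close>

lemma cos_dihedral_angle:
  fixes B' :: "'a \<Rightarrow> real \<times> 'b"
  assumes B': "nondeg_simplex \<kappa> UNIV B'"
    and same: "\<And>x y. {x, y} \<noteq> {p, q} \<Longrightarrow> bform \<kappa> (B' x) (B' y) = G x y"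
  defines "\<theta> \<equiv> dihedral_angle \<kappa> UNIV B' p q"
  shows "bform \<kappa> (B' p) (B' q) = c0 + \<rho> * cos \<theta>" "0 < \<theta>" "\<theta> < pi"
proof -
  let ?r = "(bform \<kappa> (B' p) (B' q) - c0) / \<rho>"
  have \<theta>: "\<theta> = arccos ?r" unfolding \<theta>_def by (rule dihedral_angle_eq(1)[OF B' same])
  have "\<bar>bform \<kappa> (B' p) (B' q) - c0\<bar> < \<bar>\<rho>\<bar>"
    by (rule power2_less_imp_less) (use dihedral_angle_eq(2)[OF B' same] in simp_all)
  then have r: "-1 < ?r" "?r < 1" using \<rho>_pos by (auto simp: divide_simps)
  then show "0 < \<theta>" "\<theta> < pi" unfolding \<theta> using arccos_lt_bounded by auto
  have "cos \<theta> = ?r" unfolding \<theta> using r by (intro cos_arccos) auto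
  then show "bform \<kappa> (B' p) (B' q) = c0 + \<rho> * cos \<theta>" using \<rho>_pos by (simp add: field_simps)
qed

definition "\<theta>0 = dihedral_angle \<kappa> UNIV B p q"

lemma \<theta>0_bounds: "0 < \<theta>0" "\<theta>0 < pi"
  unfolding \<theta>0_def using cos_dihedral_angle[OF nondeg] by auto

lemma gram_of_angle_self: "gram_of_angle \<theta>0 = gram_mat \<kappa> B"
proof -
  have "bform \<kappa> (B p) (B q) = c0 + \<rho> * cos \<theta>0"
    unfolding \<theta>0_def by (rule cos_dihedral_angle(1)[OF nondeg]) simp
  then show ?thesis using gram_of_angle_iff[of B \<theta>0] by simp
qed

text \<open>Any simplex with angle \<open>\<theta>\<close> and the other lengths unchanged has Gram
  matrix \<open>gram_of_angle \<theta>\<close>, so its volume is forced. Existence of one such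
  simplex is the hypothesis on \<open>B'\<close>.\<close>

lemma volume_of_angle_eq:
  fixes B' :: "'a \<Rightarrow> real \<times> 'b"
  assumes B': "nondeg_simplex \<kappa> UNIV B'" "gram_mat \<kappa> B' = gram_of_angle \<theta>" and \<theta>: "0 \<le> \<theta>" "\<theta> \<le> pi"
  shows "volume_of_angle \<kappa> UNIV B p q \<theta> = volume_of_gram \<kappa> (gram_of_angle \<theta>)"
  unfolding volume_of_angle_def
proof (rule the_equality)
  have same: "\<And>x y. {x, y} \<noteq> {p, q} \<Longrightarrow> bform \<kappa> (B' x) (B' y) = G x y"
    and pq': "bform \<kappa> (B' p) (B' q) = c0 + \<rho> * cos \<theta>"
    using B'(2) unfolding gram_of_angle_iff by auto
  have "dihedral_angle \<kappa> UNIV B' p q = \<theta>"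
    using dihedral_angle_eq(1)[OF B'(1) same] \<rho>_pos arccos_cos[OF \<theta>] by (simp add: pq')
  moreover have "volume_of_gram \<kappa> (gram_of_angle \<theta>) = simplex_volume \<kappa> UNIV B'"
    using simplex_volume_eq_volume_of_gram[OF curv B'(1)] B'(2) by simp
  moreover have "geodist \<kappa> (B' x) (B' y) = geodist \<kappa> (B x) (B y)" if "{x, y} \<noteq> {p, q}" for x y
    unfolding geodist_def same[OF that] ..
  ultimately show "\<exists>B' :: 'a \<Rightarrow> real \<times> 'b. nondeg_simplex \<kappa> UNIV B' \<and>
    (\<forall>a\<in>UNIV. \<forall>b\<in>UNIV. a \<noteq> b \<and> {a, b} \<noteq> {p, q} \<longrightarrow> geodist \<kappa> (B' a) (B' b) = geodist \<kappa> (B a) (B b)) \<and>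
    dihedral_angle \<kappa> UNIV B' p q = \<theta> \<and> volume_of_gram \<kappa> (gram_of_angle \<theta>) = simplex_volume \<kappa> UNIV B'"
    using B'(1) by (intro exI[of _ B']) simp
next
  fix V
  assume "\<exists>B' :: 'a \<Rightarrow> real \<times> 'b. nondeg_simplex \<kappa> UNIV B' \<and>
    (\<forall>a\<in>UNIV. \<forall>b\<in>UNIV. a \<noteq> b \<and> {a, b} \<noteq> {p, q} \<longrightarrow> geodist \<kappa> (B' a) (B' b) = geodist \<kappa> (B a) (B b)) \<and>
    dihedral_angle \<kappa> UNIV B' p q = \<theta> \<and> V = simplex_volume \<kappa> UNIV B'"
  then obtain C :: "'a \<Rightarrow> real \<times> 'b" where C: "nondeg_simplex \<kappa> UNIV C"
    "\<And>x y. x \<noteq> y \<Longrightarrow> {x, y} \<noteq> {p, q} \<Longrightarrow> geodist \<kappa> (C x) (C y) = geodist \<kappa> (B x) (B y)"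
    "dihedral_angle \<kappa> UNIV C p q = \<theta>" "V = simplex_volume \<kappa> UNIV C" by auto
  interpret C: full_model_simplex \<kappa> C
    using curv C(1) by (simp add: full_model_simplex_def model_simplex_def)
  have same: "bform \<kappa> (C x) (C y) = G x y" if "{x, y} \<noteq> {p, q}" for x y
  proof (cases "x = y")
    case True
    then show ?thesis using form_self[of y] C.form_self[of y] by simp
  next
    case False
    have "bform \<kappa> (C x) (C y) = gram_entry \<kappa> (geodist \<kappa> (C x) (C y))"
      by (rule gram_entry_geodist[OF curv C.in_model C.in_model, symmetric]) simp_all
    also have "\<dots> = gram_entry \<kappa> (geodist \<kappa> (B x) (B y))" using C(2)[OF False that] by simp
    also have "\<dots> = G x y" by (rule gram_entry_geodist[OF curv in_model in_model]) simp_all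
    finally show ?thesis .
  qed
  have "gram_mat \<kappa> C = gram_of_angle \<theta>"
    unfolding gram_of_angle_iff using same cos_dihedral_angle(1)[OF C(1) same] C(3) by simp
  then show "V = volume_of_gram \<kappa> (gram_of_angle \<theta>)"
    using simplex_volume_eq_volume_of_gram[OF curv C(1)] C(4) by simp
qed

lemma gram_of_angle_has_derivative:
  "(gram_of_angle has_derivative (\<lambda>h. \<chi> x y. if {x, y} = {p, q} then - (\<rho> * sin \<theta>) * h else 0)) (at \<theta>)"
  unfolding gram_of_angle_def[abs_def]
proof (intro has_derivative_vec_lambda)
  fix x y
  have "((\<lambda>\<theta>. c0 + \<rho> * cos \<theta>) has_real_derivative - (\<rho> * sin \<theta>)) (at \<theta>)"
    by (auto intro!: derivative_eq_intros)
  then have "((\<lambda>\<theta>. c0 + \<rho> * cos \<theta>) has_derivative (\<lambda>h. - (\<rho> * sin \<theta>) * h)) (at \<theta>)"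
    by (simp only: has_field_derivative_def)
  then show "((\<lambda>\<theta>. if {x, y} = {p, q} then c0 + \<rho> * cos \<theta> else G x y) has_derivative
      (\<lambda>h. if {x, y} = {p, q} then - (\<rho> * sin \<theta>) * h else 0)) (at \<theta>)"
    by (cases "{x, y} = {p, q}") (simp_all only: simp_thms if_True if_False has_derivative_const)
qed

text \<open>The matrix moves only in the entries (p, q) and (q, p); this is the source of the factor
  2 in the derivative by the angle.\<close>

lemma sum_edge_pair:
  "(\<Sum>x\<in>UNIV. \<Sum>y\<in>UNIV. f x y * (if {x, y} = {p, q} then c else 0)) = (f p q + f q p) * (c :: real)"
proof -
  have "f x y * (if {x, y} = {p, q} then c else 0) =
      (if x = p then (if y = q then f p q * c else 0) else 0) +
      (if x = q then (if y = p then f q p * c else 0) else 0)" for x y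
    using pq by (auto simp: doubleton_eq_iff)
  moreover have "(\<Sum>y\<in>UNIV. if x = s then (if y = r then d else 0) else 0) = (if x = s then d else 0)"
    for x s r :: 'a and d :: real by simp
  ultimately show ?thesis by (simp add: sum.distrib distrib_right)
qed

lemma volume_of_angle_has_derivative:
  "(volume_of_angle \<kappa> UNIV B p q has_real_derivative - (2 * edge_coeff p q * (\<rho> * sin \<theta>0))) (at \<theta>0)"
proof -
  have "((\<lambda>\<theta>. volume_of_gram \<kappa> (gram_of_angle \<theta>)) has_derivative
    (\<lambda>h. \<Sum>x\<in>UNIV. \<Sum>y\<in>UNIV. edge_coeff x y *
      (\<chi> x y. if {x, y} = {p, q} then - (\<rho> * sin \<theta>0) * h else 0) $ x $ y)) (at \<theta>0)"
    by (rule has_derivative_compose[OF gram_of_angle_has_derivative])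
      (simp only: gram_of_angle_self volume_of_gram_has_derivative)
  moreover have "(\<Sum>x\<in>UNIV. \<Sum>y\<in>UNIV. edge_coeff x y *
      (\<chi> x y. if {x, y} = {p, q} then - (\<rho> * sin \<theta>0) * h else 0) $ x $ y) =
      - (2 * edge_coeff p q * (\<rho> * sin \<theta>0)) * h" for h
    by (simp add: sum_edge_pair edge_coeff_sym[of q p] del: mult_minus_left)
  ultimately have d: "((\<lambda>\<theta>. volume_of_gram \<kappa> (gram_of_angle \<theta>)) has_derivative
      (\<lambda>h. - (2 * edge_coeff p q * (\<rho> * sin \<theta>0)) * h)) (at \<theta>0)" by (simp only:)
  have "isCont gram_of_angle \<theta>0" by (rule has_derivative_continuous[OF gram_of_angle_has_derivative])
  then have "(gram_of_angle \<longlongrightarrow> gram_of_angle \<theta>0) (nhds \<theta>0)"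
    by (simp only: isCont_def tendsto_at_iff_tendsto_nhds)
  then have "(gram_of_angle \<longlongrightarrow> gram_mat \<kappa> B) (nhds \<theta>0)" by (simp only: gram_of_angle_self)
  \<comment> \<open>For angles near \<open>\<theta>0\<close> a simplex with the prescribed Gram
    matrix exists, so the description of the volume has its intended value on a whole
    neighbourhood.\<close>
  then have real: "eventually (\<lambda>\<theta>. (\<forall>i j. gram_of_angle \<theta> $ i $ j = gram_of_angle \<theta> $ j $ i) \<longrightarrow>
    (\<forall>i. gram_of_angle \<theta> $ i $ i = \<kappa>) \<longrightarrow>
    (\<exists>B' :: 'a \<Rightarrow> real \<times> 'b. nondeg_simplex \<kappa> UNIV B' \<and> gram_mat \<kappa> B' = gram_of_angle \<theta>)) (nhds \<theta>0)"
    by (rule eventually_compose_filterlim[OF gram_realization])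
  have sym: "gram_of_angle \<theta> $ i $ j = gram_of_angle \<theta> $ j $ i" for \<theta> i j
    by (simp add: gram_of_angle_def insert_commute bform_commute[of \<kappa> "B i" "B j"])
  have diag: "gram_of_angle \<theta> $ i $ i = \<kappa>" for \<theta> i
    using pq form_self[of i] by (auto simp: gram_of_angle_def doubleton_eq_iff)
  have "eventually (\<lambda>\<theta>. \<theta> \<in> {0<..<pi}) (nhds \<theta>0)"
    using \<theta>0_bounds by (intro eventually_nhds_in_open) auto
  with real have ev: "eventually (\<lambda>\<theta>. volume_of_gram \<kappa> (gram_of_angle \<theta>) = volume_of_angle \<kappa> UNIV B p q \<theta>) (nhds \<theta>0)"
  proof eventually_elim
    case (elim \<theta>)
    then obtain B' :: "'a \<Rightarrow> real \<times> 'b" where "nondeg_simplex \<kappa> UNIV B'" "gram_mat \<kappa> B' = gram_of_angle \<theta>"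
      using sym diag by blast
    from volume_of_angle_eq[OF this] elim(2) show ?case by simp
  qed
  show ?thesis
    unfolding has_field_derivative_def
  proof (rule has_derivative_transform_eventually[OF d])
    show "\<forall>\<^sub>F \<theta> in at \<theta>0. volume_of_gram \<kappa> (gram_of_angle \<theta>) = volume_of_angle \<kappa> UNIV B p q \<theta>"
      and "volume_of_gram \<kappa> (gram_of_angle \<theta>0) = volume_of_angle \<kappa> UNIV B p q \<theta>0"
      using ev unfolding eventually_nhds_conv_at by auto
  qed simp
qed

text \<open>\<open>\<rho> * sin \<theta>0\<close> occurs twice: as the speed of the Gram entry, up
  to sign, and as the ratio of the two Gram norms. Multiplication by the norm of the face therefore
  leaves no trace of the angle.\<close>

lemma g_face_eq:
  "gram_norm \<kappa> (UNIV - {p, q}) B * g_face \<kappa> UNIV B p q =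
    - (fact (CARD('a) - 1) * (2 * gram_norm \<kappa> UNIV B * edge_coeff p q))"
proof -
  have "\<rho> * sin \<theta>0 = sqrt (\<rho>\<^sup>2 - (bform \<kappa> u v)\<^sup>2)"
  proof -
    have "bform \<kappa> u v = \<rho> * cos \<theta>0"
      using uv_eq cos_dihedral_angle(1)[OF nondeg] by (simp add: \<theta>0_def)
    then have "\<rho>\<^sup>2 - (bform \<kappa> u v)\<^sup>2 = (\<rho> * sin \<theta>0)\<^sup>2"
      by (simp add: power_mult_distrib sin_squared_eq algebra_simps)
    moreover have "0 \<le> \<rho> * sin \<theta>0" using \<rho>_pos \<theta>0_bounds by (simp add: sin_ge_zero)
    ultimately show ?thesis by simp
  qed
  then have n: "gram_norm \<kappa> UNIV B = gram_norm \<kappa> (UNIV - {p, q}) B * (\<rho> * sin \<theta>0)"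
    using gram_norm_factor by (simp add: F_def)
  have "deriv (volume_of_angle \<kappa> UNIV B p q) \<theta>0 = - (2 * edge_coeff p q * (\<rho> * sin \<theta>0))"
    by (rule DERIV_imp_deriv[OF volume_of_angle_has_derivative])
  then show ?thesis by (simp add: g_face_def \<theta>0_def[symmetric] n mult_ac)
qed

end

theorem proposition2p11:
  fixes \<kappa> :: real
    and k :: nat
    and G :: "'v::{finite,linorder} \<Rightarrow> real \<times> 'a::euclidean_space"
  assumes curvature: "\<kappa> = 1 \<or> \<kappa> = -1"
    and k_ge_2: "k \<ge> 2"
    and vertices: "CARD('v) = k + 1"
    and simplex: "nondeg_simplex \<kappa> UNIV G"
  shows "as_function_of_lengths \<kappa> (simplex_volume \<kappa> UNIV :: ('v \<Rightarrow> real \<times> 'a) \<Rightarrow> real)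
           (edge_lengths \<kappa> G) = simplex_volume \<kappa> UNIV G
    \<and> (\<exists>dV dc.
          (as_function_of_lengths \<kappa> (simplex_volume \<kappa> UNIV :: ('v \<Rightarrow> real \<times> 'a) \<Rightarrow> real)
             has_derivative dV) (at (edge_lengths \<kappa> G))
        \<and> (\<forall>i j. i < j \<longrightarrow>
             (as_function_of_lengths \<kappa> (\<lambda>B :: 'v \<Rightarrow> real \<times> 'a. sqdist \<kappa> (B i) (B j))
                has_derivative dc i j) (at (edge_lengths \<kappa> G)))
        \<and> (\<forall>h. 2 * fact k * gram_norm \<kappa> UNIV G * dV h =
             (\<Sum>(i, j) \<in> {(i, j). i < j}.
                gram_norm \<kappa> (UNIV - {i, j}) G * g_face \<kappa> UNIV G i j * dc i j h)))
    \<and> (\<forall>i j. i \<noteq> j \<longrightarrow>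
          \<kappa> * gram_norm \<kappa> (UNIV - {i, j}) G * g_face \<kappa> UNIV G i j =
          real k * fact (k - 2) *
            (\<Sum>(p, q) \<in> {(p, q). p < q}.
               Rcoef2 \<kappa> G UNIV p q i j * gram_norm \<kappa> (UNIV - {p, q}) G *
                 simplex_volume \<kappa> (UNIV - {p, q}) G))"
proof (intro conjI)
  interpret S: full_model_simplex \<kappa> G
    using curvature simplex by (simp add: full_model_simplex_def model_simplex_def)
  let ?w = S.edge_coeff
  let ?s = "gram_norm \<kappa> UNIV G"
  have vol: "simplex_volume \<kappa> UNIV B = volume_of_gram \<kappa> (gram_mat \<kappa> B)"
    if "nondeg_simplex \<kappa> UNIV B" for B :: "'v \<Rightarrow> real \<times> 'a"
    by (rule simplex_volume_eq_volume_of_gram[OF curvature that])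
  have g: "gram_norm \<kappa> (UNIV - {i, j}) G * g_face \<kappa> UNIV G i j = - (fact k * (2 * ?s * ?w i j))"
    if "i \<noteq> j" for i j
  proof -
    interpret E: full_model_simplex_edge \<kappa> G i j
      using that k_ge_2 vertices by unfold_locales auto
    show ?thesis using E.g_face_eq vertices by simp
  qed
  show "as_function_of_lengths \<kappa> (simplex_volume \<kappa> UNIV :: ('v \<Rightarrow> real \<times> 'a) \<Rightarrow> real) (edge_lengths \<kappa> G) =
      simplex_volume \<kappa> UNIV G"
    using S.as_function_of_lengths_eq[where \<Phi> = "simplex_volume \<kappa> UNIV" and \<phi> = "volume_of_gram \<kappa>",
        OF vol simplex refl] vol[OF simplex] by (simp add: S.gram_of_lengths_self)
  let ?Y = "\<lambda>h. \<chi> i j. if i = j then 0 else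
      gram_entry_deriv \<kappa> (S.lengths $ min i j $ max i j) * h $ min i j $ max i j"
  let ?dV = "\<lambda>h. \<Sum>i\<in>UNIV. \<Sum>j\<in>UNIV. ?w i j * ?Y h $ i $ j"
  \<comment> \<open>The squared chord is 2 \<kappa> minus twice the Gram entry, since both points
    have square \<kappa>.\<close>
  let ?dc = "\<lambda>i j h. - 2 * ?Y h $ i $ j"
  have "(as_function_of_lengths \<kappa> (simplex_volume \<kappa> UNIV :: ('v \<Rightarrow> real \<times> 'a) \<Rightarrow> real)
      has_derivative ?dV) (at (edge_lengths \<kappa> G))"
    by (rule S.as_function_of_lengths_has_derivative[OF vol S.volume_of_gram_has_derivative])
  moreover have "(as_function_of_lengths \<kappa> (\<lambda>B :: 'v \<Rightarrow> real \<times> 'a. sqdist \<kappa> (B i) (B j))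
      has_derivative ?dc i j) (at (edge_lengths \<kappa> G))" for i j
  proof (rule S.as_function_of_lengths_has_derivative[where \<phi> = "\<lambda>X. 2 * \<kappa> - 2 * X $ i $ j" and D = "\<lambda>H. - 2 * H $ i $ j"])
    fix B :: "'v \<Rightarrow> real \<times> 'a" assume B: "nondeg_simplex \<kappa> UNIV B"
    interpret B: full_model_simplex \<kappa> B
      using curvature B by (simp add: full_model_simplex_def model_simplex_def)
    show "sqdist \<kappa> (B i) (B j) = 2 * \<kappa> - 2 * gram_mat \<kappa> B $ i $ j"
      using B.form_self[of i] B.form_self[of j]
      by (simp add: sqdist_def bform_diff_left bform_diff_right bform_commute[of \<kappa> "B j" "B i"])
  next
    have "((\<lambda>X :: ((real, 'v) vec, 'v) vec. X $ i $ j) has_derivative (\<lambda>H. H $ i $ j)) (at (gram_mat \<kappa> G))"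
      by (intro bounded_linear.has_derivative[OF bounded_linear_vec_nth] has_derivative_ident)
    then show "((\<lambda>X. 2 * \<kappa> - 2 * X $ i $ j) has_derivative (\<lambda>H. - 2 * H $ i $ j)) (at (gram_mat \<kappa> G))"
      by (auto intro!: derivative_eq_intros)
  qed
  moreover have "2 * fact k * ?s * ?dV h = (\<Sum>(i, j) \<in> {(i, j). i < j}.
      gram_norm \<kappa> (UNIV - {i, j}) G * g_face \<kappa> UNIV G i j * ?dc i j h)" for h
  proof -
    have "?dV h = (\<Sum>(i, j)\<in>{(i, j). i < j}. ?w i j * ?Y h $ i $ j + ?w j i * ?Y h $ j $ i)"
      by (rule sum_off_diagonal) simp
    \<comment> \<open>The entries (i, j) and (j, i) depend on the same length and have equal
      coefficients, so each edge counts twice.\<close>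
    also have "\<dots> = (\<Sum>(i, j)\<in>{(i, j). i < j}. 2 * ?w i j * ?Y h $ i $ j)"
      by (rule sum.cong) (auto simp: S.edge_coeff_sym[of _ _] min.commute max.commute)
    finally have "2 * fact k * ?s * ?dV h =
        (\<Sum>(i, j)\<in>{(i, j). i < j}. 2 * fact k * ?s * (2 * ?w i j * ?Y h $ i $ j))"
      by (simp only: sum_distrib_left case_prod_unfold)
    also have "\<dots> = (\<Sum>(i, j) \<in> {(i, j). i < j}.
      gram_norm \<kappa> (UNIV - {i, j}) G * g_face \<kappa> UNIV G i j * ?dc i j h)"
    proof (rule sum.cong[OF refl], clarify)
      fix i j :: 'v assume "i < j"
      then have "gram_norm \<kappa> (UNIV - {i, j}) G * g_face \<kappa> UNIV G i j = - (fact k * (2 * ?s * ?w i j))"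
        by (intro g) simp
      then show "2 * fact k * ?s * (2 * ?w i j * ?Y h $ i $ j) =
          gram_norm \<kappa> (UNIV - {i, j}) G * g_face \<kappa> UNIV G i j * ?dc i j h"
        by (simp only:) simp
    qed
    finally show ?thesis .
  qed
  ultimately show "\<exists>dV dc.
          (as_function_of_lengths \<kappa> (simplex_volume \<kappa> UNIV :: ('v \<Rightarrow> real \<times> 'a) \<Rightarrow> real)
             has_derivative dV) (at (edge_lengths \<kappa> G))
        \<and> (\<forall>i j. i < j \<longrightarrow>
             (as_function_of_lengths \<kappa> (\<lambda>B :: 'v \<Rightarrow> real \<times> 'a. sqdist \<kappa> (B i) (B j))
                has_derivative dc i j) (at (edge_lengths \<kappa> G)))
        \<and> (\<forall>h. 2 * fact k * gram_norm \<kappa> UNIV G * dV h =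
             (\<Sum>(i, j) \<in> {(i, j). i < j}.
                gram_norm \<kappa> (UNIV - {i, j}) G * g_face \<kappa> UNIV G i j * dc i j h))"
    by (intro exI[of _ ?dV] exI[of _ ?dc] conjI allI impI)
  show "\<forall>i j. i \<noteq> j \<longrightarrow>
          \<kappa> * gram_norm \<kappa> (UNIV - {i, j}) G * g_face \<kappa> UNIV G i j =
          real k * fact (k - 2) *
            (\<Sum>(p, q) \<in> {(p, q). p < q}.
               Rcoef2 \<kappa> G UNIV p q i j * gram_norm \<kappa> (UNIV - {p, q}) G *
                 simplex_volume \<kappa> (UNIV - {p, q}) G)"
  proof (intro allI impI)
    fix i j :: 'v assume ij: "i \<noteq> j"
    let ?S = "\<Sum>(p, q) \<in> {(p, q). p < q}. Rcoef2 \<kappa> G UNIV p q i j * gram_norm \<kappa> (UNIV - {p, q}) G *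
                 simplex_volume \<kappa> (UNIV - {p, q}) G"
    have "2 * (real CARD('v) - 2) * ?s * ?w i j = - \<kappa> * ?S"
      using S.edge_coeff_eq[of i j] k_ge_2 vertices
        S.sum_ordered_pairs_Rcoef2[of i j "\<lambda>F. gram_norm \<kappa> F G * simplex_volume \<kappa> F G"]
      by (simp add: mult.assoc)
    then have w: "(real k - 1) * (2 * ?s * ?w i j) = - \<kappa> * ?S" by (simp add: vertices algebra_simps)
    \<comment> \<open>The factor k - 1 split off here is the one supplied by the radial constants,
      so that k (k - 2)! remains.\<close>
    have fact_k: "(fact k :: real) = real k * (real k - 1) * fact (k - 2)"
    proof -
      obtain l where l: "k = Suc (Suc l)" using k_ge_2 by (metis add_2_eq_Suc le_Suc_ex)
      then show ?thesis by (simp add: algebra_simps)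
    qed
    have "\<kappa> * gram_norm \<kappa> (UNIV - {i, j}) G * g_face \<kappa> UNIV G i j = - \<kappa> * fact k * (2 * ?s * ?w i j)"
      using g[OF ij] by (simp add: mult.assoc)
    also have "\<dots> = - \<kappa> * (real k * fact (k - 2)) * ((real k - 1) * (2 * ?s * ?w i j))"
      by (simp add: fact_k mult_ac)
    also have "\<dots> = real k * fact (k - 2) * ?S"
      unfolding w using curvature by auto
    finally show "\<kappa> * gram_norm \<kappa> (UNIV - {i, j}) G * g_face \<kappa> UNIV G i j = real k * fact (k - 2) * ?S" .
  qed
qed

end
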